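(* Let $\mathcal{H}\cong\mathbb{C}^d$, let $\mathcal{F}_0=\{f_i\}_{i=1}^{n_0}\in\mathcal{H}^{n_0}$, let $n>n_0$ be an integer, $k=n-n_0$, and assume $\operatorname{rk}S_{\mathcal{F}_0}\ge d-k$. Let $\mathbf{a}=(\alpha_i)_{i=1}^n\in\mathbb{R}_{>0}^n$ with $\|f_i\|^2=\alpha_i$ for $1\le i\le n_0$. Let $\mathbf{b}=(\alpha_i)_{i=n_0+1}^n$, $t=\sum_{i=1}^n\alpha_i$, $S_0=S_{\mathcal{F}_0}$, $\lambda=\lambda(S_0)$, $m=d-k$, and let $\nu=\nu(\mathcal{F}_0,\mathbf{a})$, $r=r(\mathcal{F}_0,\mathbf{a})$, $\mu=\mu(\mathcal{F}_0,\mathbf{a})$ be as defined in the context. Assume that $\mathbf{b}\prec\mu$. Then: \begin{enumerate} \item $\nu\in\Lambda_{\mathbf{a}}(\mathcal{F}_0)$. \item $\nu\prec\beta$ for every other $\beta\in\Lambda_{\mathbf{a}}(\mathcal{F}_0)$. \item Given $\mathcal{F}_1=\{f_i\}_{i=n_0+1}^n\in\mathcal{H}^k$ such that $\mathcal{F}=(\mathcal{F}_0,\mathcal{F}_1)\in\mathcal{C}_{\mathbf{a}}(\mathcal{F}_0)$, the following are equivalent: (a) $\lambda(S_{\mathcal{F}})=\nu$ (i.e. $S_{\mathcal{F}}$ is $\prec$-minimal in $\mathcal{SC}_{\mathbf{a}}(\mathcal{F}_0)$); (b) there exists an orthonormal basis $\{h_i\}_{i=1}^d$ of eigenvectors for $S_0,\lambda$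 such that $$S_{\mathcal{F}_1}=B=\sum_{i=1}^{d-r}\mu_i\,h_{r+i}\otimes h_{r+i}.$$ Such an $\mathcal{F}_1$ exists. \item Moreover, if one of the following conditions holds: $m\le0$; or $m\ge1$ and $\lambda_m>\lambda_{m+1}$; or $m\ge1$, $\lambda_m=\lambda_{m+1}$ and $t\le s^*(\lambda,m)$; then (a) any orthonormal basis of eigenvectors for $S_0,\lambda$ produces the same operator $B$ via the formula in 3(b); (b) any $\mathcal{F}=(\mathcal{F}_0,\mathcal{F}_1)\in\mathcal{C}_{\mathbf{a}}(\mathcal{F}_0)$ satisfies: $\lambda(S_{\mathcal{F}})=\nu$ if and only if $S_{\mathcal{F}_1}=B$. \end{enumerate}
   Context: For a finite sequence $\mathcal{G}=\{g_i\}$ in $\mathcal{H}$, its frame operator is $S_{\mathcal{G}}=\sum_i g_i\otimes g_i$, where $(x\otimes y)z=\langle z,y\rangle x$. $\mathbf{F}(n,d)$ is the set of $(n,d)$-frames, i.e. sequences of $n$ vectors spanning $\mathcal{H}$. $\lambda(S)$ is the vector of eigenvalues of a positive semidefinite $S$ counted with multiplicity in decreasing order. An "orthonormal basis of eigenvectors for $S_0,\lambda$" is an orthonormal basis $\{h_i\}_{i=1}^d$ with $S_0h_i=\lambda_ih_i$. Majorization: $x\prec y$ means $\sum_{i\le j}x_i^\downarrow\le\sum_{i\le j}y_i^\downarrow$ for all $j$, with equality of total sums ($\downarrow$ = decreasing rearrangement); vectors with nonnegative entries of different lengths are compared after completing the shorter one with zeros. For matrices, $\prec$ is majorization of the eigenvalue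 vectors. $$\mathcal{C}_{\mathbf{a}}(\mathcal{F}_0)=\{\{f_i\}_{i=1}^n\in\mathbf{F}(n,d):\ \{f_i\}_{i=1}^{n_0}=\mathcal{F}_0,\ \|f_i\|^2=\alpha_i\text{ for }i\ge n_0+1\},$$ $\mathcal{SC}_{\mathbf{a}}(\mathcal{F}_0)=\{S_{\mathcal{F}}:\mathcal{F}\in\mathcal{C}_{\mathbf{a}}(\mathcal{F}_0)\}$ and $\Lambda_{\mathbf{a}}(\mathcal{F}_0)=\{\lambda(S):S\in\mathcal{SC}_{\mathbf{a}}(\mathcal{F}_0)\}$. Let $\lambda\in\mathbb{R}^d$ have nonnegative decreasing entries, $t_0=\sum_i\lambda_i$. For $t\ge t_0$ and $q\in\{0,\dots,d-1\}$ let $p_\lambda(q,t)=\frac{t-\sum_{j=1}^q\lambda_j}{d-q}$, and $$r_\lambda(t)=\min\{q\in\{0,\dots,d-1\}:p_\lambda(q,t)\ge\lambda_{q+1}\},\qquad c_\lambda(t)=p_\lambda(r_\lambda(t),t).$$ For $1\le m\le d-1$ let $s^*=s^*(\lambda,m)=\sum_{i=1}^m\lambda_i+(d-m)\lambda_m$, $s^{**}=(d-m)\lambda_1+\sum_{j=1}^m\lambda_j$, and for $t\ge t_0$ $$c_{\lambda,m}(t)=\begin{cases}c_\lambda(t)& t\le s^*\\ \lambda_m+\frac{t-s^*}{d-m}& t>s^*\end{cases},\qquad r_{\lambda,m}(t)=\min\{q\in\{0,\dots,d-1\}:c_{\lambda,m}(t)\ge\lambda_{q+1}\}.$$ For $m\le0$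 set $c_{\lambda,m}=c_\lambda$ and $r_{\lambda,m}=r_\lambda$. With $\lambda=\lambda(S_{\mathcal{F}_0})$, $m=d-k$, $t=\sum_i\alpha_i$, put $c=c_{\lambda,m}(t)$, $\rho=r_{\lambda,m}(t)$, $r=r(\mathcal{F}_0,\mathbf{a})=\max\{r_{\lambda,m}(t),m\}$, $\mu=\mu(\mathcal{F}_0,\mathbf{a})=(c-\lambda_{r+j})_{j=1}^{d-r}$ (so $d-r\le k$), and, with $\mathbf{1}_q$ the all-ones vector of length $q$, define $\nu=\nu(\mathcal{F}_0,\mathbf{a})\in\mathbb{R}^d$ by: $\nu=(\lambda_1,\dots,\lambda_\rho,c\,\mathbf{1}_{d-\rho})$ if $m\le0$, or if $m\ge1$ and $t\le s^*$; $\nu=(\lambda_1,\dots,\lambda_\rho,c\,\mathbf{1}_{d-m},\lambda_{\rho+1},\dots,\lambda_m)$ if $m\ge1$ and $s^*<t<s^{**}$; $\nu=(c\,\mathbf{1}_{d-m},\lambda_1,\dots,\lambda_m)$ if $m\ge1$ and $t\ge s^{**}$. *)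

theory Defs
  imports
    "Jordan_Normal_Form.Schur_Decomposition"
    "Jordan_Normal_Form.DL_Rank"
    "HOL-Computational_Algebra.Fundamental_Theorem_Algebra"
begin

text \<open>
  The Hilbert space is \<open>carrier_vec d\<close> over the complex numbers with the inner product
  \<open>\<langle>x, y\<rangle> = x \<bullet>c y\<close>; operators are identified with their \<open>d \<times> d\<close> matrices. Finite sequences are
  lists, so the entry \<open>x\<^sub>i\<close> of a sequence indexed from 1 is \<open>x ! (i - 1)\<close>.
\<close>

definition norm_sq :: "complex vec \<Rightarrow> real" where
  "norm_sq x = Re (x \<bullet>c x)"

text \<open>The matrix of \<open>z \<mapsto> \<langle>z, y\<rangle> x\<close>.\<close>
definition tensor :: "complex vec \<Rightarrow> complex vec \<Rightarrow> complex mat" where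
  "tensor x y = mat (dim_vec x) (dim_vec y) (\<lambda>(i, j). x $ i * conjugate (y $ j))"

definition mat_sum :: "nat \<Rightarrow> complex mat list \<Rightarrow> complex mat" where
  "mat_sum d As = foldr (+) As (0\<^sub>m d d)"

definition frame_op :: "nat \<Rightarrow> complex vec list \<Rightarrow> complex mat" where
  "frame_op d gs = mat_sum d (map (\<lambda>g. tensor g g) gs)"

definition spans :: "nat \<Rightarrow> complex vec list \<Rightarrow> bool" where
  "spans d gs \<longleftrightarrow> LinearCombinations.module.span class_ring (module_vec TYPE(complex) d) (set gs)
     = carrier_vec d"

definition frames :: "nat \<Rightarrow> nat \<Rightarrow> complex vec list set" where
  "frames n d = {gs. length gs = n \<and> set gs \<subseteq> carrier_vec d \<and> spans d gs}"

definition decr :: "real list \<Rightarrow> real list" where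
  "decr x = rev (sort x)"

text \<open>
  The eigenvalues with multiplicity, in decreasing order. This is used for positive semidefinite
  matrices only, whose eigenvalues are real, so that \<open>Re\<close> loses nothing.
\<close>
definition eigs :: "complex mat \<Rightarrow> real list" where
  "eigs A = rev (sorted_list_of_multiset (image_mset Re (proots (char_poly A))))"

definition pad :: "nat \<Rightarrow> real list \<Rightarrow> real list" where
  "pad N x = x @ replicate (N - length x) 0"

text \<open>
  Lists of equal length are compared as they are. Lists of different lengths, which are meant to
  have nonnegative entries, are compared after completing the shorter one with zeros.
\<close>
definition majorized :: "real list \<Rightarrow> real list \<Rightarrow> bool" (infix "\<prec>\<^sub>m" 50) where
  "x \<prec>\<^sub>m y \<longleftrightarrow>
     (let N = max (length x) (length y); x' = decr (pad N x); y' = decr (pad N y)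
      in (\<forall>j\<le>N. sum_list (take j x') \<le> sum_list (take j y')) \<and> sum_list x' = sum_list y')"

definition mat_majorized :: "complex mat \<Rightarrow> complex mat \<Rightarrow> bool" where
  "mat_majorized A B \<longleftrightarrow> eigs A \<prec>\<^sub>m eigs B"

definition completions :: "nat \<Rightarrow> complex vec list \<Rightarrow> real list \<Rightarrow> complex vec list set" where
  "completions d F0 a = {fs \<in> frames (length a) d. take (length F0) fs = F0 \<and>
     (\<forall>i. length F0 \<le> i \<and> i < length a \<longrightarrow> norm_sq (fs ! i) = a ! i)}"

definition completion_ops :: "nat \<Rightarrow> complex vec list \<Rightarrow> real list \<Rightarrow> complex mat set" where
  "completion_ops d F0 a = frame_op d ` completions d F0 a"

definition completion_spectra :: "nat \<Rightarrow> complex vec list \<Rightarrow> real list \<Rightarrow> real list set" where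
  "completion_spectra d F0 a = eigs ` completion_ops d F0 a"

text \<open>In the definitions of the optimal spectral data, \<open>d = length lam\<close>.\<close>

definition p_lam :: "real list \<Rightarrow> nat \<Rightarrow> real \<Rightarrow> real" where
  "p_lam lam q t = (t - (\<Sum>j<q. lam ! j)) / (real (length lam) - real q)"

definition r_lam :: "real list \<Rightarrow> real \<Rightarrow> nat" where
  "r_lam lam t = Min {q. q < length lam \<and> p_lam lam q t \<ge> lam ! q}"

definition c_lam :: "real list \<Rightarrow> real \<Rightarrow> real" where
  "c_lam lam t = p_lam lam (r_lam lam t) t"

text \<open>
  The integer \<open>m\<close> may be nonpositive. \<open>s_star\<close> and \<open>s_star_star\<close> are only meant for
  \<open>1 \<le> m \<le> d - 1\<close>, and \<open>\<lambda>\<^sub>m\<close> is \<open>lam ! (nat m - 1)\<close>.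
\<close>
definition s_star :: "real list \<Rightarrow> int \<Rightarrow> real" where
  "s_star lam m = (\<Sum>i<nat m. lam ! i) + (real (length lam) - of_int m) * lam ! (nat m - 1)"

definition s_star_star :: "real list \<Rightarrow> int \<Rightarrow> real" where
  "s_star_star lam m = (real (length lam) - of_int m) * lam ! 0 + (\<Sum>j<nat m. lam ! j)"

definition c_lam_m :: "real list \<Rightarrow> int \<Rightarrow> real \<Rightarrow> real" where
  "c_lam_m lam m t =
     (if m \<le> 0 \<or> t \<le> s_star lam m then c_lam lam t
      else lam ! (nat m - 1) + (t - s_star lam m) / (real (length lam) - of_int m))"

definition r_lam_m :: "real list \<Rightarrow> int \<Rightarrow> real \<Rightarrow> nat" where
  "r_lam_m lam m t =
     (if m \<le> 0 then r_lam lam t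
      else Min {q. q < length lam \<and> c_lam_m lam m t \<ge> lam ! q})"

definition r_opt :: "real list \<Rightarrow> int \<Rightarrow> real \<Rightarrow> nat" where
  "r_opt lam m t = max (r_lam_m lam m t) (nat m)"

definition mu_opt :: "real list \<Rightarrow> int \<Rightarrow> real \<Rightarrow> real list" where
  "mu_opt lam m t = map (\<lambda>i. c_lam_m lam m t - lam ! i) [r_opt lam m t..<length lam]"

definition nu_opt :: "real list \<Rightarrow> int \<Rightarrow> real \<Rightarrow> real list" where
  "nu_opt lam m t =
     (let d = length lam; c = c_lam_m lam m t; \<rho> = r_lam_m lam m t in
      if m \<le> 0 \<or> t \<le> s_star lam m then take \<rho> lam @ replicate (d - \<rho>) c
      else if t < s_star_star lam m
        then take \<rho> lam @ replicate (d - nat m) c @ drop \<rho> (take (nat m) lam)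
      else replicate (d - nat m) c @ take (nat m) lam)"

definition orthonormal_basis :: "nat \<Rightarrow> complex vec list \<Rightarrow> bool" where
  "orthonormal_basis d hs \<longleftrightarrow> length hs = d \<and> set hs \<subseteq> carrier_vec d \<and> spans d hs \<and>
     (\<forall>i<d. \<forall>j<d. hs ! i \<bullet>c hs ! j = (if i = j then 1 else 0))"

definition eigenbasis :: "nat \<Rightarrow> complex mat \<Rightarrow> real list \<Rightarrow> complex vec list \<Rightarrow> bool" where
  "eigenbasis d S lam hs \<longleftrightarrow> orthonormal_basis d hs \<and>
     (\<forall>i<d. S *\<^sub>v (hs ! i) = complex_of_real (lam ! i) \<cdot>\<^sub>v (hs ! i))"

text \<open>The operator \<open>\<Sum>\<^sub>i \<mu>\<^sub>i h\<^sub>r\<^sub>+\<^sub>i \<otimes> h\<^sub>r\<^sub>+\<^sub>i\<close>, with \<open>i\<close> running from 1 to \<open>d - r\<close>.\<close>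
definition opt_op :: "nat \<Rightarrow> nat \<Rightarrow> real list \<Rightarrow> complex vec list \<Rightarrow> complex mat" where
  "opt_op d r mu hs = mat_sum d
     (map (\<lambda>i. complex_of_real (mu ! i) \<cdot>\<^sub>m tensor (hs ! (r + i)) (hs ! (r + i))) [0..<d - r])"

end

theory Submission
  imports Defs "Jordan_Normal_Form.Spectral_Radius"
begin

text \<open>
  A completion adds to \<open>S\<^sub>0\<close> a positive operator \<open>B\<close> of rank at most \<open>k\<close>, so the spectrum \<open>\<beta>\<close> of the
  sum satisfies \<open>\<lambda>\<^sub>i \<le> \<beta>\<^sub>i\<close> and \<open>\<beta>\<^sub>k\<^sub>+\<^sub>i \<le> \<lambda>\<^sub>i\<close>. Together with the trace these inequalities already force
  \<open>\<nu> \<prec> \<beta>\<close>. The spectrum \<open>\<nu>\<close> is attained: by rotating pairs of vectors, an orthogonal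
  system with squared norms \<open>\<mu>\<close> is changed into one with squared norms \<open>b\<close> and the same frame operator.
  For the equality case, Ky Fan type trace inequalities, applied to the eigenvectors of \<open>S\<^sub>0\<close> with
  eigenvalue above \<open>c\<close> and to a system of vectors orthogonal to these and to \<open>F\<^sub>1\<close>, show that every vector of
  \<open>F\<^sub>1\<close> is an eigenvector of \<open>S\<close> with eigenvalue \<open>c\<close>. Hence \<open>B\<close> commutes with \<open>S\<^sub>0\<close>, and in a common
  eigenbasis the eigenvalue of \<open>B\<close> is \<open>0\<close> or completes that of \<open>S\<^sub>0\<close> to \<open>c\<close>; counting
  multiplicities identifies \<open>B\<close>.
\<close>

section \<open>Operators given by weighted sums of rank-one projections\<close>

text \<open>The three branches of \<open>nu_opt\<close> have one common shape. With
  \<open>rho\<close> the number of eigenvalues above \<open>c\<close>, there is an index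
  \<open>R\<close> such that the optimal operator keeps the first \<open>R\<close> eigenvalues of
  \<open>S0\<close> and raises the others to \<open>c\<close>; either \<open>R = rho\<close>, or
  \<open>R + k = d\<close>. In the first case nothing below \<open>c\<close> is kept and the lower
  bounds on \<open>beta\<close> suffice; in the second, kept eigenvalues may lie below
  \<open>c\<close>, and the bound on the rank of \<open>B\<close> controls them. Listed along an
  eigenbasis of \<open>S0\<close>, this spectrum may fail to be decreasing. Operators are therefore
  handled through weights on a basis, and spectra are compared as multisets; sorting matters only
  for majorization and interlacing. Uniqueness of \<open>B\<close> fails for one reason:
  \<open>lam ! (R - 1) = lam ! R\<close> below \<open>c\<close>, where an eigenspace has to be split
  into a kept and a raised part. The conditions of the last claim exclude this and make
  \<open>B\<close> a function of \<open>S0\<close>. The rank hypothesis serves the spanning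
  condition: it makes the kept eigenvalues positive.\<close>

lemma cscalar_prod_sum:
  assumes "x \<in> carrier_vec d" "y \<in> carrier_vec d"
  shows "x \<bullet>c y = (\<Sum>a<d. x $ a * cnj (y $ a))"
  using assms by (simp add: scalar_prod_def atLeast0LessThan)

lemma cnj_cscalar_prod:
  assumes "x \<in> carrier_vec d" "y \<in> carrier_vec d"
  shows "cnj (x \<bullet>c y) = y \<bullet>c x"
  using assms by (simp add: cscalar_prod_sum[of _ d] mult.commute)

lemma norm_sq_sum:
  assumes "x \<in> carrier_vec d"
  shows "norm_sq x = (\<Sum>a<d. (cmod (x $ a))\<^sup>2)"
  using assms unfolding norm_sq_def
  by (simp add: cscalar_prod_sum[of _ d] complex_norm_square[symmetric] del: of_real_power)

lemma cscalar_prod_self: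
  assumes "x \<in> carrier_vec d"
  shows "x \<bullet>c x = complex_of_real (norm_sq x)"
  using assms by (simp add: cscalar_prod_sum[of _ d] norm_sq_sum[of _ d] complex_norm_square[symmetric])

lemma norm_sq_nonneg: "norm_sq x \<ge> 0"
  by (simp add: norm_sq_sum[of x "dim_vec x"] sum_nonneg)

lemma norm_sq_eq_0_iff:
  assumes "x \<in> carrier_vec d"
  shows "norm_sq x = 0 \<longleftrightarrow> x = 0\<^sub>v d"
  using assms by (auto simp: norm_sq_sum[of _ d] sum_nonneg_eq_0_iff intro!: eq_vecI)

lemma cscalar_prod_smult_right:
  assumes "x \<in> carrier_vec d" "y \<in> carrier_vec d"
  shows "x \<bullet>c (z \<cdot>\<^sub>v y) = cnj z * (x \<bullet>c y)"
  using assms by (simp add: cscalar_prod_sum[of _ d] sum_distrib_left mult_ac)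

lemma cscalar_prod_smult_left:
  fixes x y :: "complex vec"
  assumes "x \<in> carrier_vec d" "y \<in> carrier_vec d"
  shows "(z \<cdot>\<^sub>v x) \<bullet>c y = z * (x \<bullet>c y)"
  using assms by (simp add: cscalar_prod_sum[of _ d] sum_distrib_left mult_ac)

definition hermitian :: "nat \<Rightarrow> complex mat \<Rightarrow> bool" where
  "hermitian d A \<longleftrightarrow> A \<in> carrier_mat d d \<and> (\<forall>i<d. \<forall>j<d. A $$ (i, j) = cnj (A $$ (j, i)))"

lemma hermitian_index:
  "hermitian d A \<Longrightarrow> i < d \<Longrightarrow> j < d \<Longrightarrow> A $$ (i, j) = cnj (A $$ (j, i))"
  unfolding hermitian_def by blast

lemma mult_mat_vec_index:
  assumes "A \<in> carrier_mat n d" "x \<in> carrier_vec d" "i < n"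
  shows "(A *\<^sub>v x) $ i = (\<Sum>j<d. A $$ (i, j) * x $ j)"
  using assms by (simp add: scalar_prod_def atLeast0LessThan)

lemma mult_mat_index:
  assumes "A \<in> carrier_mat n d" "B \<in> carrier_mat d p" "i < n" "j < p"
  shows "(A * B) $$ (i, j) = (\<Sum>l<d. A $$ (i, l) * B $$ (l, j))"
  using assms by (simp add: scalar_prod_def atLeast0LessThan)

lemma hermitian_cscalar_prod:
  assumes "hermitian d A" "x \<in> carrier_vec d" "y \<in> carrier_vec d"
  shows "(A *\<^sub>v x) \<bullet>c y = x \<bullet>c (A *\<^sub>v y)"
proof -
  have A: "A \<in> carrier_mat d d" using assms by (simp add: hermitian_def)
  have "(A *\<^sub>v x) \<bullet>c y = (\<Sum>i<d. \<Sum>j<d. A $$ (i, j) * x $ j * cnj (y $ i))"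
    using assms A by (simp add: cscalar_prod_sum[of _ d] mult_mat_vec_index[OF A] sum_distrib_right del: index_mult_mat_vec)
  also have "\<dots> = (\<Sum>j<d. \<Sum>i<d. A $$ (i, j) * x $ j * cnj (y $ i))"
    by (rule sum.swap)
  also have "\<dots> = (\<Sum>j<d. \<Sum>i<d. x $ j * cnj (A $$ (j, i) * y $ i))"
  proof (intro sum.cong refl)
    fix i j assume "i \<in> {..<d}" "j \<in> {..<d}"
    then have "A $$ (i, j) = cnj (A $$ (j, i))" using assms(1) unfolding hermitian_def by blast
    then show "A $$ (i, j) * x $ j * cnj (y $ i) = x $ j * cnj (A $$ (j, i) * y $ i)" by simp
  qed
  also have "\<dots> = x \<bullet>c (A *\<^sub>v y)"
    using assms A by (simp add: cscalar_prod_sum[of _ d] mult_mat_vec_index[OF A] sum_distrib_left mult_ac del: index_mult_mat_vec)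
  finally show ?thesis .
qed

text \<open>One form covers both kinds of operators that occur: weights 1 on arbitrary vectors give
  frame operators, real weights on an orthonormal basis give spectral decompositions. Operators that
  are diagonal in the same basis are added by adding weights.\<close>

definition weighted_op :: "nat \<Rightarrow> (nat \<Rightarrow> complex) \<Rightarrow> complex vec list \<Rightarrow> complex mat" where
  "weighted_op d w hs = mat d d (\<lambda>(a, b). \<Sum>i<length hs. w i * hs ! i $ a * cnj (hs ! i $ b))"

lemma weighted_op_carrier [simp]: "weighted_op d w hs \<in> carrier_mat d d"
  by (simp add: weighted_op_def)

lemma weighted_op_dim [simp]:
  "dim_row (weighted_op d w hs) = d" "dim_col (weighted_op d w hs) = d"
  by (simp_all add: weighted_op_def)

lemma weighted_op_index:
  "a < d \<Longrightarrow> b < d \<Longrightarrow>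
    weighted_op d w hs $$ (a, b) = (\<Sum>i<length hs. w i * hs ! i $ a * cnj (hs ! i $ b))"
  by (simp add: weighted_op_def)

lemma weighted_op_cong:
  "(\<And>i. i < length hs \<Longrightarrow> w i = w' i) \<Longrightarrow> weighted_op d w hs = weighted_op d w' hs"
  unfolding weighted_op_def by (intro cong_mat refl) auto

lemma weighted_op_add:
  "weighted_op d w hs + weighted_op d w' hs = weighted_op d (\<lambda>i. w i + w' i) hs"
  by (intro eq_matI) (auto simp: weighted_op_index sum.distrib algebra_simps)

lemma hermitian_weighted_op: "hermitian d (weighted_op d (\<lambda>i. complex_of_real (w i)) hs)"
  by (auto simp: hermitian_def weighted_op_index mult_ac)

lemma weighted_op_mult_vec:
  assumes "set hs \<subseteq> carrier_vec d" "x \<in> carrier_vec d" "a < d"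
  shows "(weighted_op d w hs *\<^sub>v x) $ a = (\<Sum>i<length hs. w i * (x \<bullet>c hs ! i) * hs ! i $ a)"
proof -
  have hs: "hs ! i \<in> carrier_vec d" if "i < length hs" for i using assms that by auto
  have "(weighted_op d w hs *\<^sub>v x) $ a
      = (\<Sum>b<d. \<Sum>i<length hs. w i * hs ! i $ a * cnj (hs ! i $ b) * x $ b)"
    using assms by (simp add: mult_mat_vec_index[of _ d d] weighted_op_index sum_distrib_right del: index_mult_mat_vec)
  also have "\<dots> = (\<Sum>i<length hs. \<Sum>b<d. w i * hs ! i $ a * cnj (hs ! i $ b) * x $ b)"
    by (rule sum.swap)
  also have "\<dots> = (\<Sum>i<length hs. w i * (x \<bullet>c hs ! i) * hs ! i $ a)"
    using assms hs by (intro sum.cong refl)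
      (simp add: cscalar_prod_sum[of _ d] sum_distrib_left sum_distrib_right mult_ac)
  finally show ?thesis .
qed

lemma weighted_op_cscalar_prod:
  assumes "set hs \<subseteq> carrier_vec d" "x \<in> carrier_vec d" "y \<in> carrier_vec d"
  shows "(weighted_op d w hs *\<^sub>v x) \<bullet>c y = (\<Sum>i<length hs. w i * (x \<bullet>c hs ! i) * (hs ! i \<bullet>c y))"
proof -
  have hs: "hs ! i \<in> carrier_vec d" if "i < length hs" for i using assms that by auto
  have c: "weighted_op d w hs *\<^sub>v x \<in> carrier_vec d"
    by (rule mult_mat_vec_carrier[OF _ assms(2)]) simp
  have "(weighted_op d w hs *\<^sub>v x) \<bullet>c y = (\<Sum>a<d. (weighted_op d w hs *\<^sub>v x) $ a * cnj (y $ a))"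
    by (rule cscalar_prod_sum[OF c assms(3)])
  also have "\<dots> = (\<Sum>a<d. \<Sum>i<length hs. w i * (x \<bullet>c hs ! i) * hs ! i $ a * cnj (y $ a))"
    using assms(1,2)
    by (intro sum.cong refl) (simp only: weighted_op_mult_vec sum_distrib_right lessThan_iff)
  also have "\<dots> = (\<Sum>i<length hs. \<Sum>a<d. w i * (x \<bullet>c hs ! i) * hs ! i $ a * cnj (y $ a))"
    by (rule sum.swap)
  also have "\<dots> = (\<Sum>i<length hs. w i * (x \<bullet>c hs ! i) * (hs ! i \<bullet>c y))"
    using assms(3) hs by (intro sum.cong refl)
      (simp only: cscalar_prod_sum[of _ d] sum_distrib_left mult.assoc lessThan_iff)
  finally show ?thesis .
qed

lemma mat_sum_carrier:
  "(\<And>A. A \<in> set As \<Longrightarrow> A \<in> carrier_mat d d) \<Longrightarrow> mat_sum d As \<in> carrier_mat d d"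
  by (induction As) (auto simp: mat_sum_def)

lemma mat_sum_index:
  assumes "\<And>A. A \<in> set As \<Longrightarrow> A \<in> carrier_mat d d" "i < d" "j < d"
  shows "mat_sum d As $$ (i, j) = (\<Sum>A\<leftarrow>As. A $$ (i, j))"
  using assms(1)
proof (induction As)
  case Nil
  then show ?case using assms by (simp add: mat_sum_def)
next
  case (Cons A As)
  have "mat_sum d As \<in> carrier_mat d d" by (rule mat_sum_carrier) (use Cons in auto)
  moreover have "mat_sum d (A # As) = A + mat_sum d As" by (simp add: mat_sum_def)
  ultimately show ?case using Cons assms by auto
qed

lemma tensor_carrier: "x \<in> carrier_vec d \<Longrightarrow> y \<in> carrier_vec d \<Longrightarrow> tensor x y \<in> carrier_mat d d"
  by (auto simp: tensor_def)

lemma tensor_index: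
  "x \<in> carrier_vec d \<Longrightarrow> y \<in> carrier_vec d \<Longrightarrow> i < d \<Longrightarrow> j < d \<Longrightarrow>
    tensor x y $$ (i, j) = x $ i * cnj (y $ j)"
  by (auto simp: tensor_def)

lemma frame_op_carrier: "set gs \<subseteq> carrier_vec d \<Longrightarrow> frame_op d gs \<in> carrier_mat d d"
  unfolding frame_op_def by (rule mat_sum_carrier) (auto intro!: tensor_carrier)

lemma frame_op_index:
  assumes "set gs \<subseteq> carrier_vec d" "i < d" "j < d"
  shows "frame_op d gs $$ (i, j) = (\<Sum>g\<leftarrow>gs. g $ i * cnj (g $ j))"
proof -
  have "frame_op d gs $$ (i, j) = (\<Sum>A\<leftarrow>map (\<lambda>g. tensor g g) gs. A $$ (i, j))"
    unfolding frame_op_def by (rule mat_sum_index) (use assms in \<open>auto intro!: tensor_carrier\<close>)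
  also have "\<dots> = (\<Sum>g\<leftarrow>gs. g $ i * cnj (g $ j))"
    using assms by (auto simp: comp_def intro!: arg_cong[of _ _ sum_list] map_cong tensor_index[of _ d])
  finally show ?thesis .
qed

lemma frame_op_weighted:
  assumes "set gs \<subseteq> carrier_vec d"
  shows "frame_op d gs = weighted_op d (\<lambda>_. 1) gs"
  using assms frame_op_carrier[OF assms]
  by (intro eq_matI) (auto simp: frame_op_index weighted_op_index sum_list_sum_nth atLeast0LessThan)

lemma frame_op_append:
  assumes "set fs \<subseteq> carrier_vec d" "set gs \<subseteq> carrier_vec d"
  shows "frame_op d (fs @ gs) = frame_op d fs + frame_op d gs"
  using assms frame_op_carrier[of fs d] frame_op_carrier[of gs d] frame_op_carrier[of "fs @ gs" d]
  by (intro eq_matI) (auto simp: frame_op_index)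

lemma frame_op_mset_cong:
  assumes "mset fs = mset gs" "set fs \<subseteq> carrier_vec d"
  shows "frame_op d fs = frame_op d gs"
proof -
  have s: "set gs \<subseteq> carrier_vec d" using assms by (metis set_mset_mset)
  have e: "(\<Sum>g\<leftarrow>fs. g $ i * cnj (g $ j)) = (\<Sum>g\<leftarrow>gs. g $ i * cnj (g $ j))" for i j
  proof -
    have "mset (map (\<lambda>g. g $ i * cnj (g $ j)) fs) = mset (map (\<lambda>g. g $ i * cnj (g $ j)) gs)"
      using assms(1) by simp
    then show ?thesis by (simp only: sum_mset_sum_list[symmetric])
  qed
  show ?thesis
    using assms(2) s frame_op_carrier[of fs d] frame_op_carrier[of gs d]
    by (intro eq_matI) (auto simp: frame_op_index e)
qed

lemma hermitian_frame_op: "set gs \<subseteq> carrier_vec d \<Longrightarrow> hermitian d (frame_op d gs)"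
  using hermitian_weighted_op[of d "\<lambda>_. 1" gs] by (simp add: frame_op_weighted)

section \<open>Orthonormal systems\<close>

definition orthonormal :: "nat \<Rightarrow> complex vec list \<Rightarrow> bool" where
  "orthonormal d qs \<longleftrightarrow> set qs \<subseteq> carrier_vec d \<and>
     (\<forall>i<length qs. \<forall>j<length qs. qs ! i \<bullet>c qs ! j = (if i = j then 1 else 0))"

lemma orthonormal_nth_carrier: "orthonormal d qs \<Longrightarrow> i < length qs \<Longrightarrow> qs ! i \<in> carrier_vec d"
  by (auto simp: orthonormal_def)

lemma orthonormal_set: "orthonormal d qs \<Longrightarrow> set qs \<subseteq> carrier_vec d"
  by (simp add: orthonormal_def)

lemma orthonormal_cscalar_prod:
  "orthonormal d qs \<Longrightarrow> i < length qs \<Longrightarrow> j < length qs \<Longrightarrow>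
    qs ! i \<bullet>c qs ! j = (if i = j then 1 else 0)"
  by (simp add: orthonormal_def)

lemma orthonormal_append:
  assumes "orthonormal d ps" "orthonormal d qs"
    and "\<And>q p. q \<in> set qs \<Longrightarrow> p \<in> set ps \<Longrightarrow> q \<bullet>c p = 0"
  shows "orthonormal d (ps @ qs)"
proof -
  have ps: "p \<in> carrier_vec d" if "p \<in> set ps" for p using assms(1) that by (auto simp: orthonormal_def)
  have qs: "q \<in> carrier_vec d" if "q \<in> set qs" for q using assms(2) that by (auto simp: orthonormal_def)
  have sym: "p \<bullet>c q = 0" if "q \<in> set qs" "p \<in> set ps" for p q
    using assms(3)[OF that] cnj_cscalar_prod[OF qs[OF that(1)] ps[OF that(2)]] by simp
  show ?thesis
    using assms(1,2) assms(3) sym unfolding orthonormal_def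
    by (auto simp: nth_append)
qed

lemma normalize:
  assumes "v \<in> carrier_vec d" "v \<noteq> 0\<^sub>v d"
  obtains c where "norm_sq (c \<cdot>\<^sub>v v) = 1"
proof -
  define c where "c = complex_of_real (1 / sqrt (norm_sq v))"
  have pos: "norm_sq v > 0" using assms norm_sq_eq_0_iff[OF assms(1)] norm_sq_nonneg[of v] by simp
  have "complex_of_real (norm_sq (c \<cdot>\<^sub>v v)) = (c \<cdot>\<^sub>v v) \<bullet>c (c \<cdot>\<^sub>v v)"
    using assms by (simp add: cscalar_prod_self[of _ d])
  also have "\<dots> = c * cnj c * complex_of_real (norm_sq v)"
    using cscalar_prod_smult_left[OF assms(1), of "c \<cdot>\<^sub>v v" c] cscalar_prod_smult_right[OF assms(1,1), of c]
      cscalar_prod_self[OF assms(1)] assms(1) by simp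
  also have "c * cnj c = complex_of_real (1 / norm_sq v)"
    using pos by (simp add: c_def flip: of_real_mult)
  finally show ?thesis using pos by (intro that[of c]) (simp flip: of_real_mult)
qed

text \<open>A dimension count by determinants: the conjugated \<open>vs\<close> become rows of a
  square matrix whose last row is zero, because there are fewer than \<open>d\<close> of them, and a
  nonzero kernel vector is orthogonal to all of them.\<close>

lemma ex_orthogonal_unit:
  assumes "set vs \<subseteq> carrier_vec d" "length vs < d"
  shows "\<exists>x \<in> carrier_vec d. norm_sq x = 1 \<and> (\<forall>v\<in>set vs. x \<bullet>c v = 0)"
proof -
  define A where "A = mat d d (\<lambda>(i, j). if i < length vs then cnj (vs ! i $ j) else 0)"
  have A: "A \<in> carrier_mat d d" by (simp add: A_def)
  have "det A = (\<Sum>j<d. A $$ (d - 1, j) * cofactor A (d - 1) j)"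
    by (rule laplace_expansion_row[OF A]) (use assms in simp)
  also have "\<dots> = 0" using assms by (intro sum.neutral) (auto simp: A_def)
  finally obtain v where v: "v \<in> carrier_vec d" "v \<noteq> 0\<^sub>v d" "A *\<^sub>v v = 0\<^sub>v d"
    using det_0_iff_vec_prod_zero_field[OF A] by auto
  have o: "v \<bullet>c vs ! i = 0" if "i < length vs" for i
  proof -
    have "v \<bullet>c vs ! i = (A *\<^sub>v v) $ i"
    proof -
      have "vs ! i \<in> carrier_vec d" using that assms by auto
      then show ?thesis
        using mult_mat_vec_index[OF A v(1), of i] that assms(2) v(1)
        by (simp add: A_def cscalar_prod_sum[of _ d] mult.commute del: index_mult_mat_vec)
    qed
    then show ?thesis using v(3) that assms by simp
  qed
  obtain c where c: "norm_sq (c \<cdot>\<^sub>v v) = 1" using normalize[OF v(1,2)] .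
  have "(c \<cdot>\<^sub>v v) \<bullet>c w = 0" if w: "w \<in> set vs" for w
  proof -
    obtain i where "i < length vs" "w = vs ! i" using w by (auto simp: in_set_conv_nth)
    then show ?thesis
      using o[of i] w assms cscalar_prod_smult_left[OF v(1), of w c] nth_mem[of i vs] by fastforce
  qed
  then show ?thesis using v c by (intro bexI[of _ "c \<cdot>\<^sub>v v"]) auto
qed

lemma ex_orthonormal_orthogonal:
  assumes "set vs \<subseteq> carrier_vec d" "length vs + p \<le> d"
  shows "\<exists>qs. orthonormal d qs \<and> length qs = p \<and> (\<forall>q\<in>set qs. \<forall>v\<in>set vs. q \<bullet>c v = 0)"
  using assms(2)
proof (induction p)
  case 0
  then show ?case by (intro exI[of _ "[]"]) (simp add: orthonormal_def)
next
  case (Suc p)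
  then obtain qs where qs: "orthonormal d qs" "length qs = p" "\<forall>q\<in>set qs. \<forall>v\<in>set vs. q \<bullet>c v = 0"
    by auto
  obtain x where x: "x \<in> carrier_vec d" "norm_sq x = 1" "\<forall>v\<in>set (vs @ qs). x \<bullet>c v = 0"
    using ex_orthogonal_unit[of "vs @ qs" d] qs assms(1) Suc.prems by (auto simp: orthonormal_def)
  have "orthonormal d (qs @ [x])"
    by (rule orthonormal_append[OF qs(1)])
      (use x in \<open>auto simp: orthonormal_def cscalar_prod_self[of _ d]\<close>)
  then show ?case using qs x by (intro exI[of _ "qs @ [x]"]) auto
qed

text \<open>Completeness is encoded by the number of vectors; that they span is recovered in
  \<open>onb_spans\<close>.\<close>

definition onb :: "nat \<Rightarrow> complex vec list \<Rightarrow> bool" where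
  "onb d hs \<longleftrightarrow> orthonormal d hs \<and> length hs = d"

lemma onb_nth_carrier: "onb d hs \<Longrightarrow> i < d \<Longrightarrow> hs ! i \<in> carrier_vec d"
  by (auto simp: onb_def orthonormal_def)

lemma onb_set: "onb d hs \<Longrightarrow> set hs \<subseteq> carrier_vec d"
  by (simp add: onb_def orthonormal_def)

lemma onb_length: "onb d hs \<Longrightarrow> length hs = d"
  by (simp add: onb_def)

lemma onb_cscalar_prod:
  "onb d hs \<Longrightarrow> i < d \<Longrightarrow> j < d \<Longrightarrow> hs ! i \<bullet>c hs ! j = (if i = j then 1 else 0)"
  by (simp add: onb_def orthonormal_def)

lemma onb_extend:
  assumes "orthonormal d qs" "length qs \<le> d"
  obtains rs where "onb d (qs @ rs)"
proof -
  obtain rs where rs: "orthonormal d rs" "length rs = d - length qs" "\<forall>r\<in>set rs. \<forall>q\<in>set qs. r \<bullet>c q = 0"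
    using ex_orthonormal_orthogonal[of qs d "d - length qs"] assms by (auto simp: orthonormal_def)
  then have "onb d (qs @ rs)"
    using orthonormal_append[OF assms(1) rs(1)] assms(2) by (auto simp: onb_def)
  then show ?thesis by (rule that)
qed

text \<open>The unitary matrix U of the basis; \<open>adj_rows_mat\<close> is its adjoint.\<close>

definition cols_mat :: "nat \<Rightarrow> complex vec list \<Rightarrow> complex mat" where
  "cols_mat d hs = mat d d (\<lambda>(i, j). hs ! j $ i)"

definition adj_rows_mat :: "nat \<Rightarrow> complex vec list \<Rightarrow> complex mat" where
  "adj_rows_mat d hs = mat d d (\<lambda>(i, j). cnj (hs ! i $ j))"

lemma cols_mat_carrier: "cols_mat d hs \<in> carrier_mat d d"
  and adj_rows_mat_carrier: "adj_rows_mat d hs \<in> carrier_mat d d"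
  by (simp_all add: cols_mat_def adj_rows_mat_def)

lemma adj_rows_cols_mat:
  assumes "onb d hs"
  shows "adj_rows_mat d hs * cols_mat d hs = 1\<^sub>m d"
proof (rule eq_matI)
  fix i j assume ij: "i < dim_row (1\<^sub>m d)" "j < dim_col (1\<^sub>m d)"
  then have "(adj_rows_mat d hs * cols_mat d hs) $$ (i, j) = hs ! j \<bullet>c hs ! i"
    using onb_nth_carrier[OF assms]
    by (subst mult_mat_index[OF adj_rows_mat_carrier cols_mat_carrier])
      (auto simp: cols_mat_def adj_rows_mat_def cscalar_prod_sum[of _ d] mult.commute)
  then show "(adj_rows_mat d hs * cols_mat d hs) $$ (i, j) = 1\<^sub>m d $$ (i, j)"
    using ij onb_cscalar_prod[OF assms] by auto
qed (auto simp: cols_mat_def adj_rows_mat_def)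

text \<open>Orthonormality says that the adjoint is a left inverse of U. For square matrices it is
  then a right inverse, which is the completeness relation behind \<open>parseval\<close>.\<close>

lemma cols_adj_rows_mat:
  "onb d hs \<Longrightarrow> cols_mat d hs * adj_rows_mat d hs = 1\<^sub>m d"
  by (rule mat_mult_left_right_inverse[OF adj_rows_mat_carrier cols_mat_carrier adj_rows_cols_mat])

lemma weighted_op_decomp:
  assumes "length hs = d"
  shows "weighted_op d w hs = cols_mat d hs * mat d d (\<lambda>(i, j). if i = j then w i else 0) * adj_rows_mat d hs"
proof (rule eq_matI)
  let ?D = "mat d d (\<lambda>(i, j). if i = j then w i else 0)"
  have UD: "cols_mat d hs * ?D \<in> carrier_mat d d" by (rule mult_carrier_mat[OF cols_mat_carrier]) simp
  fix a b assume "a < dim_row (cols_mat d hs * ?D * adj_rows_mat d hs)"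
    "b < dim_col (cols_mat d hs * ?D * adj_rows_mat d hs)"
  then have ab: "a < d" "b < d" by (auto simp: cols_mat_def adj_rows_mat_def)
  have *: "(cols_mat d hs * ?D) $$ (a, l) = w l * hs ! l $ a" if l: "l < d" for l
  proof -
    have "(cols_mat d hs * ?D) $$ (a, l) = (\<Sum>i<d. cols_mat d hs $$ (a, i) * ?D $$ (i, l))"
      by (rule mult_mat_index[OF cols_mat_carrier _ ab(1) l]) simp
    also have "\<dots> = (\<Sum>i<d. if i = l then w l * hs ! l $ a else 0)"
      using ab l by (intro sum.cong) (auto simp: cols_mat_def)
    finally show ?thesis using l by (simp add: sum.delta)
  qed
  show "weighted_op d w hs $$ (a, b) = (cols_mat d hs * ?D * adj_rows_mat d hs) $$ (a, b)"
    unfolding mult_mat_index[OF UD adj_rows_mat_carrier ab] using assms ab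
    by (auto simp: weighted_op_index * adj_rows_mat_def intro!: sum.cong simp del: index_mult_mat)
qed (auto simp: cols_mat_def adj_rows_mat_def)

lemma weighted_op_one:
  assumes "onb d hs"
  shows "weighted_op d (\<lambda>_. 1) hs = 1\<^sub>m d"
proof -
  have "mat d d (\<lambda>(i, j). if i = j then 1 else 0 :: complex) = 1\<^sub>m d"
    by (intro eq_matI) auto
  then show ?thesis
    using weighted_op_decomp[OF onb_length[OF assms], of "\<lambda>_. 1"] cols_adj_rows_mat[OF assms]
      right_mult_one_mat[OF cols_mat_carrier[of d hs]] by simp
qed

lemma parseval:
  assumes "onb d u" "x \<in> carrier_vec d" "y \<in> carrier_vec d"
  shows "x \<bullet>c y = (\<Sum>j<d. (x \<bullet>c u ! j) * (u ! j \<bullet>c y))"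
  using weighted_op_cscalar_prod[OF onb_set[OF assms(1)] assms(2,3), of "\<lambda>_. 1"] assms
  by (simp add: weighted_op_one onb_length)

lemma cscalar_prod_mult_swap:
  assumes "x \<in> carrier_vec d" "y \<in> carrier_vec d"
  shows "(x \<bullet>c y) * (y \<bullet>c x) = complex_of_real ((cmod (x \<bullet>c y))\<^sup>2)"
  using cnj_cscalar_prod[OF assms] complex_norm_square[of "x \<bullet>c y"] by simp

lemma cmod_cscalar_prod_commute:
  assumes "x \<in> carrier_vec d" "y \<in> carrier_vec d"
  shows "cmod (x \<bullet>c y) = cmod (y \<bullet>c x)"
  by (metis assms cnj_cscalar_prod complex_mod_cnj)

lemma norm_sq_parseval:
  assumes "onb d u" "x \<in> carrier_vec d"
  shows "norm_sq x = (\<Sum>j<d. (cmod (x \<bullet>c u ! j))\<^sup>2)"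
proof -
  have "complex_of_real (norm_sq x) = (\<Sum>j<d. (x \<bullet>c u ! j) * (u ! j \<bullet>c x))"
    using parseval[OF assms(1,2,2)] cscalar_prod_self[OF assms(2)] by simp
  also have "\<dots> = complex_of_real (\<Sum>j<d. (cmod (x \<bullet>c u ! j))\<^sup>2)"
    unfolding of_real_sum using onb_nth_carrier[OF assms(1)] assms(2)
    by (intro sum.cong refl cscalar_prod_mult_swap) auto
  finally show ?thesis by (simp only: of_real_eq_iff)
qed

lemma bessel:
  assumes "orthonormal d qs" "length qs \<le> d" "x \<in> carrier_vec d"
  shows "(\<Sum>i<length qs. (cmod (x \<bullet>c qs ! i))\<^sup>2) \<le> norm_sq x"
proof -
  obtain rs where rs: "onb d (qs @ rs)" using onb_extend[OF assms(1,2)] .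
  have "(\<Sum>i<length qs. (cmod (x \<bullet>c qs ! i))\<^sup>2) = (\<Sum>i<length qs. (cmod (x \<bullet>c (qs @ rs) ! i))\<^sup>2)"
    by (intro sum.cong) (auto simp: nth_append)
  also have "\<dots> \<le> (\<Sum>i<d. (cmod (x \<bullet>c (qs @ rs) ! i))\<^sup>2)"
    using assms(2) by (intro sum_mono2) auto
  finally show ?thesis using norm_sq_parseval[OF rs assms(3)] by simp
qed

text \<open>Equality in Bessel's inequality puts \<open>x\<close> into the span of
  \<open>qs\<close>. The conclusion expresses this through orthogonality, the form in which it is
  used.\<close>

lemma bessel_eq_orthogonal:
  assumes "orthonormal d qs" "length qs \<le> d" "x \<in> carrier_vec d" "y \<in> carrier_vec d"
    and eq: "(\<Sum>i<length qs. (cmod (x \<bullet>c qs ! i))\<^sup>2) = norm_sq x"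
    and y: "\<And>i. i < length qs \<Longrightarrow> y \<bullet>c qs ! i = 0"
  shows "y \<bullet>c x = 0"
proof -
  obtain rs where rs: "onb d (qs @ rs)" using onb_extend[OF assms(1,2)] .
  have "(\<Sum>i<length qs. (cmod (x \<bullet>c qs ! i))\<^sup>2) = (\<Sum>i<length qs. (cmod (x \<bullet>c (qs @ rs) ! i))\<^sup>2)"
    by (intro sum.cong) (auto simp: nth_append)
  moreover have "(\<Sum>i<d. (cmod (x \<bullet>c (qs @ rs) ! i))\<^sup>2)
      = (\<Sum>i<length qs. (cmod (x \<bullet>c (qs @ rs) ! i))\<^sup>2) + (\<Sum>i\<in>{length qs..<d}. (cmod (x \<bullet>c (qs @ rs) ! i))\<^sup>2)"
    using assms(2) by (subst sum.union_disjoint[symmetric]) (auto intro!: sum.cong)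
  ultimately have "(\<Sum>i\<in>{length qs..<d}. (cmod (x \<bullet>c (qs @ rs) ! i))\<^sup>2) = 0"
    using norm_sq_parseval[OF rs assms(3)] eq by simp
  then have z: "x \<bullet>c (qs @ rs) ! i = 0" if "length qs \<le> i" "i < d" for i
    using that by (subst (asm) sum_nonneg_eq_0_iff) auto
  have "(y \<bullet>c (qs @ rs) ! i) * ((qs @ rs) ! i \<bullet>c x) = 0" if "i < d" for i
  proof (cases "i < length qs")
    case True
    then show ?thesis using y by (simp add: nth_append)
  next
    case False
    then have "cmod ((qs @ rs) ! i \<bullet>c x) = 0"
      using z[of i] that cmod_cscalar_prod_commute[OF onb_nth_carrier[OF rs that] assms(3)] by simp
    then show ?thesis by simp
  qed
  then show ?thesis unfolding parseval[OF rs assms(4,3)] by (intro sum.neutral) blast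
qed

lemma weighted_op_mult_basis:
  assumes "orthonormal d u" "j < length u"
  shows "weighted_op d w u *\<^sub>v u ! j = w j \<cdot>\<^sub>v u ! j"
proof (rule eq_vecI)
  have uj: "u ! j \<in> carrier_vec d" using assms by (rule orthonormal_nth_carrier)
  fix a assume "a < dim_vec (w j \<cdot>\<^sub>v u ! j)"
  then have a: "a < d" using uj by simp
  have "(weighted_op d w u *\<^sub>v u ! j) $ a = (\<Sum>i<length u. if i = j then w j * u ! j $ a else 0)"
    unfolding weighted_op_mult_vec[OF orthonormal_set[OF assms(1)] uj a]
    by (intro sum.cong refl) (use assms orthonormal_cscalar_prod[OF assms(1), of j] in auto)
  then show "(weighted_op d w u *\<^sub>v u ! j) $ a = (w j \<cdot>\<^sub>v u ! j) $ a"
    using a uj assms by (simp add: sum.delta del: index_mult_mat_vec)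
qed (use orthonormal_nth_carrier[OF assms] in auto)

lemma eq_weighted_op:
  assumes "onb d u" "A \<in> carrier_mat d d" "\<And>j. j < d \<Longrightarrow> A *\<^sub>v u ! j = w j \<cdot>\<^sub>v u ! j"
  shows "A = weighted_op d w u"
proof (rule eq_matI)
  fix a b assume "a < dim_row (weighted_op d w u)" "b < dim_col (weighted_op d w u)"
  then have ab: "a < d" "b < d" by auto
  \<comment> \<open>Insert the resolution of the identity by the basis, so that \<open>A\<close>
    acts only on the vectors \<open>u ! i\<close>.\<close>
  have "A $$ (a, b) = (A * 1\<^sub>m d) $$ (a, b)" using assms(2) by simp
  also have "\<dots> = (\<Sum>l<d. A $$ (a, l) * weighted_op d (\<lambda>_. 1) u $$ (l, b))"
    unfolding weighted_op_one[OF assms(1), symmetric] using assms(2) ab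
    by (subst mult_mat_index[of _ d d _ d]) auto
  also have "\<dots> = (\<Sum>l<d. \<Sum>i<d. A $$ (a, l) * u ! i $ l * cnj (u ! i $ b))"
    using ab by (simp add: weighted_op_index onb_length[OF assms(1)] sum_distrib_left mult.assoc)
  also have "\<dots> = (\<Sum>i<d. \<Sum>l<d. A $$ (a, l) * u ! i $ l * cnj (u ! i $ b))"
    by (rule sum.swap)
  also have "\<dots> = (\<Sum>i<d. (A *\<^sub>v u ! i) $ a * cnj (u ! i $ b))"
  proof (intro sum.cong refl)
    fix i assume "i \<in> {..<d}"
    then show "(\<Sum>l<d. A $$ (a, l) * u ! i $ l * cnj (u ! i $ b)) = (A *\<^sub>v u ! i) $ a * cnj (u ! i $ b)"
      using mult_mat_vec_index[OF assms(2) onb_nth_carrier[OF assms(1)] ab(1), of i]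
      by (simp add: sum_distrib_right del: index_mult_mat_vec)
  qed
  also have "\<dots> = weighted_op d w u $$ (a, b)"
  proof -
    have "(A *\<^sub>v u ! i) $ a = w i * u ! i $ a" if "i < d" for i
      using assms(3)[OF that] onb_nth_carrier[OF assms(1) that] ab by simp
    then show ?thesis
      using ab by (simp add: weighted_op_index onb_length[OF assms(1)] del: index_mult_mat_vec)
  qed
  finally show "A $$ (a, b) = weighted_op d w u $$ (a, b)" .
qed (use assms in auto)

lemma weighted_op_eq_iff:
  assumes "onb d u" "A \<in> carrier_mat d d"
  shows "A = weighted_op d w u \<longleftrightarrow> (\<forall>j<d. A *\<^sub>v u ! j = w j \<cdot>\<^sub>v u ! j)"
  using eq_weighted_op[OF assms] weighted_op_mult_basis[of d u _ w] assms(1)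
  by (auto simp: onb_def)

section \<open>Simultaneous diagonalization of commuting Hermitian matrices\<close>

lemma char_poly_weighted_op:
  assumes "onb d u"
  shows "char_poly (weighted_op d w u) = (\<Prod>a\<leftarrow>map w [0..<d]. [:- a, 1:])"
proof -
  define D where "D = mat d d (\<lambda>(i, j). if i = j then w i else 0)"
  have D: "D \<in> carrier_mat d d" by (simp add: D_def)
  have "similar_mat_wit (weighted_op d w u) D (cols_mat d u) (adj_rows_mat d u)"
    using weighted_op_decomp[OF onb_length[OF assms], of w, folded D_def]
    by (intro similar_mat_witI[of _ _ d] cols_adj_rows_mat adj_rows_cols_mat assms
        cols_mat_carrier adj_rows_mat_carrier D weighted_op_carrier)
  then have "char_poly (weighted_op d w u) = char_poly D"
    by (intro char_poly_similar) (auto simp: similar_mat_def)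
  also have "\<dots> = (\<Prod>a\<leftarrow>diag_mat D. [:- a, 1:])"
    by (rule char_poly_upper_triangular[OF D]) (auto simp: D_def)
  also have "diag_mat D = map w [0..<d]" by (auto simp: diag_mat_def D_def)
  finally show ?thesis .
qed

lemma proots_prod_linear: "proots (\<Prod>a\<leftarrow>as. [:- a, 1:]) = mset (as :: complex list)"
proof (induction as)
  case (Cons a as)
  have "(\<Prod>a\<leftarrow>as. [:- a, 1:]) \<noteq> 0" by (auto simp: prod_list_zero_iff)
  then show ?case using Cons proots_linear_factor[of "- a"] by (subst list.map, subst prod_list.Cons, subst proots_mult) auto
qed auto

lemma eigs_weighted_op:
  assumes "onb d u"
  shows "eigs (weighted_op d (\<lambda>i. complex_of_real (e i)) u) = decr (map e [0..<d])"
proof -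
  have "image_mset Re (proots (char_poly (weighted_op d (\<lambda>i. complex_of_real (e i)) u))) = mset (map e [0..<d])"
    unfolding char_poly_weighted_op[OF assms] proots_prod_linear by (simp flip: mset_map add: comp_def)
  then show ?thesis by (simp add: eigs_def decr_def del: mset_map)
qed

lemma cscalar_prod_minus_left:
  fixes x y z :: "complex vec"
  assumes "x \<in> carrier_vec d" "y \<in> carrier_vec d" "z \<in> carrier_vec d"
  shows "(x - y) \<bullet>c z = x \<bullet>c z - y \<bullet>c z"
  using assms minus_carrier_vec[OF assms(1,2)]
  by (simp add: cscalar_prod_sum[of _ d] left_diff_distrib sum_subtractf)

lemma cscalar_prod_minus_right:
  fixes x y z :: "complex vec"
  assumes "x \<in> carrier_vec d" "y \<in> carrier_vec d" "z \<in> carrier_vec d"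
  shows "z \<bullet>c (x - y) = z \<bullet>c x - z \<bullet>c y"
  using assms minus_carrier_vec[OF assms(1,2)]
  by (simp add: cscalar_prod_sum[of _ d] right_diff_distrib sum_subtractf)

lemma cscalar_prod_add_left:
  fixes x y z :: "complex vec"
  assumes "x \<in> carrier_vec d" "y \<in> carrier_vec d" "z \<in> carrier_vec d"
  shows "(x + y) \<bullet>c z = x \<bullet>c z + y \<bullet>c z"
  using assms add_carrier_vec[OF assms(1,2)]
  by (simp add: cscalar_prod_sum[of _ d] distrib_right sum.distrib)

lemma eq_of_cscalar_prod_onb:
  assumes "onb d u" "x \<in> carrier_vec d" "y \<in> carrier_vec d"
    and "\<And>j. j < d \<Longrightarrow> x \<bullet>c u ! j = y \<bullet>c u ! j"
  shows "x = y"
proof -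
  have c: "x - y \<in> carrier_vec d" using assms by auto
  have "norm_sq (x - y) = (\<Sum>j<d. (cmod (x \<bullet>c u ! j - y \<bullet>c u ! j))\<^sup>2)"
    unfolding norm_sq_parseval[OF assms(1) c]
    using onb_nth_carrier[OF assms(1)] assms(2,3)
    by (intro sum.cong refl) (simp add: cscalar_prod_minus_left[of _ d])
  then have "norm_sq (x - y) = 0" using assms(4) by simp
  then have z: "x - y = 0\<^sub>v d" using norm_sq_eq_0_iff[OF c] by simp
  show ?thesis
  proof (rule eq_vecI)
    fix i assume "i < dim_vec y"
    then have "(x - y) $ i = 0" "i < d" using z assms by auto
    then show "x $ i = y $ i" using assms by auto
  qed (use assms in auto)
qed

section \<open>Linear combinations and common eigenvectors\<close>

definition lin_comb :: "nat \<Rightarrow> complex vec \<Rightarrow> complex vec list \<Rightarrow> complex vec" where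
  "lin_comb d y rs = vec d (\<lambda>a. \<Sum>j<length rs. y $ j * rs ! j $ a)"

lemma lin_comb_carrier [simp]: "lin_comb d y rs \<in> carrier_vec d"
  by (simp add: lin_comb_def)

lemma lin_comb_cscalar_prod:
  assumes "set rs \<subseteq> carrier_vec d" "x \<in> carrier_vec d"
  shows "lin_comb d y rs \<bullet>c x = (\<Sum>j<length rs. y $ j * (rs ! j \<bullet>c x))"
proof -
  have r: "rs ! j \<in> carrier_vec d" if "j < length rs" for j using assms(1) that by auto
  have "lin_comb d y rs \<bullet>c x = (\<Sum>a<d. \<Sum>j<length rs. y $ j * rs ! j $ a * cnj (x $ a))"
    using assms by (simp add: cscalar_prod_sum[of _ d] lin_comb_def sum_distrib_right)
  also have "\<dots> = (\<Sum>j<length rs. \<Sum>a<d. y $ j * rs ! j $ a * cnj (x $ a))"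
    by (rule sum.swap)
  also have "\<dots> = (\<Sum>j<length rs. y $ j * (rs ! j \<bullet>c x))"
    using r assms(2) by (intro sum.cong refl) (simp add: cscalar_prod_sum[of _ d] sum_distrib_left mult.assoc)
  finally show ?thesis .
qed

lemma mult_lin_comb:
  assumes "M \<in> carrier_mat d d" "set rs \<subseteq> carrier_vec d"
  shows "M *\<^sub>v lin_comb d y rs = lin_comb d y (map (\<lambda>r. M *\<^sub>v r) rs)"
proof (rule eq_vecI)
  fix a assume "a < dim_vec (lin_comb d y (map (\<lambda>r. M *\<^sub>v r) rs))"
  then have a: "a < d" by (simp add: lin_comb_def)
  have r: "rs ! j \<in> carrier_vec d" if "j < length rs" for j using assms(2) that by auto
  have "(M *\<^sub>v lin_comb d y rs) $ a = (\<Sum>l<d. \<Sum>j<length rs. M $$ (a, l) * (y $ j * rs ! j $ l))"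
    unfolding mult_mat_vec_index[OF assms(1) lin_comb_carrier a]
    by (simp add: lin_comb_def sum_distrib_left)
  also have "\<dots> = (\<Sum>j<length rs. \<Sum>l<d. M $$ (a, l) * (y $ j * rs ! j $ l))"
    by (rule sum.swap)
  also have "\<dots> = (\<Sum>j<length rs. y $ j * (M *\<^sub>v rs ! j) $ a)"
    by (intro sum.cong refl)
      (use r a in \<open>simp add: mult_mat_vec_index[OF assms(1)] sum_distrib_left mult_ac del: index_mult_mat_vec\<close>)
  finally show "(M *\<^sub>v lin_comb d y rs) $ a = lin_comb d y (map (\<lambda>r. M *\<^sub>v r) rs) $ a"
    using a assms(1) by (simp add: lin_comb_def del: index_mult_mat_vec)
qed (use assms in \<open>auto simp: lin_comb_def\<close>)

text \<open>For the residuals \<open>P\<close> and \<open>Q\<close> the eigenvalue equation reads P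
  = -i Q. Commutation makes the inner product of \<open>P\<close> and \<open>Q\<close> real, while
  the squared norm of \<open>P\<close> is i times this number; so both residuals vanish.\<close>

lemma eigenvector_commuting_parts:
  assumes A: "hermitian d A" and B: "hermitian d B" and comm: "A * B = B * A"
    and x: "x \<in> carrier_vec d"
    and eig: "A *\<^sub>v x + \<i> \<cdot>\<^sub>v (B *\<^sub>v x) = z \<cdot>\<^sub>v x"
  shows "A *\<^sub>v x = complex_of_real (Re z) \<cdot>\<^sub>v x" "B *\<^sub>v x = complex_of_real (Im z) \<cdot>\<^sub>v x"
proof -
  have Ac: "A \<in> carrier_mat d d" and Bc: "B \<in> carrier_mat d d" using A B by (auto simp: hermitian_def)
  have Ax: "A *\<^sub>v x \<in> carrier_vec d" and Bx: "B *\<^sub>v x \<in> carrier_vec d" using Ac Bc x by auto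
  define P where "P = A *\<^sub>v x - complex_of_real (Re z) \<cdot>\<^sub>v x"
  define Q where "Q = B *\<^sub>v x - complex_of_real (Im z) \<cdot>\<^sub>v x"
  have P: "P \<in> carrier_vec d" and Q: "Q \<in> carrier_vec d" using x Ac Bc by (auto simp: P_def Q_def)
  have PQ: "P = (- \<i>) \<cdot>\<^sub>v Q"
  proof (rule eq_vecI)
    fix a assume "a < dim_vec ((- \<i>) \<cdot>\<^sub>v Q)"
    then have a: "a < d" using Q by auto
    have "(A *\<^sub>v x) $ a + \<i> * (B *\<^sub>v x) $ a = z * x $ a"
      using arg_cong[OF eig, of "\<lambda>v. v $ a"] a x Ax Bx Ac Bc by (simp del: index_mult_mat_vec)
    then have "(A *\<^sub>v x) $ a = (Re z + \<i> * Im z) * x $ a - \<i> * (B *\<^sub>v x) $ a"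
      by (simp add: complex_eq[symmetric] algebra_simps del: index_mult_mat_vec)
    then show "P $ a = ((- \<i>) \<cdot>\<^sub>v Q) $ a"
      using a x Ax Bx Ac Bc by (simp add: P_def Q_def algebra_simps del: index_mult_mat_vec)
  qed (use P Q in auto)
  have AB: "(A *\<^sub>v x) \<bullet>c (B *\<^sub>v x) = (B *\<^sub>v x) \<bullet>c (A *\<^sub>v x)"
  proof -
    have "(A *\<^sub>v x) \<bullet>c (B *\<^sub>v x) = ((B * A) *\<^sub>v x) \<bullet>c x"
      using hermitian_cscalar_prod[OF B Ax x] Ac Bc x by (simp add: assoc_mult_mat_vec)
    also have "\<dots> = ((A * B) *\<^sub>v x) \<bullet>c x" by (simp only: comm)
    also have "\<dots> = (B *\<^sub>v x) \<bullet>c (A *\<^sub>v x)"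
      using hermitian_cscalar_prod[OF A Bx x] Ac Bc x by (simp add: assoc_mult_mat_vec)
    finally show ?thesis .
  qed
  have sx: "c \<cdot>\<^sub>v x \<in> carrier_vec d" for c using x by auto
  note ips = cscalar_prod_minus_left[of _ d] cscalar_prod_minus_right[of _ d]
    cscalar_prod_smult_left[of _ d] cscalar_prod_smult_right[of _ d]
  have "P \<bullet>c Q = Q \<bullet>c P"
    unfolding P_def Q_def
    using AB hermitian_cscalar_prod[OF A x x] hermitian_cscalar_prod[OF B x x] x Ax Bx sx
    by (simp add: ips algebra_simps)
  then have im: "Im (P \<bullet>c Q) = 0" using cnj_cscalar_prod[OF P Q] by (metis Reals_cnj_iff complex_is_Real_iff)
  have "P \<bullet>c P = \<i> * (P \<bullet>c Q)"
    by (subst (2) PQ) (use P Q in \<open>simp add: cscalar_prod_smult_right[of _ d]\<close>)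
  then have "norm_sq P = 0" using im cscalar_prod_self[OF P]
    by (metis Re_complex_of_real complex_i_mult_minus Re_i_times neg_0_equal_iff_equal)
  then have P0: "P = 0\<^sub>v d" using norm_sq_eq_0_iff[OF P] by simp
  have Q0: "Q = 0\<^sub>v d"
  proof (rule eq_vecI)
    fix a assume "a < dim_vec (0\<^sub>v d)"
    then have "((- \<i>) \<cdot>\<^sub>v Q) $ a = 0" "a < d" using P0 PQ by auto
    then show "Q $ a = 0\<^sub>v d $ a" using Q by auto
  qed (use Q in auto)
  show "A *\<^sub>v x = complex_of_real (Re z) \<cdot>\<^sub>v x"
  proof (rule eq_vecI)
    fix a assume "a < dim_vec (complex_of_real (Re z) \<cdot>\<^sub>v x)"
    then have "P $ a = 0" "a < d" using P0 x by auto
    then show "(A *\<^sub>v x) $ a = (complex_of_real (Re z) \<cdot>\<^sub>v x) $ a"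
      using x Ax Ac by (simp add: P_def del: index_mult_mat_vec)
  qed (use x Ac in auto)
  show "B *\<^sub>v x = complex_of_real (Im z) \<cdot>\<^sub>v x"
  proof (rule eq_vecI)
    fix a assume "a < dim_vec (complex_of_real (Im z) \<cdot>\<^sub>v x)"
    then have "Q $ a = 0" "a < d" using Q0 x by auto
    then show "(B *\<^sub>v x) $ a = (complex_of_real (Im z) \<cdot>\<^sub>v x) $ a"
      using x Bx Bc by (simp add: Q_def del: index_mult_mat_vec)
  qed (use x Bc in auto)
qed

text \<open>The pair is packed into the single matrix \<open>M\<close>, whose eigenvectors split by
  \<open>eigenvector_commuting_parts\<close>. The orthogonal complement of \<open>qs\<close> is
  invariant under \<open>M\<close>, so an eigenvector of the restriction, which exists over the
  complex numbers, is an eigenvector of \<open>M\<close>.\<close>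

lemma common_eigenvector_orthogonal:
  assumes A: "hermitian d A" and B: "hermitian d B" and comm: "A * B = B * A"
    and qs: "orthonormal d qs" "length qs < d"
    and eig: "\<And>q. q \<in> set qs \<Longrightarrow> \<exists>e g. A *\<^sub>v q = complex_of_real e \<cdot>\<^sub>v q \<and> B *\<^sub>v q = complex_of_real g \<cdot>\<^sub>v q"
  obtains x e g where "x \<in> carrier_vec d" "norm_sq x = 1" "\<And>q. q \<in> set qs \<Longrightarrow> x \<bullet>c q = 0"
    "A *\<^sub>v x = complex_of_real e \<cdot>\<^sub>v x" "B *\<^sub>v x = complex_of_real g \<cdot>\<^sub>v x"
proof -
  have Ac: "A \<in> carrier_mat d d" and Bc: "B \<in> carrier_mat d d" using A B by (auto simp: hermitian_def)
  obtain rs where rs: "onb d (qs @ rs)" using onb_extend[OF qs(1)] qs(2) by auto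
  define p where "p = length rs"
  have p: "0 < p" "length qs + p = d" using rs qs(2) by (auto simp: p_def onb_def)
  have rc: "set rs \<subseteq> carrier_vec d" and qc: "set qs \<subseteq> carrier_vec d" using onb_set[OF rs] by auto
  have rj: "rs ! j \<in> carrier_vec d" if "j < p" for j using rc that by (auto simp: p_def)
  have rr: "rs ! i \<bullet>c rs ! j = (if i = j then 1 else 0)" if "i < p" "j < p" for i j
    using onb_cscalar_prod[OF rs, of "length qs + i" "length qs + j"] that p by simp
  have rq: "rs ! i \<bullet>c q = 0" if "i < p" "q \<in> set qs" for i q
  proof -
    obtain j where "j < length qs" "q = qs ! j" using \<open>q \<in> set qs\<close> by (auto simp: in_set_conv_nth)
    then show ?thesis
      using onb_cscalar_prod[OF rs, of "length qs + i" j] \<open>i < p\<close> p by (auto simp: nth_append)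
  qed
  define M where "M = A + \<i> \<cdot>\<^sub>m B"
  have M: "M \<in> carrier_mat d d" using Ac Bc by (simp add: M_def)
  have Mx: "M *\<^sub>v v = A *\<^sub>v v + \<i> \<cdot>\<^sub>v (B *\<^sub>v v)" if "v \<in> carrier_vec d" for v
    using that Ac Bc
    by (intro eq_vecI) (auto simp: M_def scalar_prod_def sum_distrib_left sum.distrib algebra_simps)
  \<comment> \<open>Invariance of the complement: \<open>A\<close> and \<open>B\<close> are moved
    over to \<open>q\<close>, where they act as scalars.\<close>
  have Mq: "(M *\<^sub>v v) \<bullet>c q = 0" if v: "v \<in> carrier_vec d" "v \<bullet>c q = 0" "q \<in> set qs" for v q
  proof -
    obtain e g where eg: "A *\<^sub>v q = complex_of_real e \<cdot>\<^sub>v q" "B *\<^sub>v q = complex_of_real g \<cdot>\<^sub>v q"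
      using eig[OF v(3)] by blast
    have q: "q \<in> carrier_vec d" using qc v(3) by auto
    have "(A *\<^sub>v v) \<bullet>c q = 0" "(B *\<^sub>v v) \<bullet>c q = 0"
      unfolding hermitian_cscalar_prod[OF A v(1) q] hermitian_cscalar_prod[OF B v(1) q] eg
      using cscalar_prod_smult_right[OF v(1) q] v(2) by auto
    then show ?thesis
      using Ac Bc v q cscalar_prod_add_left[of "A *\<^sub>v v" d "\<i> \<cdot>\<^sub>v (B *\<^sub>v v)" q]
        cscalar_prod_smult_left[of "B *\<^sub>v v" d q \<i>] by (simp add: Mx)
  qed
  \<comment> \<open>The matrix of \<open>M\<close> restricted to the complement of
    \<open>qs\<close>, in the basis \<open>rs\<close>.\<close>
  define N where "N = mat p p (\<lambda>(i, j). (M *\<^sub>v rs ! j) \<bullet>c rs ! i)"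
  have N: "N \<in> carrier_mat p p" by (simp add: N_def)
  obtain z where "eigenvalue N z" using spectrum_non_empty[OF N p(1)] by (auto simp: spectrum_def)
  then obtain y where y: "y \<in> carrier_vec p" "y \<noteq> 0\<^sub>v p" "N *\<^sub>v y = z \<cdot>\<^sub>v y"
    using N by (auto simp: eigenvalue_def eigenvector_def)
  define x where "x = lin_comb d y rs"
  have x: "x \<in> carrier_vec d" by (simp add: x_def)
  have xq: "x \<bullet>c q = 0" if "q \<in> set qs" for q
    using that qc rq by (auto simp: x_def lin_comb_cscalar_prod[OF rc] p_def)
  have xr: "x \<bullet>c rs ! i = y $ i" if "i < p" for i
  proof -
    have "x \<bullet>c rs ! i = (\<Sum>j<p. if j = i then y $ i else 0)"
      unfolding x_def lin_comb_cscalar_prod[OF rc rj[OF that]] p_def[symmetric]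
      using that rr by (intro sum.cong) auto
    then show ?thesis using that by simp
  qed
  have zx: "z \<cdot>\<^sub>v x \<in> carrier_vec d" and Mxc: "M *\<^sub>v x \<in> carrier_vec d" using x M by auto
  have "M *\<^sub>v x = z \<cdot>\<^sub>v x"
  proof (rule eq_of_cscalar_prod_onb[OF rs Mxc zx])
    fix j assume j: "j < d"
    show "(M *\<^sub>v x) \<bullet>c (qs @ rs) ! j = (z \<cdot>\<^sub>v x) \<bullet>c (qs @ rs) ! j"
    proof (cases "j < length qs")
      case True
      then have q: "qs ! j \<in> set qs" "qs ! j \<in> carrier_vec d" using qc by auto
      have "(M *\<^sub>v x) \<bullet>c qs ! j = 0" by (rule Mq[OF x xq[OF q(1)] q(1)])
      moreover have "(z \<cdot>\<^sub>v x) \<bullet>c qs ! j = 0"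
        using cscalar_prod_smult_left[OF x q(2), of z] xq[OF q(1)] by simp
      ultimately show ?thesis using True by (simp add: nth_append)
    next
      case False
      define i where "i = j - length qs"
      have i: "i < p" "(qs @ rs) ! j = rs ! i" using False j p by (auto simp: i_def nth_append)
      have Mr: "set (map (\<lambda>r. M *\<^sub>v r) rs) \<subseteq> carrier_vec d" using rc M by auto
      have "(M *\<^sub>v x) \<bullet>c rs ! i = (\<Sum>j<p. y $ j * N $$ (i, j))"
        unfolding x_def mult_lin_comb[OF M rc] lin_comb_cscalar_prod[OF Mr rj[OF i(1)]]
        using i by (simp add: p_def[symmetric] N_def)
      also have "\<dots> = (N *\<^sub>v y) $ i"
        unfolding mult_mat_vec_index[OF N y(1) i(1)] by (simp add: mult.commute)
      also have "\<dots> = (z \<cdot>\<^sub>v x) \<bullet>c rs ! i"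
        using y i xr[OF i(1)] cscalar_prod_smult_left[OF x rj[OF i(1)], of z] by simp
      finally show ?thesis using i by simp
    qed
  qed
  then have eig: "A *\<^sub>v x + \<i> \<cdot>\<^sub>v (B *\<^sub>v x) = z \<cdot>\<^sub>v x" using Mx[OF x] by simp
  have "x \<noteq> 0\<^sub>v d"
  proof
    assume "x = 0\<^sub>v d"
    then have "y $ i = 0" if "i < p" for i using xr[OF that] rj[OF that] by simp
    then have "y = 0\<^sub>v p" using y(1) by (intro eq_vecI) auto
    then show False using y(2) by simp
  qed
  then obtain c where c: "norm_sq (c \<cdot>\<^sub>v x) = 1" using normalize[OF x] by blast
  note e = eigenvector_commuting_parts[OF A B comm x eig]
  show thesis
  proof (rule that[of "c \<cdot>\<^sub>v x"])
    show "A *\<^sub>v (c \<cdot>\<^sub>v x) = complex_of_real (Re z) \<cdot>\<^sub>v (c \<cdot>\<^sub>v x)"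
      "B *\<^sub>v (c \<cdot>\<^sub>v x) = complex_of_real (Im z) \<cdot>\<^sub>v (c \<cdot>\<^sub>v x)"
      unfolding mult_mat_vec[OF Ac x] mult_mat_vec[OF Bc x] e by (simp_all add: smult_smult_assoc mult.commute)
    show "(c \<cdot>\<^sub>v x) \<bullet>c q = 0" if "q \<in> set qs" for q
      using cscalar_prod_smult_left[OF x, of q c] xq[OF that] that qc by auto
  qed (use x c in auto)
qed

text \<open>Common eigenvectors are split off one at a time. With \<open>B = A\<close> this is the
  spectral theorem, and \<open>hermitian_spectral\<close> obtains it in this way.\<close>

lemma commuting_hermitian_spectral:
  assumes A: "hermitian d A" and B: "hermitian d B" and comm: "A * B = B * A"
  obtains hs e g where "onb d hs" "A = weighted_op d (\<lambda>i. complex_of_real (e i)) hs"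
    "B = weighted_op d (\<lambda>i. complex_of_real (g i)) hs"
proof -
  let ?E = "\<lambda>q e g. A *\<^sub>v q = complex_of_real e \<cdot>\<^sub>v q \<and> B *\<^sub>v q = complex_of_real g \<cdot>\<^sub>v q"
  have "p \<le> d \<Longrightarrow> \<exists>qs. orthonormal d qs \<and> length qs = p \<and> (\<forall>q\<in>set qs. \<exists>e g. ?E q e g)" for p
  proof (induction p)
    case 0
    then show ?case by (intro exI[of _ "[]"]) (simp add: orthonormal_def)
  next
    case (Suc p)
    then obtain qs where qs: "orthonormal d qs" "length qs = p" "\<forall>q\<in>set qs. \<exists>e g. ?E q e g" by auto
    obtain x e g where x: "x \<in> carrier_vec d" "norm_sq x = 1" "\<And>q. q \<in> set qs \<Longrightarrow> x \<bullet>c q = 0" "?E x e g"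
      using common_eigenvector_orthogonal[OF A B comm qs(1)] qs Suc.prems
      by (metis Suc_le_lessD)
    have "orthonormal d (qs @ [x])"
      by (rule orthonormal_append[OF qs(1)])
        (use x in \<open>auto simp: orthonormal_def cscalar_prod_self[of _ d]\<close>)
    then show ?case using qs x by (intro exI[of _ "qs @ [x]"]) auto
  qed
  from this[of d] obtain hs where hs: "onb d hs" "\<forall>q\<in>set hs. \<exists>e g. ?E q e g" by (auto simp: onb_def)
  then have "\<forall>i<d. \<exists>e g. ?E (hs ! i) e g" by (simp add: onb_def)
  then obtain e g where "\<forall>i<d. ?E (hs ! i) (e i) (g i)" by metis
  then show thesis
    using that[of hs e g] hs(1) A B weighted_op_eq_iff[OF hs(1)] by (auto simp: hermitian_def)
qed

section \<open>Spectra and interlacing\<close>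

lemma mset_map_upt_permutation:
  assumes "mset (map f [0..<d]) = mset (map g [0..<d])"
  obtains p where "bij_betw p {..<d} {..<d}" "\<And>i. i < d \<Longrightarrow> f (p i) = g i"
proof -
  obtain p where p: "p permutes {..<length (map f [0..<d])}" "permute_list p (map f [0..<d]) = map g [0..<d]"
    using mset_eq_permutation[OF assms[symmetric]] .
  have b: "bij_betw p {..<d} {..<d}" using p(1) permutes_imp_bij by fastforce
  have "f (p i) = g i" if "i < d" for i
  proof -
    have "p i < d" using b that by (auto simp: bij_betw_def)
    then show ?thesis using arg_cong[OF p(2), of "\<lambda>l. l ! i"] that p(1) by (simp add: permute_list_nth)
  qed
  then show thesis using b that by blast
qed

lemma onb_permute:
  assumes "onb d hs" "bij_betw p {..<d} {..<d}"
  shows "onb d (map (\<lambda>i. hs ! p i) [0..<d])"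
proof -
  have p: "p i < d" if "i < d" for i using assms(2) that by (auto simp: bij_betw_def)
  have inj: "p i = p j \<longleftrightarrow> i = j" if "i < d" "j < d" for i j
    using assms(2) that by (auto simp: bij_betw_def inj_on_def)
  show ?thesis
    using p inj onb_cscalar_prod[OF assms(1)] onb_nth_carrier[OF assms(1)]
    by (auto simp: onb_def orthonormal_def)
qed

lemma weighted_op_permute:
  assumes "length hs = d" "bij_betw p {..<d} {..<d}"
  shows "weighted_op d (\<lambda>i. w (p i)) (map (\<lambda>i. hs ! p i) [0..<d]) = weighted_op d w hs"
proof (rule eq_matI)
  fix a b assume "a < dim_row (weighted_op d w hs)" "b < dim_col (weighted_op d w hs)"
  then have ab: "a < d" "b < d" by auto
  show "weighted_op d (\<lambda>i. w (p i)) (map (\<lambda>i. hs ! p i) [0..<d]) $$ (a, b) = weighted_op d w hs $$ (a, b)"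
    using sum.reindex_bij_betw[OF assms(2), of "\<lambda>i. w i * hs ! i $ a * cnj (hs ! i $ b)"] ab assms(1)
    by (simp add: weighted_op_index)
qed auto

text \<open>The labels \<open>f\<close> and \<open>g\<close> have arbitrary type, and the new basis
  is chosen before \<open>w\<close>. With pairs as labels, one rearrangement serves two operators at
  once, as in \<open>optimal_operator_structure\<close>.\<close>

lemma weighted_op_reorder:
  assumes "onb d hs" "mset (map f [0..<d]) = mset (map g [0..<d])"
  obtains hs' where "onb d hs'"
    "\<And>w. weighted_op d (\<lambda>i. w (f i)) hs = weighted_op d (\<lambda>i. w (g i)) hs'"
proof -
  obtain p where p: "bij_betw p {..<d} {..<d}" "\<And>i. i < d \<Longrightarrow> f (p i) = g i"
    using mset_map_upt_permutation[OF assms(2)] by blast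
  let ?hs = "map (\<lambda>i. hs ! p i) [0..<d]"
  have "weighted_op d (\<lambda>i. w (f i)) hs = weighted_op d (\<lambda>i. w (g i)) ?hs" for w
  proof -
    have "weighted_op d (\<lambda>i. w (f i)) hs = weighted_op d (\<lambda>i. w (f (p i))) ?hs"
      by (rule weighted_op_permute[symmetric, OF onb_length[OF assms(1)] p(1)])
    also have "\<dots> = weighted_op d (\<lambda>i. w (g i)) ?hs"
      by (rule weighted_op_cong) (use p in simp)
    finally show ?thesis .
  qed
  then show thesis using that onb_permute[OF assms(1) p(1)] by blast
qed

abbreviation real_weighted_op :: "nat \<Rightarrow> (nat \<Rightarrow> real) \<Rightarrow> complex vec list \<Rightarrow> complex mat" where
  "real_weighted_op d w \<equiv> weighted_op d (\<lambda>i. complex_of_real (w i))"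

text \<open>This reduces equality of spectra to equality of multisets, so that eigenvalues may be
  listed in the order of a basis instead of by size.\<close>

lemma decr_eq_iff: "decr xs = decr ys \<longleftrightarrow> mset xs = mset ys"
  by (metis decr_def mset_rev mset_sort rev_rev_ident sort_key_stable properties_for_sort sorted_sort)

lemma mset_decr [simp]: "mset (decr xs) = mset xs"
  by (simp add: decr_def)

lemma length_decr [simp]: "length (decr xs) = length xs"
  by (simp add: decr_def)

lemma sorted_decr: "sorted_wrt (\<ge>) (decr xs)"
  by (simp add: decr_def sorted_wrt_rev)

lemma decr_id: "sorted_wrt (\<ge>) xs \<Longrightarrow> decr xs = xs"
  by (metis decr_def mset_rev properties_for_sort rev_rev_ident sorted_wrt_rev)

lemma spectral_sorted:
  assumes "onb d u" "A = real_weighted_op d e u"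
  obtains hs where "onb d hs" "A = real_weighted_op d (\<lambda>i. eigs A ! i) hs" "length (eigs A) = d"
proof -
  have e: "eigs A = decr (map e [0..<d])" using eigs_weighted_op[OF assms(1)] assms(2) by simp
  then have l: "length (eigs A) = d" by simp
  have "map (\<lambda>i. eigs A ! i) [0..<d] = eigs A" using l by (metis map_nth)
  then have "mset (map e [0..<d]) = mset (map (\<lambda>i. eigs A ! i) [0..<d])" by (simp only: e mset_decr)
  from weighted_op_reorder[OF assms(1) this] obtain hs where "onb d hs"
    "\<And>w. weighted_op d (\<lambda>i. w (e i)) u = weighted_op d (\<lambda>i. w (eigs A ! i)) hs" by blast
  note hs = this
  have "A = real_weighted_op d (\<lambda>i. eigs A ! i) hs" using hs(2)[of complex_of_real] assms(2) by simp
  then show thesis using that l hs(1) by blast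
qed

lemma hermitian_spectral:
  assumes "hermitian d A"
  obtains hs where "onb d hs" "A = real_weighted_op d (\<lambda>i. eigs A ! i) hs" "length (eigs A) = d"
proof -
  obtain hs e g where hs: "onb d hs" "A = real_weighted_op d e hs"
    using commuting_hermitian_spectral[OF assms assms refl] by metis
  from spectral_sorted[OF this] show thesis using that by blast
qed

lemma sorted_eigs: "sorted_wrt (\<ge>) (eigs A)"
  by (simp add: eigs_def sorted_wrt_rev)

section \<open>Spanning and eigenbases\<close>

lemma in_span_lin_comb:
  assumes "set fs \<subseteq> carrier_vec d"
  shows "lin_comb d y fs \<in> LinearCombinations.module.span class_ring (module_vec TYPE(complex) d) (set fs)"
proof -
  interpret vec_space "TYPE(complex)" d .
  have "n \<le> length fs \<Longrightarrow> lin_comb d y (take n fs) \<in> span (set fs)" for n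
  proof (induction n)
    case 0
    have "lin_comb d y [] = 0\<^sub>v d" by (auto simp: lin_comb_def)
    then show ?case using vectorspace.span_zero[OF vectorspace_axioms, of "set fs"] by simp
  next
    case (Suc n)
    have n: "fs ! n \<in> set fs" "fs ! n \<in> carrier_vec d" using Suc.prems assms by auto
    have eq: "lin_comb d y (take (Suc n) fs) = lin_comb d y (take n fs) + y $ n \<cdot>\<^sub>v fs ! n"
      using Suc.prems n by (intro eq_vecI) (auto simp: lin_comb_def)
    have "y $ n \<cdot>\<^sub>v fs ! n \<in> span (set fs)"
      by (rule smult_in_span[OF assms span_mem[OF _ n(1)]]) (use assms in simp)
    then show ?case unfolding eq using span_add1[OF _ Suc.IH] assms Suc.prems by simp
  qed
  from this[of "length fs"] show ?thesis by simp
qed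

lemma spans_iff:
  assumes "set fs \<subseteq> carrier_vec d"
  shows "spans d fs \<longleftrightarrow> carrier_vec d \<subseteq> LinearCombinations.module.span class_ring (module_vec TYPE(complex) d) (set fs)"
proof -
  interpret vec_space "TYPE(complex)" d .
  show ?thesis using span_closed[of "set fs"] assms by (auto simp: spans_def)
qed

lemma weighted_op_mult_vec_lin_comb:
  assumes "set hs \<subseteq> carrier_vec d" "x \<in> carrier_vec d"
  shows "weighted_op d w hs *\<^sub>v x = lin_comb d (vec (length hs) (\<lambda>i. w i * (x \<bullet>c hs ! i))) hs"
  by (rule eq_vecI) (simp_all add: weighted_op_mult_vec[OF assms] lin_comb_def del: index_mult_mat_vec)

lemma weighted_op_cscalar_prod_onb:
  assumes "onb d u" "x \<in> carrier_vec d" "j < d"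
  shows "(weighted_op d w u *\<^sub>v x) \<bullet>c u ! j = w j * (x \<bullet>c u ! j)"
proof -
  have "(weighted_op d w u *\<^sub>v x) \<bullet>c u ! j = (\<Sum>i<d. if i = j then w j * (x \<bullet>c u ! j) else 0)"
    unfolding weighted_op_cscalar_prod[OF onb_set[OF assms(1)] assms(2) onb_nth_carrier[OF assms(1,3)]]
      onb_length[OF assms(1)]
    by (intro sum.cong refl) (use onb_cscalar_prod[OF assms(1) _ assms(3)] in auto)
  then show ?thesis using assms(3) by simp
qed

text \<open>The frame operator is invertible, so \<open>v\<close> is its value at some
  \<open>x\<close>, and every such value is the combination of \<open>fs\<close> with the inner
  products of \<open>x\<close> and the \<open>fs ! i\<close> as coefficients.\<close>

lemma spans_of_frame_op:
  assumes fs: "set fs \<subseteq> carrier_vec d" and u: "onb d u"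
    and S: "frame_op d fs = real_weighted_op d e u" and pos: "\<And>j. j < d \<Longrightarrow> e j \<noteq> 0"
  shows "spans d fs"
  unfolding spans_iff[OF fs]
proof
  fix v :: "complex vec" assume v: "v \<in> carrier_vec d"
  define x where "x = real_weighted_op d (\<lambda>j. 1 / e j) u *\<^sub>v v"
  have x: "x \<in> carrier_vec d" unfolding x_def by (rule mult_mat_vec_carrier[OF _ v]) simp
  have Sx: "frame_op d fs *\<^sub>v x \<in> carrier_vec d"
    by (rule mult_mat_vec_carrier[OF frame_op_carrier[OF fs] x])
  have "frame_op d fs *\<^sub>v x = v"
  proof (rule eq_of_cscalar_prod_onb[OF u Sx v])
    fix j assume j: "j < d"
    have "x \<bullet>c u ! j = complex_of_real (1 / e j) * (v \<bullet>c u ! j)"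
      unfolding x_def by (rule weighted_op_cscalar_prod_onb[OF u v j])
    then show "(frame_op d fs *\<^sub>v x) \<bullet>c u ! j = v \<bullet>c u ! j"
      unfolding S weighted_op_cscalar_prod_onb[OF u x j] using pos[OF j] by simp
  qed
  then have "v = lin_comb d (vec (length fs) (\<lambda>i. 1 * (x \<bullet>c fs ! i))) fs"
    unfolding frame_op_weighted[OF fs] weighted_op_mult_vec_lin_comb[OF fs x] by simp
  then show "v \<in> LinearCombinations.module.span class_ring (module_vec TYPE(complex) d) (set fs)"
    using in_span_lin_comb[OF fs] by metis
qed

lemma onb_spans:
  assumes "onb d hs"
  shows "spans d hs"
proof (rule spans_of_frame_op[OF onb_set[OF assms] assms])
  show "frame_op d hs = real_weighted_op d (\<lambda>_. 1) hs"
    using frame_op_weighted[OF onb_set[OF assms]] by simp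
qed simp

lemma eigenbasis_iff:
  assumes "S \<in> carrier_mat d d"
  shows "eigenbasis d S lam hs \<longleftrightarrow> onb d hs \<and> S = real_weighted_op d (\<lambda>i. lam ! i) hs"
proof -
  have "orthonormal_basis d hs \<longleftrightarrow> onb d hs"
    using onb_spans[of d hs] by (auto simp: orthonormal_basis_def onb_def orthonormal_def)
  then show ?thesis
    using weighted_op_eq_iff[OF _ assms, of hs "\<lambda>i. complex_of_real (lam ! i)"] by (auto simp: eigenbasis_def)
qed

section \<open>Quadratic forms, traces and Weyl's inequality\<close>

definition qform :: "complex mat \<Rightarrow> complex vec \<Rightarrow> real" where
  "qform A x = Re ((A *\<^sub>v x) \<bullet>c x)"

lemma qform_weighted_op:
  assumes "set hs \<subseteq> carrier_vec d" "x \<in> carrier_vec d"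
  shows "qform (real_weighted_op d w hs) x = (\<Sum>i<length hs. w i * (cmod (x \<bullet>c hs ! i))\<^sup>2)"
proof -
  have "(real_weighted_op d w hs *\<^sub>v x) \<bullet>c x = (\<Sum>i<length hs. complex_of_real (w i * (cmod (x \<bullet>c hs ! i))\<^sup>2))"
    unfolding weighted_op_cscalar_prod[OF assms assms(2)]
  proof (intro sum.cong refl)
    fix i assume "i \<in> {..<length hs}"
    then have "hs ! i \<in> carrier_vec d" using assms(1) by auto
    from cscalar_prod_mult_swap[OF assms(2) this]
    show "complex_of_real (w i) * (x \<bullet>c hs ! i) * (hs ! i \<bullet>c x) = complex_of_real (w i * (cmod (x \<bullet>c hs ! i))\<^sup>2)"
      by (simp add: mult.assoc)
  qed
  then show ?thesis by (simp add: qform_def flip: of_real_sum)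
qed

lemma qform_frame_op:
  assumes "set fs \<subseteq> carrier_vec d" "x \<in> carrier_vec d"
  shows "qform (frame_op d fs) x = (\<Sum>i<length fs. (cmod (x \<bullet>c fs ! i))\<^sup>2)"
  using qform_weighted_op[OF assms, of "\<lambda>_. 1"] frame_op_weighted[OF assms(1)] by simp

lemma qform_add:
  assumes "A \<in> carrier_mat d d" "B \<in> carrier_mat d d" "x \<in> carrier_vec d"
  shows "qform (A + B) x = qform A x + qform B x"
  using assms cscalar_prod_add_left[of "A *\<^sub>v x" d "B *\<^sub>v x" x]
  by (simp add: qform_def add_mult_distrib_mat_vec[OF assms])

lemma qform_basis:
  assumes "onb d u" "j < d"
  shows "qform (real_weighted_op d e u) (u ! j) = e j"
  using weighted_op_cscalar_prod_onb[OF assms(1) onb_nth_carrier[OF assms] assms(2)] assms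
    onb_cscalar_prod[OF assms assms(2)]
  by (simp add: qform_def)

text \<open>Both sides are the trace of the frame operator; the proof is Parseval for each vector
  and an exchange of sums.\<close>

lemma sum_norm_sq_frame_op:
  assumes "set fs \<subseteq> carrier_vec d" "onb d u"
  shows "(\<Sum>i<length fs. norm_sq (fs ! i)) = (\<Sum>j<d. qform (frame_op d fs) (u ! j))"
proof -
  have "(\<Sum>i<length fs. norm_sq (fs ! i)) = (\<Sum>i<length fs. \<Sum>j<d. (cmod (u ! j \<bullet>c fs ! i))\<^sup>2)"
  proof (intro sum.cong refl)
    fix i assume "i \<in> {..<length fs}"
    then have f: "fs ! i \<in> carrier_vec d" using assms(1) by auto
    show "norm_sq (fs ! i) = (\<Sum>j<d. (cmod (u ! j \<bullet>c fs ! i))\<^sup>2)"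
      unfolding norm_sq_parseval[OF assms(2) f] using onb_nth_carrier[OF assms(2)] f
      by (intro sum.cong refl) (simp add: cmod_cscalar_prod_commute[of _ d])
  qed
  also have "\<dots> = (\<Sum>j<d. \<Sum>i<length fs. (cmod (u ! j \<bullet>c fs ! i))\<^sup>2)" by (rule sum.swap)
  also have "\<dots> = (\<Sum>j<d. qform (frame_op d fs) (u ! j))"
    using qform_frame_op[OF assms(1)] onb_nth_carrier[OF assms(2)] by simp
  finally show ?thesis .
qed

lemma sum_eigenvalues_frame_op:
  assumes "set fs \<subseteq> carrier_vec d" "onb d u" "frame_op d fs = real_weighted_op d e u"
  shows "(\<Sum>i<length fs. norm_sq (fs ! i)) = (\<Sum>j<d. e j)"
  using sum_norm_sq_frame_op[OF assms(1,2)] qform_basis[OF assms(2), of _ e] assms(3) by simp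

text \<open>A Courant-Fischer argument: a suitable unit vector meets only eigenvalues of the one
  operator that are at least \<open>beta (length gs + i)\<close>, and only eigenvalues of the other
  that are at most \<open>lam i\<close>. The list \<open>gs\<close> allows for a perturbation of
  rank at most \<open>length gs\<close>: with \<open>gs = F1\<close> this bounds the spectrum of a
  completion from above, with \<open>gs\<close> empty and the operators exchanged it bounds it from
  below.\<close>

lemma weyl_inequality:
  assumes h: "onb d h" and u: "onb d u"
    and lam: "\<And>i j. i \<le> j \<Longrightarrow> j < d \<Longrightarrow> lam j \<le> lam i"
    and beta: "\<And>i j. i \<le> j \<Longrightarrow> j < d \<Longrightarrow> beta j \<le> beta i"
    and gs: "set gs \<subseteq> carrier_vec d"
    and le: "\<And>x. x \<in> carrier_vec d \<Longrightarrow> (\<And>g. g \<in> set gs \<Longrightarrow> x \<bullet>c g = 0) \<Longrightarrow>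
      qform (real_weighted_op d beta u) x \<le> qform (real_weighted_op d lam h) x"
    and i: "length gs + i < d"
  shows "beta (length gs + i) \<le> lam i"
proof -
  let ?m = "length gs + i"
  \<comment> \<open>These are \<open>d - 1\<close> vectors, one fewer than the dimension.\<close>
  define vs where "vs = gs @ take i h @ drop (Suc ?m) u"
  have vs: "set vs \<subseteq> carrier_vec d"
    using gs onb_set[OF h] onb_set[OF u] unfolding vs_def by (auto dest!: in_set_takeD in_set_dropD)
  have "length vs < d" using i onb_length[OF h] onb_length[OF u] by (simp add: vs_def)
  then obtain x where x: "x \<in> carrier_vec d" "norm_sq x = 1" "\<forall>v\<in>set vs. x \<bullet>c v = 0"
    using ex_orthogonal_unit[OF vs] by blast
  have xh: "x \<bullet>c h ! j = 0" if "j < i" for j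
  proof -
    have "h ! j \<in> set (take i h)" using that i onb_length[OF h] by (auto simp: in_set_conv_nth)
    then show ?thesis using x(3) by (simp add: vs_def)
  qed
  have xu: "x \<bullet>c u ! j = 0" if "?m < j" "j < d" for j
  proof -
    have "drop (Suc ?m) u ! (j - Suc ?m) = u ! j" using that onb_length[OF u] by simp
    then have "u ! j \<in> set (drop (Suc ?m) u)"
      using that onb_length[OF u] by (metis diff_less_mono length_drop Suc_leI nth_mem)
    then show ?thesis using x(3) by (simp add: vs_def)
  qed
  have "beta ?m = (\<Sum>j<d. beta ?m * (cmod (x \<bullet>c u ! j))\<^sup>2)"
    using norm_sq_parseval[OF u x(1)] x(2) by (simp flip: sum_distrib_left)
  also have "\<dots> \<le> (\<Sum>j<d. beta j * (cmod (x \<bullet>c u ! j))\<^sup>2)"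
  proof (rule sum_mono)
    fix j assume "j \<in> {..<d}"
    then show "beta ?m * (cmod (x \<bullet>c u ! j))\<^sup>2 \<le> beta j * (cmod (x \<bullet>c u ! j))\<^sup>2"
      using beta[of j ?m] i xu[of j] by (cases "j \<le> ?m") (auto intro!: mult_right_mono)
  qed
  also have "\<dots> \<le> (\<Sum>j<d. lam j * (cmod (x \<bullet>c h ! j))\<^sup>2)"
    using le[OF x(1)] x(3) qform_weighted_op[OF onb_set[OF u] x(1), of beta]
      qform_weighted_op[OF onb_set[OF h] x(1), of lam] onb_length[OF h] onb_length[OF u]
    by (auto simp: vs_def)
  also have "\<dots> \<le> (\<Sum>j<d. lam i * (cmod (x \<bullet>c h ! j))\<^sup>2)"
  proof (rule sum_mono)
    fix j assume "j \<in> {..<d}"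
    then show "lam j * (cmod (x \<bullet>c h ! j))\<^sup>2 \<le> lam i * (cmod (x \<bullet>c h ! j))\<^sup>2"
      using lam[of i j] i xh[of j] by (cases "i \<le> j") (auto intro!: mult_right_mono)
  qed
  also have "\<dots> = lam i"
    using norm_sq_parseval[OF h x(1)] x(2) by (simp flip: sum_distrib_left)
  finally show ?thesis .
qed

section \<open>Rigidity of the optimal operator\<close>

text \<open>The left side is the sum of \<open>e j * W j\<close>, where \<open>W j\<close> is the
  squared length of the projection of \<open>u ! j\<close> onto the span of \<open>qs\<close>, a
  number between 0 and 1. Equality forces \<open>W j = 1\<close> wherever \<open>e j > 0\<close>, so
  these \<open>u ! j\<close> lie in that span; the second claim says so by orthogonality.\<close>

lemma positive_part_trace_le:
  fixes e :: "nat \<Rightarrow> real"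
  assumes u: "onb d u" and qs: "orthonormal d qs" "length qs \<le> d"
  shows "(\<Sum>i<length qs. \<Sum>j<d. e j * (cmod (qs ! i \<bullet>c u ! j))\<^sup>2) \<le> (\<Sum>j<d. max 0 (e j))"
    and "\<And>y j. (\<Sum>i<length qs. \<Sum>j<d. e j * (cmod (qs ! i \<bullet>c u ! j))\<^sup>2) = (\<Sum>j<d. max 0 (e j)) \<Longrightarrow>
      y \<in> carrier_vec d \<Longrightarrow> (\<And>q. q \<in> set qs \<Longrightarrow> y \<bullet>c q = 0) \<Longrightarrow> j < d \<Longrightarrow> e j > 0 \<Longrightarrow> y \<bullet>c u ! j = 0"
proof -
  define W where "W = (\<lambda>j. \<Sum>i<length qs. (cmod (u ! j \<bullet>c qs ! i))\<^sup>2)"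
  have uc: "u ! j \<in> carrier_vec d" if "j < d" for j using onb_nth_carrier[OF u that] .
  have qc: "qs ! i \<in> carrier_vec d" if "i < length qs" for i using orthonormal_nth_carrier[OF qs(1) that] .
  have un: "norm_sq (u ! j) = 1" if "j < d" for j
    using onb_cscalar_prod[OF u that that] cscalar_prod_self[OF uc[OF that]] by simp
  have W1: "W j \<le> 1" if "j < d" for j using bessel[OF qs uc[OF that]] un[OF that] by (simp add: W_def)
  have W0: "W j \<ge> 0" for j by (simp add: W_def sum_nonneg)
  have eq: "(\<Sum>i<length qs. \<Sum>j<d. e j * (cmod (qs ! i \<bullet>c u ! j))\<^sup>2) = (\<Sum>j<d. e j * W j)"
  proof -
    have "(\<Sum>i<length qs. \<Sum>j<d. e j * (cmod (qs ! i \<bullet>c u ! j))\<^sup>2)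
        = (\<Sum>j<d. \<Sum>i<length qs. e j * (cmod (qs ! i \<bullet>c u ! j))\<^sup>2)" by (rule sum.swap)
    also have "\<dots> = (\<Sum>j<d. \<Sum>i<length qs. e j * (cmod (u ! j \<bullet>c qs ! i))\<^sup>2)"
      using qc uc by (intro sum.cong refl) (simp add: cmod_cscalar_prod_commute[of _ d])
    finally show ?thesis by (simp add: W_def sum_distrib_left)
  qed
  have le: "e j * W j \<le> max 0 (e j)" if "j < d" for j
  proof (cases "e j \<ge> 0")
    case True
    then show ?thesis using mult_left_mono[OF W1[OF that] True] by simp
  next
    case False
    then show ?thesis using W0[of j] by (simp add: mult_nonpos_nonneg)
  qed
  show "(\<Sum>i<length qs. \<Sum>j<d. e j * (cmod (qs ! i \<bullet>c u ! j))\<^sup>2) \<le> (\<Sum>j<d. max 0 (e j))"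
    unfolding eq by (rule sum_mono) (use le in auto)
  fix y j
  assume "(\<Sum>i<length qs. \<Sum>j<d. e j * (cmod (qs ! i \<bullet>c u ! j))\<^sup>2) = (\<Sum>j<d. max 0 (e j))"
    and y: "y \<in> carrier_vec d" "\<And>q. q \<in> set qs \<Longrightarrow> y \<bullet>c q = 0" and j: "j < d" "e j > 0"
  then have "(\<Sum>j<d. max 0 (e j) - e j * W j) = 0" unfolding eq by (simp add: sum_subtractf)
  then have "\<forall>j\<in>{..<d}. max 0 (e j) - e j * W j = 0"
    by (rule iffD1[OF sum_nonneg_eq_0_iff, rotated -1]) (use le in \<open>simp_all\<close>)
  then have "max 0 (e j) - e j * W j = 0" using j(1) by blast
  then have "e j * W j = e j" using j(2) by (simp add: max_def)
  then have "W j = 1" using j(2) by simp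
  then show "y \<bullet>c u ! j = 0"
    using y un[OF j(1)] by (intro bessel_eq_orthogonal[OF qs uc[OF j(1)] y(1)]) (auto simp: W_def)
qed

lemma ky_fan_below:
  fixes lam :: "nat \<Rightarrow> real"
  assumes h: "onb d h" and qs: "orthonormal d qs" and R: "rho + length qs \<le> d"
    and lam: "\<And>i j. rho \<le> i \<Longrightarrow> i \<le> j \<Longrightarrow> j < d \<Longrightarrow> lam j \<le> lam i"
    and orth: "\<And>q i. q \<in> set qs \<Longrightarrow> i < rho \<Longrightarrow> q \<bullet>c h ! i = 0"
  shows "(\<Sum>i<length qs. qform (real_weighted_op d lam h) (qs ! i)) \<le> (\<Sum>j\<in>{rho..<rho + length qs}. lam j)"
proof (cases "length qs = 0")
  case False
  define p where "p = length qs"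
  define W where "W = (\<lambda>j. \<Sum>i<p. (cmod (qs ! i \<bullet>c h ! j))\<^sup>2)"
  \<comment> \<open>The smallest of the eigenvalues in the bound. As the weights \<open>W\<close>
    sum to \<open>p\<close>, subtracting \<open>tau\<close> from every \<open>lam j\<close> changes
    both sides by \<open>tau * real p\<close>, and then the comparison holds term by term.\<close>
  define tau where "tau = lam (rho + p - 1)"
  have hc: "h ! j \<in> carrier_vec d" if "j < d" for j using onb_nth_carrier[OF h that] .
  have qc: "qs ! i \<in> carrier_vec d" if "i < p" for i using orthonormal_nth_carrier[OF qs] that by (simp add: p_def)
  have p: "p > 0" "rho + p \<le> d" using False R by (simp_all add: p_def)
  have W1: "W j \<le> 1" if "j < d" for j
  proof -
    have "W j = (\<Sum>i<p. (cmod (h ! j \<bullet>c qs ! i))\<^sup>2)"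
      unfolding W_def using hc[OF that] qc by (intro sum.cong refl) (simp add: cmod_cscalar_prod_commute[of _ d])
    also have "\<dots> \<le> norm_sq (h ! j)" using bessel[OF qs _ hc[OF that]] p by (simp add: p_def)
    also have "\<dots> = 1" using onb_cscalar_prod[OF h that that] cscalar_prod_self[OF hc[OF that]] by simp
    finally show ?thesis .
  qed
  have W0: "W j \<ge> 0" for j by (simp add: W_def sum_nonneg)
  have Wrho: "W j = 0" if "j < rho" for j
    using orth that by (simp add: W_def p_def)
  have Wsum: "(\<Sum>j<d. W j) = real p"
  proof -
    have "(\<Sum>j<d. W j) = (\<Sum>i<p. \<Sum>j<d. (cmod (qs ! i \<bullet>c h ! j))\<^sup>2)" unfolding W_def by (rule sum.swap)
    also have "\<dots> = (\<Sum>i<p. 1)"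
    proof (intro sum.cong refl)
      fix i assume "i \<in> {..<p}"
      then have i: "i < length qs" "i < p" by (simp_all add: p_def)
      then show "(\<Sum>j<d. (cmod (qs ! i \<bullet>c h ! j))\<^sup>2) = 1"
        using norm_sq_parseval[OF h qc[OF i(2)]] orthonormal_cscalar_prod[OF qs i(1) i(1)]
          cscalar_prod_self[OF qc[OF i(2)]] by (metis of_real_eq_1_iff)
    qed
    finally show ?thesis by simp
  qed
  have "(\<Sum>i<p. qform (real_weighted_op d lam h) (qs ! i)) = (\<Sum>i<p. \<Sum>j<d. lam j * (cmod (qs ! i \<bullet>c h ! j))\<^sup>2)"
    using qform_weighted_op[OF onb_set[OF h]] qc onb_length[OF h] by simp
  also have "\<dots> = (\<Sum>j<d. \<Sum>i<p. lam j * (cmod (qs ! i \<bullet>c h ! j))\<^sup>2)" by (rule sum.swap)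
  also have "\<dots> = (\<Sum>j<d. (lam j - tau) * W j) + tau * real p"
    by (simp add: left_diff_distrib sum_subtractf sum_distrib_left[symmetric] Wsum) (simp add: W_def)
  also have "(\<Sum>j<d. (lam j - tau) * W j) \<le> (\<Sum>j<d. if rho \<le> j \<and> j < rho + p then lam j - tau else 0)"
  proof (rule sum_mono)
    fix j assume "j \<in> {..<d}"
    then have j: "j < d" by simp
    consider "j < rho" | "rho \<le> j" "j < rho + p" | "rho + p \<le> j" by linarith
    then show "(lam j - tau) * W j \<le> (if rho \<le> j \<and> j < rho + p then lam j - tau else 0)"
    proof cases
      case 1
      then show ?thesis using Wrho by simp
    next
      case 2
      then have "tau \<le> lam j" unfolding tau_def using p by (intro lam) auto
      then show ?thesis using mult_left_mono[OF W1[OF j], of "lam j - tau"] 2 by simp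
    next
      case 3
      then have "lam j \<le> tau" unfolding tau_def using p j by (intro lam) auto
      then show ?thesis using W0[of j] 3 by (simp add: mult_nonpos_nonneg)
    qed
  qed
  also have "(\<Sum>j<d. if rho \<le> j \<and> j < rho + p then lam j - tau else 0) = (\<Sum>j\<in>{rho..<rho + p}. lam j - tau)"
    using p by (intro sum.mono_neutral_cong_right) auto
  also have "(\<Sum>j\<in>{rho..<rho + p}. lam j - tau) + tau * real p = (\<Sum>j\<in>{rho..<rho + p}. lam j)"
    by (simp add: sum_subtractf)
  finally show ?thesis by (simp add: p_def)
qed simp

text \<open>The eigenvectors \<open>u ! j\<close> with eigenvalue other than \<open>c\<close> lie in
  the span of test vectors orthogonal to \<open>fs\<close>: for eigenvalues above \<open>c\<close>,
  the first \<open>rho\<close> vectors of \<open>h\<close>; for those below, a system constructed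
  for this purpose. In both cases the trace of S - c, respectively c - S, over the test vectors
  attains the bound of \<open>positive_part_trace_le\<close>.\<close>

lemma optimal_frame_vectors_eigen:
  fixes lam :: "nat \<Rightarrow> real"
  assumes h: "onb d h" and u: "onb d u" and fs: "set fs \<subseteq> carrier_vec d"
    and S: "real_weighted_op d lam h + frame_op d fs = real_weighted_op d (\<lambda>i. if i < R then lam i else c) u"
    and lam: "\<And>i j. i \<le> j \<Longrightarrow> j < d \<Longrightarrow> lam j \<le> lam i"
    and rho: "rho \<le> R" "R \<le> d" "\<And>i. i < rho \<Longrightarrow> c < lam i" "\<And>i. rho \<le> i \<Longrightarrow> i < d \<Longrightarrow> lam i \<le> c"
    and R: "R = rho \<or> length fs + R \<le> d"
    and f: "f \<in> set fs"
  shows "real_weighted_op d (\<lambda>i. if i < R then lam i else c) u *\<^sub>v f = complex_of_real c \<cdot>\<^sub>v f"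
proof -
  define nu where "nu = (\<lambda>i. if i < R then lam i else c)"
  have fc: "g \<in> carrier_vec d" if "g \<in> set fs" for g using fs that by auto
  have hc: "h ! i \<in> carrier_vec d" if "i < d" for i using onb_nth_carrier[OF h that] .
  have qS: "(\<Sum>j<d. nu j * (cmod (x \<bullet>c u ! j))\<^sup>2) = qform (real_weighted_op d lam h) x + (\<Sum>i<length fs. (cmod (x \<bullet>c fs ! i))\<^sup>2)"
    if x: "x \<in> carrier_vec d" for x
  proof -
    have "(\<Sum>j<d. nu j * (cmod (x \<bullet>c u ! j))\<^sup>2) = qform (real_weighted_op d lam h + frame_op d fs) x"
      using qform_weighted_op[OF onb_set[OF u] x, of nu] onb_length[OF u] S by (simp add: nu_def)
    then show ?thesis
      using qform_add[OF _ frame_op_carrier[OF fs] x] qform_frame_op[OF fs x] by simp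
  qed
  have qS': "(\<Sum>j<d. (nu j - c) * (cmod (x \<bullet>c u ! j))\<^sup>2)
      = qform (real_weighted_op d lam h) x - c * norm_sq x + (\<Sum>i<length fs. (cmod (x \<bullet>c fs ! i))\<^sup>2)"
    if x: "x \<in> carrier_vec d" for x
    using qS[OF x] norm_sq_parseval[OF u x]
    by (simp add: left_diff_distrib sum_subtractf sum_distrib_left)
  have nc: "norm_sq x = 1" if "orthonormal d qs" "x \<in> set qs" for x qs
  proof -
    obtain i where "i < length qs" "x = qs ! i" using \<open>x \<in> set qs\<close> by (auto simp: in_set_conv_nth)
    then show ?thesis
      using orthonormal_cscalar_prod[OF that(1), of i i] orthonormal_nth_carrier[OF that(1), of i]
        cscalar_prod_self[of x d] by simp
  qed
  let ?P = "take rho h"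
  have P: "orthonormal d ?P" "length ?P = rho" "rho \<le> d"
    using h rho by (auto simp: onb_def orthonormal_def dest: in_set_takeD)
  have Pn: "?P ! i = h ! i" if "i < rho" for i using that by simp
  have "(\<Sum>i<rho. \<Sum>j<d. (nu j - c) * (cmod (?P ! i \<bullet>c u ! j))\<^sup>2)
      = (\<Sum>i<rho. lam i - c + (\<Sum>l<length fs. (cmod (h ! i \<bullet>c fs ! l))\<^sup>2))"
  proof (intro sum.cong refl)
    fix i assume "i \<in> {..<rho}"
    then have i: "i < rho" "i < d" using P by auto
    show "(\<Sum>j<d. (nu j - c) * (cmod (?P ! i \<bullet>c u ! j))\<^sup>2) = lam i - c + (\<Sum>l<length fs. (cmod (h ! i \<bullet>c fs ! l))\<^sup>2)"
      unfolding Pn[OF i(1)] qS'[OF hc[OF i(2)]] qform_basis[OF h i(2)]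
      using nc[OF P(1), of "h ! i"] i nth_mem[of i ?P] P by simp
  qed
  moreover have mx: "(\<Sum>j<d. max 0 (nu j - c)) = (\<Sum>i<rho. lam i - c)"
  proof -
    have "max 0 (nu j - c) = (if j < rho then lam j - c else 0)" if "j < d" for j
      using rho(1) rho(3)[of j] rho(4)[of j] that by (cases "j < rho") (auto simp: nu_def max_def)
    then have "(\<Sum>j<d. max 0 (nu j - c)) = (\<Sum>j<d. if j < rho then lam j - c else 0)" by simp
    also have "\<dots> = (\<Sum>i<rho. lam i - c)" using P by (intro sum.mono_neutral_cong_right) auto
    finally show ?thesis .
  qed
  \<comment> \<open>The positive part of S - c has as its trace the sum of \<open>lam i - c\<close>
    over \<open>i < rho\<close>. The test vectors collect that much from \<open>S0\<close> alone, so
    the nonnegative contribution of \<open>fs\<close> has to vanish.\<close>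
  ultimately have le: "(\<Sum>i<rho. lam i - c) + (\<Sum>i<rho. \<Sum>l<length fs. (cmod (h ! i \<bullet>c fs ! l))\<^sup>2) \<le> (\<Sum>i<rho. lam i - c)"
    and eq: "(\<Sum>i<length ?P. \<Sum>j<d. (nu j - c) * (cmod (?P ! i \<bullet>c u ! j))\<^sup>2)
      = (\<Sum>i<rho. lam i - c) + (\<Sum>i<rho. \<Sum>l<length fs. (cmod (h ! i \<bullet>c fs ! l))\<^sup>2)"
    using positive_part_trace_le(1)[OF u P(1), of "\<lambda>j. nu j - c"] P by (simp_all add: sum.distrib)
  have z0: "(\<Sum>i<rho. \<Sum>l<length fs. (cmod (h ! i \<bullet>c fs ! l))\<^sup>2) = 0"
    using le by (intro antisym sum_nonneg) auto
  then have hf: "g \<bullet>c h ! i = 0" if "i < rho" "g \<in> set fs" for g i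
  proof -
    obtain l where l: "l < length fs" "g = fs ! l" using \<open>g \<in> set fs\<close> by (auto simp: in_set_conv_nth)
    have "(\<Sum>l<length fs. (cmod (h ! i \<bullet>c fs ! l))\<^sup>2) = 0"
      using z0 \<open>i < rho\<close> by (subst (asm) sum_nonneg_eq_0_iff) (auto simp: sum_nonneg)
    then have "h ! i \<bullet>c g = 0" using l by (subst (asm) sum_nonneg_eq_0_iff) auto
    then show ?thesis using cmod_cscalar_prod_commute[OF hc fc[OF that(2)], of i] that P by simp
  qed
  have above: "f \<bullet>c u ! j = 0" if "j < d" "nu j > c" for j
  proof (rule positive_part_trace_le(2)[OF u P(1), where e = "\<lambda>j. nu j - c"])
    show "f \<bullet>c q = 0" if "q \<in> set ?P" for q
      using that hf[OF _ f] P by (auto simp: in_set_conv_nth)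
  qed (use that eq z0 mx P fc[OF f] in auto)
  have below: "f \<bullet>c u ! j = 0" if j: "j < d" "nu j < c" for j
  proof (cases "R = rho")
    case True
    then show ?thesis using j rho(3)[of j] by (simp add: nu_def split: if_splits)
  next
    case False
    then have R': "length fs + R \<le> d" using R by simp
    \<comment> \<open>On vectors orthogonal to \<open>fs\<close>, the quadratic form of S is that of
      \<open>S0\<close>. Since \<open>length fs + R \<le> d\<close>, there is room for
      \<open>R - rho\<close> of them that are also orthogonal to the first \<open>rho\<close>
      vectors of \<open>h\<close>.\<close>
    let ?vs = "fs @ ?P"
    have vs: "set ?vs \<subseteq> carrier_vec d" using fs P(1) by (auto simp: orthonormal_def)
    obtain qs where qs: "orthonormal d qs" "length qs = R - rho" "\<forall>q\<in>set qs. \<forall>v\<in>set ?vs. q \<bullet>c v = 0"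
      using ex_orthonormal_orthogonal[OF vs, of "R - rho"] R' P rho by auto
    have qc: "qs ! i \<in> carrier_vec d" if "i < R - rho" for i using orthonormal_nth_carrier[OF qs(1)] qs(2) that by simp
    have qh: "q \<bullet>c h ! i = 0" if "q \<in> set qs" "i < rho" for q i
      using qs(3) that nth_mem[of i ?P] P by auto
    have kf: "(\<Sum>i<R - rho. qform (real_weighted_op d lam h) (qs ! i)) \<le> (\<Sum>j\<in>{rho..<R}. lam j)"
      using ky_fan_below[OF h qs(1), of rho lam] lam qh qs(2) rho by simp
    have 1: "(\<Sum>i<length qs. \<Sum>j<d. (c - nu j) * (cmod (qs ! i \<bullet>c u ! j))\<^sup>2)
        = (\<Sum>i<R - rho. c - qform (real_weighted_op d lam h) (qs ! i))"
      unfolding qs(2)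
    proof (intro sum.cong refl)
      fix i assume "i \<in> {..<R - rho}"
      then have i: "i < R - rho" by simp
      then have qi: "qs ! i \<in> set qs" using qs(2) by simp
      have "(\<Sum>j<d. (c - nu j) * (cmod (qs ! i \<bullet>c u ! j))\<^sup>2) = - (\<Sum>j<d. (nu j - c) * (cmod (qs ! i \<bullet>c u ! j))\<^sup>2)"
        by (simp add: left_diff_distrib sum_subtractf)
      also have "\<dots> = c - qform (real_weighted_op d lam h) (qs ! i)"
        unfolding qS'[OF qc[OF i]] using nc[OF qs(1) qi] qs(3) qi by simp
      finally show "(\<Sum>j<d. (c - nu j) * (cmod (qs ! i \<bullet>c u ! j))\<^sup>2) = c - qform (real_weighted_op d lam h) (qs ! i)" .
    qed
    have 2: "(\<Sum>i<R - rho. c - qform (real_weighted_op d lam h) (qs ! i)) \<ge> (\<Sum>j\<in>{rho..<R}. c - lam j)"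
      using kf rho by (simp add: sum_subtractf)
    have 3: "(\<Sum>j\<in>{rho..<R}. c - lam j) = (\<Sum>j<d. max 0 (c - nu j))"
    proof -
      have "max 0 (c - nu j) = (if rho \<le> j \<and> j < R then c - lam j else 0)" if "j < d" for j
        using rho(1) rho(3)[of j] rho(4)[of j] that by (auto simp: nu_def max_def)
      then have "(\<Sum>j<d. max 0 (c - nu j)) = (\<Sum>j<d. if rho \<le> j \<and> j < R then c - lam j else 0)" by simp
      also have "\<dots> = (\<Sum>j\<in>{rho..<R}. c - lam j)" using rho by (intro sum.mono_neutral_cong_right) auto
      finally show ?thesis by simp
    qed
    \<comment> \<open>Ky Fan bounds the trace of c - S over \<open>qs\<close> from below, its
      positive part bounds it from above, and the two bounds coincide.\<close>
    have eq: "(\<Sum>i<length qs. \<Sum>j<d. (c - nu j) * (cmod (qs ! i \<bullet>c u ! j))\<^sup>2) = (\<Sum>j<d. max 0 (c - nu j))"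
      using positive_part_trace_le(1)[OF u qs(1), of "\<lambda>j. c - nu j"] qs(2) rho 1 2 3 by simp
    show ?thesis
    proof (rule positive_part_trace_le(2)[OF u qs(1) _ eq])
      show "f \<bullet>c q = 0" if "q \<in> set qs" for q
      proof -
        have "q \<in> carrier_vec d" using that orthonormal_set[OF qs(1)] by auto
        moreover have "q \<bullet>c f = 0" using qs(3) that f by simp
        ultimately show ?thesis using cmod_cscalar_prod_commute[OF _ fc[OF f], of q] by simp
      qed
    qed (use j qs(2) rho fc[OF f] in auto)
  qed
  have "real_weighted_op d nu u *\<^sub>v f = complex_of_real c \<cdot>\<^sub>v f"
  proof (rule eq_of_cscalar_prod_onb[OF u])
    show "real_weighted_op d nu u *\<^sub>v f \<in> carrier_vec d" by (rule mult_mat_vec_carrier[OF _ fc[OF f]]) simp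
    show "complex_of_real c \<cdot>\<^sub>v f \<in> carrier_vec d" using fc[OF f] by simp
    fix j assume j: "j < d"
    show "(real_weighted_op d nu u *\<^sub>v f) \<bullet>c u ! j = (complex_of_real c \<cdot>\<^sub>v f) \<bullet>c u ! j"
      unfolding weighted_op_cscalar_prod_onb[OF u fc[OF f] j]
        cscalar_prod_smult_left[OF fc[OF f] onb_nth_carrier[OF u j]]
      using above[OF j] below[OF j] by (cases "nu j" c rule: linorder_cases) auto
  qed
  then show ?thesis by (simp only: nu_def)
qed

text \<open>In a pair, \<open>v\<close> stands for an eigenvalue of \<open>S0\<close> and
  \<open>e\<close> for the eigenvalue of \<open>B\<close> on the same vector. Pairs whose sum is not
  \<open>c\<close> have \<open>e = 0\<close> and are read off from the sums; the others have
  \<open>e = c - v\<close>, and their first entries are what then remains of the \<open>fst\<close>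
  multiset.\<close>

lemma pair_mset_eq:
  fixes P Q :: "(real \<times> real) multiset"
  assumes P: "\<And>v e. (v, e) \<in># P \<Longrightarrow> e = 0 \<or> v + e = c" and Q: "\<And>v e. (v, e) \<in># Q \<Longrightarrow> e = 0 \<or> v + e = c"
    and 1: "image_mset fst P = image_mset fst Q"
    and 2: "image_mset (\<lambda>(v, e). v + e) P = image_mset (\<lambda>(v, e). v + e) Q"
  shows "P = Q"
proof -
  let ?s = "\<lambda>(v, e). v + e"
  have a: "filter_mset (\<lambda>p. ?s p \<noteq> c) M = image_mset (\<lambda>v. (v, 0)) (filter_mset (\<lambda>v. v \<noteq> c) (image_mset ?s M))"
    and b: "filter_mset (\<lambda>p. ?s p = c) M
      = image_mset (\<lambda>v. (v, c - v)) (image_mset fst M - image_mset fst (filter_mset (\<lambda>p. ?s p \<noteq> c) M))"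
    if M: "\<And>v e. (v, e) \<in># M \<Longrightarrow> e = 0 \<or> v + e = c" for M :: "(real \<times> real) multiset"
  proof -
    have "image_mset (\<lambda>p. (?s p, 0)) (filter_mset (\<lambda>p. ?s p \<noteq> c) M) = image_mset id (filter_mset (\<lambda>p. ?s p \<noteq> c) M)"
      using M by (intro image_mset_cong) force
    then show "filter_mset (\<lambda>p. ?s p \<noteq> c) M = image_mset (\<lambda>v. (v, 0)) (filter_mset (\<lambda>v. v \<noteq> c) (image_mset ?s M))"
      by (simp add: filter_mset_image_mset multiset.map_comp comp_def)
    have "image_mset fst M = image_mset fst (filter_mset (\<lambda>p. ?s p = c) M) + image_mset fst (filter_mset (\<lambda>p. ?s p \<noteq> c) M)"
      by (simp only: multiset_partition[of M "\<lambda>p. ?s p = c", symmetric] flip: image_mset_union)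
    then have "image_mset fst M - image_mset fst (filter_mset (\<lambda>p. ?s p \<noteq> c) M) = image_mset fst (filter_mset (\<lambda>p. ?s p = c) M)"
      by simp
    moreover have "image_mset (\<lambda>v. (v, c - v)) (image_mset fst (filter_mset (\<lambda>p. ?s p = c) M)) = filter_mset (\<lambda>p. ?s p = c) M"
    proof -
      have "image_mset (\<lambda>p. (fst p, c - fst p)) (filter_mset (\<lambda>p. ?s p = c) M) = image_mset id (filter_mset (\<lambda>p. ?s p = c) M)"
        by (intro image_mset_cong) auto
      then show ?thesis by (simp add: multiset.map_comp comp_def)
    qed
    ultimately show "filter_mset (\<lambda>p. ?s p = c) M
      = image_mset (\<lambda>v. (v, c - v)) (image_mset fst M - image_mset fst (filter_mset (\<lambda>p. ?s p \<noteq> c) M))" by simp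
  qed
  have "filter_mset (\<lambda>p. ?s p \<noteq> c) P = filter_mset (\<lambda>p. ?s p \<noteq> c) Q"
    using a[OF P] a[OF Q] 2 by simp
  moreover from this have "filter_mset (\<lambda>p. ?s p = c) P = filter_mset (\<lambda>p. ?s p = c) Q"
    using b[OF P] b[OF Q] 1 by simp
  ultimately show ?thesis
    using multiset_partition[of P "\<lambda>p. ?s p = c"] multiset_partition[of Q "\<lambda>p. ?s p = c"] by simp
qed

text \<open>The sum \<open>A\<close> multiplies every vector of \<open>fs\<close> by
  \<open>c\<close>, so A B = c B, and taking adjoints gives B A = c B. In a common eigenbasis each
  eigenvalue of \<open>B\<close> is zero or sits over the eigenvalue \<open>c\<close> of
  \<open>A\<close>, and \<open>pair_mset_eq\<close> identifies the joint spectrum of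
  \<open>S0\<close> and \<open>B\<close>.\<close>

lemma optimal_operator_structure:
  fixes lam :: "nat \<Rightarrow> real"
  assumes h: "onb d h" and u: "onb d u" and fs: "set fs \<subseteq> carrier_vec d"
    and S: "real_weighted_op d lam h + frame_op d fs = real_weighted_op d (\<lambda>i. if i < R then lam i else c) u"
    and lam: "\<And>i j. i \<le> j \<Longrightarrow> j < d \<Longrightarrow> lam j \<le> lam i"
    and rho: "rho \<le> R" "R \<le> d" "\<And>i. i < rho \<Longrightarrow> c < lam i" "\<And>i. rho \<le> i \<Longrightarrow> i < d \<Longrightarrow> lam i \<le> c"
    and R: "R = rho \<or> length fs + R \<le> d"
  obtains hs where "onb d hs" "real_weighted_op d lam h = real_weighted_op d lam hs"
    "frame_op d fs = real_weighted_op d (\<lambda>i. if i < R then 0 else c - lam i) hs"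
proof -
  define nu where "nu = (\<lambda>i. if i < R then lam i else c)"
  define A where "A = real_weighted_op d nu u"
  define B where "B = frame_op d fs"
  have A: "hermitian d A" "A \<in> carrier_mat d d" by (simp_all add: A_def hermitian_weighted_op)
  have B: "hermitian d B" "B \<in> carrier_mat d d"
    using hermitian_frame_op[OF fs] frame_op_carrier[OF fs] by (simp_all add: B_def)
  have Af: "A *\<^sub>v f = complex_of_real c \<cdot>\<^sub>v f" if "f \<in> set fs" for f
    unfolding A_def nu_def
    by (rule optimal_frame_vectors_eigen[OF h u fs S lam rho R that])
  have AB: "(A * B) $$ (a, b) = complex_of_real c * B $$ (a, b)" if ab: "a < d" "b < d" for a b
  proof -
    have Ai: "(\<Sum>l<d. A $$ (a, l) * fs ! i $ l) = complex_of_real c * fs ! i $ a" if i: "i < length fs" for i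
    proof -
      have "fs ! i \<in> carrier_vec d" using i fs by auto
      then show ?thesis using mult_mat_vec_index[OF A(2) _ ab(1), of "fs ! i"] Af[of "fs ! i"] i ab by simp
    qed
    have "(A * B) $$ (a, b) = (\<Sum>l<d. \<Sum>i<length fs. A $$ (a, l) * fs ! i $ l * cnj (fs ! i $ b))"
      unfolding mult_mat_index[OF A(2) B(2) ab]
      using ab by (simp add: B_def frame_op_weighted[OF fs] weighted_op_index sum_distrib_left mult.assoc)
    also have "\<dots> = (\<Sum>i<length fs. (\<Sum>l<d. A $$ (a, l) * fs ! i $ l) * cnj (fs ! i $ b))"
      unfolding sum_distrib_right by (rule sum.swap)
    also have "\<dots> = complex_of_real c * B $$ (a, b)"
      using ab Ai by (simp add: B_def frame_op_weighted[OF fs] weighted_op_index sum_distrib_left mult.assoc)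
    finally show ?thesis .
  qed
  have BA: "(B * A) $$ (a, b) = complex_of_real c * B $$ (a, b)" if ab: "a < d" "b < d" for a b
  proof -
    have "(B * A) $$ (a, b) = (\<Sum>l<d. cnj (A $$ (b, l) * B $$ (l, a)))"
      unfolding mult_mat_index[OF B(2) A(2) ab]
    proof (intro sum.cong refl)
      fix l assume "l \<in> {..<d}"
      then have "B $$ (a, l) = cnj (B $$ (l, a))" "A $$ (l, b) = cnj (A $$ (b, l))"
        using ab by (auto intro: hermitian_index A(1) B(1))
      then show "B $$ (a, l) * A $$ (l, b) = cnj (A $$ (b, l) * B $$ (l, a))" by simp
    qed
    also have "\<dots> = cnj (complex_of_real c * B $$ (b, a))"
      using AB[OF ab(2,1)] unfolding mult_mat_index[OF A(2) B(2) ab(2,1)] by (metis cnj_sum)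
    also have "\<dots> = complex_of_real c * B $$ (a, b)"
      using hermitian_index[OF B(1) ab] by simp
    finally show ?thesis .
  qed
  have comm: "A * B = B * A" using AB BA A B by (intro eq_matI) (auto simp del: index_mult_mat(1))
  obtain w e g where w: "onb d w" "A = real_weighted_op d e w" "B = real_weighted_op d g w"
    using commuting_hermitian_spectral[OF A(1) B(1) comm] .
  have cases: "g i = 0 \<or> e i = c" if i: "i < d" for i
  proof -
    have wi: "w ! i \<in> carrier_vec d" using onb_nth_carrier[OF w(1) i] .
    have cB: "A * B = complex_of_real c \<cdot>\<^sub>m B" using AB A B by (intro eq_matI) (auto simp del: index_mult_mat(1))
    have Bw: "B *\<^sub>v w ! i = complex_of_real (g i) \<cdot>\<^sub>v w ! i" and Aw: "A *\<^sub>v w ! i = complex_of_real (e i) \<cdot>\<^sub>v w ! i"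
      using weighted_op_mult_basis[of d w i] w i by (auto simp: onb_def)
    have "(A * B) *\<^sub>v w ! i = complex_of_real (g i * e i) \<cdot>\<^sub>v w ! i"
      using assoc_mult_mat_vec[OF A(2) B(2) wi] Bw Aw mult_mat_vec[OF A(2) wi] by (simp add: smult_smult_assoc)
    moreover have "(complex_of_real c \<cdot>\<^sub>m B) *\<^sub>v w ! i = complex_of_real (c * g i) \<cdot>\<^sub>v w ! i"
    proof -
      have "(complex_of_real c \<cdot>\<^sub>m B) *\<^sub>v w ! i = complex_of_real c \<cdot>\<^sub>v (B *\<^sub>v w ! i)"
        using B(2) wi by (intro eq_vecI) (auto simp: scalar_prod_def sum_distrib_left mult.assoc)
      then show ?thesis by (simp add: Bw smult_smult_assoc)
    qed
    ultimately have eq: "complex_of_real (g i * e i) \<cdot>\<^sub>v w ! i = complex_of_real (c * g i) \<cdot>\<^sub>v w ! i"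
      using cB by simp
    have "complex_of_real (g i * e i) = complex_of_real (c * g i)"
      using arg_cong[OF eq, of "\<lambda>x. x \<bullet>c w ! i"] cscalar_prod_smult_left[OF wi wi] onb_cscalar_prod[OF w(1) i i] by simp
    then have "g i * e i = c * g i" by (simp only: of_real_eq_iff)
    then show ?thesis by auto
  qed
  have hw: "real_weighted_op d lam h = real_weighted_op d (\<lambda>i. e i - g i) w"
  proof -
    have "real_weighted_op d lam h + B = real_weighted_op d (\<lambda>i. e i - g i) w + B"
      using S w weighted_op_add[of d "\<lambda>i. complex_of_real (e i - g i)" w "\<lambda>i. complex_of_real (g i)"]
      by (simp add: A_def B_def nu_def)
    then have *: "(real_weighted_op d lam h + B) $$ (a, b) = (real_weighted_op d (\<lambda>i. e i - g i) w + B) $$ (a, b)" for a b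
      by (simp only:)
    have "real_weighted_op d lam h $$ (a, b) = real_weighted_op d (\<lambda>i. e i - g i) w $$ (a, b)"
      if "a < d" "b < d" for a b
      using *[of a b] that B(2) by (simp del: of_real_diff)
    then show ?thesis by (intro eq_matI) (simp_all del: of_real_diff)
  qed
  have m1: "mset (map lam [0..<d]) = mset (map (\<lambda>i. e i - g i) [0..<d])"
    using eigs_weighted_op[OF h, of lam] eigs_weighted_op[OF w(1), of "\<lambda>i. e i - g i"] hw
    unfolding decr_eq_iff[symmetric] by (simp only:)
  have m2: "mset (map nu [0..<d]) = mset (map e [0..<d])"
    using eigs_weighted_op[OF u, of nu] eigs_weighted_op[OF w(1), of e] w(2)
    unfolding decr_eq_iff[symmetric] A_def by (simp only:)
  \<comment> \<open>The joint spectrum as a multiset of pairs; reordering pairs keeps both operators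
    diagonal in the same basis.\<close>
  have "mset (map (\<lambda>i. (e i - g i, g i)) [0..<d]) = mset (map (\<lambda>i. (lam i, if i < R then 0 else c - lam i)) [0..<d])"
  proof (rule pair_mset_eq[where c = c])
    show "image_mset fst (mset (map (\<lambda>i. (e i - g i, g i)) [0..<d]))
      = image_mset fst (mset (map (\<lambda>i. (lam i, if i < R then 0 else c - lam i)) [0..<d]))"
      using m1 by (simp add: multiset.map_comp comp_def)
    have "image_mset (\<lambda>(v, e). v + e) (mset (map (\<lambda>i. (lam i, if i < R then 0 else c - lam i)) [0..<d])) = mset (map nu [0..<d])"
      by (auto simp: multiset.map_comp comp_def nu_def intro!: image_mset_cong)
    then show "image_mset (\<lambda>(v, e). v + e) (mset (map (\<lambda>i. (e i - g i, g i)) [0..<d]))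
      = image_mset (\<lambda>(v, e). v + e) (mset (map (\<lambda>i. (lam i, if i < R then 0 else c - lam i)) [0..<d]))"
      using m2 by (simp add: multiset.map_comp comp_def)
    show "ev = 0 \<or> v + ev = c" if "(v, ev) \<in># mset (map (\<lambda>i. (e i - g i, g i)) [0..<d])" for v ev
      using that cases by fastforce
  qed (auto split: if_splits)
  from weighted_op_reorder[OF w(1) this] obtain hs where hs: "onb d hs"
    "\<And>v. weighted_op d (\<lambda>i. v (e i - g i, g i)) w = weighted_op d (\<lambda>i. v (lam i, if i < R then 0 else c - lam i)) hs"
    by blast
  show thesis
  proof (rule that[OF hs(1)])
    show "real_weighted_op d lam h = real_weighted_op d lam hs"
      using hw hs(2)[of "\<lambda>p. complex_of_real (fst p)"] by simp
    show "frame_op d fs = real_weighted_op d (\<lambda>i. if i < R then 0 else c - lam i) hs"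
      using w(3) hs(2)[of "\<lambda>p. complex_of_real (snd p)"] by (simp add: B_def)
  qed
qed

section \<open>Frames with prescribed norms and frame operator\<close>

text \<open>A rotation of the pair preserves the sum of the two rank-one operators, hence also the
  sum of the squared norms. The squared norm of the first vector moves continuously from
  \<open>norm_sq g\<close> at angle 0 to \<open>norm_sq h\<close> at pi/2 and so takes the value
  \<open>y\<close>.\<close>

lemma rotate_pair:
  assumes g: "g \<in> carrier_vec d" and h: "h \<in> carrier_vec d"
    and y: "norm_sq h \<le> y" "y \<le> norm_sq g"
  obtains g' h' where "g' \<in> carrier_vec d" "h' \<in> carrier_vec d" "norm_sq g' = y"
    "norm_sq h' = norm_sq g + norm_sq h - y"
    "\<And>a b. a < d \<Longrightarrow> b < d \<Longrightarrow> g' $ a * cnj (g' $ b) + h' $ a * cnj (h' $ b) = g $ a * cnj (g $ b) + h $ a * cnj (h $ b)"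
proof -
  define G where "G = (\<lambda>\<theta>. vec d (\<lambda>a. complex_of_real (cos \<theta>) * g $ a + complex_of_real (sin \<theta>) * h $ a))"
  define H where "H = (\<lambda>\<theta>. vec d (\<lambda>a. complex_of_real (cos \<theta>) * h $ a - complex_of_real (sin \<theta>) * g $ a))"
  have Gc: "G \<theta> \<in> carrier_vec d" and Hc: "H \<theta> \<in> carrier_vec d" for \<theta> by (simp_all add: G_def H_def)
  have nG: "norm_sq (G \<theta>) = (\<Sum>a<d. (cmod (complex_of_real (cos \<theta>) * g $ a + complex_of_real (sin \<theta>) * h $ a))\<^sup>2)" for \<theta>
    by (simp add: norm_sq_sum[OF Gc]) (simp add: G_def)
  have "continuous_on {0..pi/2} (\<lambda>\<theta>. norm_sq (G \<theta>))"
    unfolding nG by (intro continuous_intros)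
  moreover have "norm_sq (G 0) = norm_sq g" "norm_sq (G (pi/2)) = norm_sq h"
    by (simp_all add: nG norm_sq_sum[OF g] norm_sq_sum[OF h])
  ultimately obtain \<theta> where \<theta>: "norm_sq (G \<theta>) = y"
    using IVT2'[of "\<lambda>\<theta>. norm_sq (G \<theta>)" "pi/2" y 0] y by auto
  have sc: "complex_of_real (cos \<theta>) * complex_of_real (cos \<theta>) = 1 - complex_of_real (sin \<theta>) * complex_of_real (sin \<theta>)"
  proof -
    have "cos \<theta> * cos \<theta> = 1 - sin \<theta> * sin \<theta>" using sin_cos_squared_add3[of \<theta>] by linarith
    from arg_cong[OF this, of complex_of_real] show ?thesis by simp
  qed
  have e: "G \<theta> $ a * cnj (G \<theta> $ b) + H \<theta> $ a * cnj (H \<theta> $ b) = g $ a * cnj (g $ b) + h $ a * cnj (h $ b)"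
    if "a < d" "b < d" for a b
  proof -
    have "G \<theta> $ a * cnj (G \<theta> $ b) + H \<theta> $ a * cnj (H \<theta> $ b)
      = (complex_of_real (cos \<theta>) * complex_of_real (cos \<theta>) + complex_of_real (sin \<theta>) * complex_of_real (sin \<theta>))
        * (g $ a * cnj (g $ b) + h $ a * cnj (h $ b))"
      using that by (simp add: G_def H_def algebra_simps)
    then show ?thesis unfolding sc by simp
  qed
  have "complex_of_real (norm_sq (G \<theta>) + norm_sq (H \<theta>)) = complex_of_real (norm_sq g + norm_sq h)"
    unfolding of_real_add cscalar_prod_self[OF Gc, symmetric] cscalar_prod_self[OF Hc, symmetric]
      cscalar_prod_self[OF g, symmetric] cscalar_prod_self[OF h, symmetric]
    unfolding cscalar_prod_sum[OF Gc Gc] cscalar_prod_sum[OF Hc Hc] cscalar_prod_sum[OF g g] cscalar_prod_sum[OF h h]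
      sum.distrib[symmetric]
    using e by (intro sum.cong refl) auto
  then have "norm_sq (G \<theta>) + norm_sq (H \<theta>) = norm_sq g + norm_sq h" by (simp only: of_real_eq_iff)
  then show thesis using \<theta> e Gc Hc by (intro that[of "G \<theta>" "H \<theta>"]) auto
qed

text \<open>A discrete intermediate value argument. Its use depends on \<open>g\<close> and
  \<open>h\<close> being adjacent: a vector of intermediate norm can replace both without disturbing
  the order.\<close>

lemma list_crossing:
  fixes f :: "'a \<Rightarrow> real"
  assumes "2 \<le> length xs" "y \<le> f (hd xs)" "f (last xs) \<le> y"
  obtains as g h bs where "xs = as @ g # h # bs" "y \<le> f g" "f h \<le> y"
proof -
  have "2 \<le> length xs \<Longrightarrow> y \<le> f (hd xs) \<Longrightarrow> f (last xs) \<le> y \<Longrightarrow>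
    \<exists>as g h bs. xs = as @ g # h # bs \<and> y \<le> f g \<and> f h \<le> y"
  proof (induction xs)
    case (Cons x xs)
    then obtain x' rest where xs: "xs = x' # rest" by (cases xs) auto
    show ?case
    proof (cases "f x' \<le> y")
      case True
      then show ?thesis using Cons.prems xs by (intro exI[of _ "[]"]) auto
    next
      case False
      then have "rest \<noteq> []" using Cons.prems xs by auto
      then have "2 \<le> length xs" "y \<le> f (hd xs)" "f (last xs) \<le> y" using xs False Cons.prems by (auto simp: Suc_le_eq)
      from Cons.IH[OF this] obtain as g h bs where "xs = as @ g # h # bs" "y \<le> f g" "f h \<le> y" by blast
      then show ?thesis by (intro exI[of _ "x # as"]) auto
    qed
  qed simp
  then show thesis using assms that by blast
qed

lemma sum_list_le_const_mult:
  fixes xs :: "real list"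
  shows "(\<And>x. x \<in> set xs \<Longrightarrow> x \<le> y) \<Longrightarrow> sum_list xs \<le> real (length xs) * y"
  by (induction xs) (auto simp: algebra_simps intro: add_mono)

lemma sum_list_ge_const_mult:
  fixes xs :: "real list"
  shows "(\<And>x. x \<in> set xs \<Longrightarrow> y \<le> x) \<Longrightarrow> real (length xs) * y \<le> sum_list xs"
  by (induction xs) (auto simp: algebra_simps intro: add_mono)

text \<open>Two adjacent vectors are rotated so that one of them gets the largest required norm; the
  norms of the others remain decreasing and still majorize the remaining requirements.\<close>

lemma frame_op_prescribed_norms_sorted:
  assumes "set G \<subseteq> carrier_vec d" "length G = length ys"
    and "sorted_wrt (\<ge>) (map norm_sq G)" "sorted_wrt (\<ge>) ys"
    and "\<And>j. j \<le> length ys \<Longrightarrow> sum_list (take j ys) \<le> sum_list (take j (map norm_sq G))"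
    and "sum_list ys = sum_list (map norm_sq G)"
  shows "\<exists>G'. set G' \<subseteq> carrier_vec d \<and> map norm_sq G' = ys \<and> frame_op d G' = frame_op d G"
  using assms
proof (induction ys arbitrary: G)
  case Nil
  then show ?case by (intro exI[of _ "[]"]) simp
next
  case (Cons y ys)
  show ?case
  proof (cases "ys = []")
    case True
    then obtain g where "G = [g]" using Cons.prems(2) by (cases G) auto
    then show ?thesis using Cons.prems True by (intro exI[of _ G]) auto
  next
    case False
    then have len: "2 \<le> length G" using Cons.prems(2) by (cases ys) auto
    then have G: "G \<noteq> []" by auto
    have hd: "y \<le> norm_sq (hd G)" using Cons.prems(5)[of 1] G by (cases G) auto
    have ys: "\<And>x. x \<in> set ys \<Longrightarrow> x \<le> y" using Cons.prems(4) by auto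
    \<comment> \<open>The smallest norm is at most the mean of all norms, which is the mean of
      \<open>y # ys\<close> and thus at most \<open>y\<close>.\<close>
    have "norm_sq (last G) \<le> norm_sq g" if "g \<in> set G" for g
    proof -
      have "G = butlast G @ [last G]" using G by simp
      then have "sorted_wrt (\<ge>) (map norm_sq (butlast G) @ [norm_sq (last G)])" "g \<in> set (butlast G @ [last G])"
        using Cons.prems(3) that by (metis list.simps(8,9) map_append)+
      then show ?thesis by (auto simp: sorted_wrt_append)
    qed
    then have "real (length G) * norm_sq (last G) \<le> sum_list (map norm_sq G)"
      using sum_list_ge_const_mult[of "map norm_sq G"] by auto
    also have "\<dots> = sum_list (y # ys)" using Cons.prems(6) by simp
    also have "\<dots> \<le> real (length G) * y"
      using sum_list_le_const_mult[of "y # ys" y] ys Cons.prems(2) by auto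
    finally have last: "norm_sq (last G) \<le> y" using G by simp
    obtain as g h bs where dec: "G = as @ g # h # bs" "y \<le> norm_sq g" "norm_sq h \<le> y"
      using list_crossing[OF len, of y norm_sq] hd last by blast
    have gh: "g \<in> carrier_vec d" "h \<in> carrier_vec d" using Cons.prems(1) dec by auto
    obtain g' h' where gh': "g' \<in> carrier_vec d" "h' \<in> carrier_vec d" "norm_sq g' = y"
      "norm_sq h' = norm_sq g + norm_sq h - y"
      "\<And>a b. a < d \<Longrightarrow> b < d \<Longrightarrow> g' $ a * cnj (g' $ b) + h' $ a * cnj (h' $ b) = g $ a * cnj (g $ b) + h $ a * cnj (h $ b)"
      using rotate_pair[OF gh dec(3,2)] by blast
    \<comment> \<open>The vector \<open>g'\<close> has squared norm \<open>y\<close> and is set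
      aside. That of \<open>h'\<close> lies between those of \<open>h\<close> and \<open>g\<close>,
      so the remaining list stays sorted.\<close>
    let ?G = "as @ h' # bs"
    have c: "set ?G \<subseteq> carrier_vec d" using Cons.prems(1) dec gh' by auto
    have "\<exists>G'. set G' \<subseteq> carrier_vec d \<and> map norm_sq G' = ys \<and> frame_op d G' = frame_op d ?G"
    proof (rule Cons.IH[OF c])
      show "length ?G = length ys" using Cons.prems(2) dec by simp
      show "sorted_wrt (\<ge>) (map norm_sq ?G)"
        using Cons.prems(3) dec gh'(4) by (fastforce simp: sorted_wrt_append)
      show "sorted_wrt (\<ge>) ys" using Cons.prems(4) by simp
      show "sum_list ys = sum_list (map norm_sq ?G)" using Cons.prems(6) dec gh'(4) by simp
      \<comment> \<open>Before the position of \<open>h'\<close>, the number \<open>y\<close>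
        separates the entries of \<open>ys\<close> from the norms. Beyond it, both partial sums are
        those of the original lists one step later, diminished by \<open>y\<close>.\<close>
      fix j assume j: "j \<le> length ys"
      show "sum_list (take j ys) \<le> sum_list (take j (map norm_sq ?G))"
      proof (cases "j \<le> length as")
        case True
        have "sum_list (take j ys) \<le> real j * y"
          using sum_list_le_const_mult[of "take j ys" y] ys j by (auto dest: in_set_takeD)
        also have "\<dots> \<le> sum_list (map norm_sq (take j as))"
        proof -
          have "y \<le> norm_sq x" if "x \<in> set (take j as)" for x
            using Cons.prems(3) dec in_set_takeD[OF that] by (fastforce simp: sorted_wrt_append)
          then show ?thesis
            using sum_list_ge_const_mult[of "map norm_sq (take j as)" y] True by auto
        qed
        finally show ?thesis using True by (simp add: take_map)
      next
        case False
        define l where "l = j - Suc (length as)"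
        have l: "j = Suc (length as + l)" using False by (simp add: l_def)
        have "y + sum_list (take j ys) \<le> sum_list (take (Suc j) (map norm_sq G))"
          using Cons.prems(5)[of "Suc j"] j by simp
        then show ?thesis using dec(1) gh'(4) by (simp add: l)
      qed
    qed
    then obtain G' where G': "set G' \<subseteq> carrier_vec d" "map norm_sq G' = ys" "frame_op d G' = frame_op d ?G" by blast
    have c': "set (g' # G') \<subseteq> carrier_vec d" using G'(1) gh' by simp
    have "frame_op d (g' # G') = frame_op d G"
    proof (rule eq_matI)
      fix a b assume "a < dim_row (frame_op d G)" "b < dim_col (frame_op d G)"
      then have ab: "a < d" "b < d" using frame_op_carrier[OF Cons.prems(1)] by auto
      have "frame_op d (g' # G') $$ (a, b) = g' $ a * cnj (g' $ b) + frame_op d ?G $$ (a, b)"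
        using frame_op_index[OF c' ab] frame_op_index[OF G'(1) ab] G'(3) by simp
      also have "\<dots> = frame_op d G $$ (a, b)"
        using frame_op_index[OF c ab] frame_op_index[OF Cons.prems(1) ab] gh'(5)[OF ab] dec(1)
        by (simp add: algebra_simps)
      finally show "frame_op d (g' # G') $$ (a, b) = frame_op d G $$ (a, b)" .
    qed (use frame_op_carrier[OF Cons.prems(1)] frame_op_carrier[OF c'] in auto)
    then show ?thesis using G' gh'(3) c' by (intro exI[of _ "g' # G'"]) simp
  qed
qed

lemma map_reorder:
  assumes "mset (map f xs) = mset ys"
  obtains xs' where "mset xs' = mset xs" "map f xs' = ys"
proof -
  obtain p where p: "p permutes {..<length (map f xs)}" "permute_list p (map f xs) = ys"
    using mset_eq_permutation[OF assms[symmetric]] .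
  then show thesis
    by (intro that[of "permute_list p xs"]) (auto simp: permute_list_map)
qed

text \<open>Frame operators do not depend on the order of the vectors, so the sorted case can be
  applied to rearrangements of \<open>G\<close> and \<open>b\<close>, and its result permuted
  back.\<close>

lemma schur_horn_frame:
  assumes G: "set G \<subseteq> carrier_vec d" "length G = length b" and maj: "b \<prec>\<^sub>m map norm_sq G"
  obtains G' where "set G' \<subseteq> carrier_vec d" "map norm_sq G' = b" "frame_op d G' = frame_op d G"
proof -
  have maj': "j \<le> length b \<Longrightarrow> sum_list (take j (decr b)) \<le> sum_list (take j (decr (map norm_sq G)))"
    "sum_list (decr b) = sum_list (decr (map norm_sq G))" for j
    using maj G(2) by (simp_all add: majorized_def Let_def pad_def)
  obtain G1 where G1: "mset G1 = mset G" "map norm_sq G1 = decr (map norm_sq G)"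
    using map_reorder[of norm_sq G "decr (map norm_sq G)"] by auto
  have c: "set G1 \<subseteq> carrier_vec d" using G(1) G1(1) by (metis set_mset_mset)
  have len: "length G1 = length (decr b)" using G1(1) G(2) by (metis length_decr size_mset)
  have "\<exists>G'. set G' \<subseteq> carrier_vec d \<and> map norm_sq G' = decr b \<and> frame_op d G' = frame_op d G1"
    using maj' by (intro frame_op_prescribed_norms_sorted c len) (simp_all add: G1(2) sorted_decr)
  then obtain G2 where G2: "set G2 \<subseteq> carrier_vec d" "map norm_sq G2 = decr b" "frame_op d G2 = frame_op d G1" by blast
  obtain G3 where G3: "mset G3 = mset G2" "map norm_sq G3 = b" using map_reorder[of norm_sq G2 b] G2(2) by auto
  have "set G3 \<subseteq> carrier_vec d" using G2(1) G3(1) by (metis set_mset_mset)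
  moreover have "frame_op d G3 = frame_op d G"
    using frame_op_mset_cong[OF G3(1) calculation] G2(3) frame_op_mset_cong[OF G1(1) c] by simp
  ultimately show thesis using G3(2) that by blast
qed

section \<open>The optimal spectrum\<close>

lemma majorized_iff_sorted:
  assumes "length x = n" "length y = n" "sorted_wrt (\<ge>) x" "sorted_wrt (\<ge>) y"
  shows "x \<prec>\<^sub>m y \<longleftrightarrow> (\<forall>j\<le>n. (\<Sum>i<j. x ! i) \<le> (\<Sum>i<j. y ! i)) \<and> (\<Sum>i<n. x ! i) = (\<Sum>i<n. y ! i)"
proof -
  have t: "sum_list (take j z) = (\<Sum>i<j. z ! i)" if "j \<le> length z" for j and z :: "real list"
    using that by (simp add: sum_list_sum_nth atLeast0LessThan min_def)
  have s: "sum_list z = (\<Sum>i<length z. z ! i)" for z :: "real list"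
    by (simp add: sum_list_sum_nth atLeast0LessThan)
  show ?thesis
    using assms by (simp add: majorized_def Let_def pad_def decr_id s t cong: conj_cong)
qed

lemma majorized_antisym_sorted:
  assumes "length x = n" "length y = n" "sorted_wrt (\<ge>) x" "sorted_wrt (\<ge>) y"
    and "x \<prec>\<^sub>m y" "y \<prec>\<^sub>m x"
  shows "x = y"
proof (rule nth_equalityI)
  have eq: "(\<Sum>i<j. x ! i) = (\<Sum>i<j. y ! i)" if "j \<le> n" for j
    using assms(5,6) that majorized_iff_sorted[OF assms(1-4)] majorized_iff_sorted[OF assms(2,1,4,3)]
    by (auto intro: antisym)
  fix i assume "i < length x"
  then show "x ! i = y ! i" using eq[of i] eq[of "Suc i"] assms(1) by simp
qed (use assms in simp)

text \<open>A single formula for the three branches of \<open>nu_opt\<close>: \<open>R = rho\<close>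
  in the first one and \<open>R = nat m\<close> in the other two, with \<open>rho = 0\<close> in the
  last. Here \<open>rho\<close> counts the entries above \<open>c\<close>, and \<open>R\<close> the
  entries of \<open>lam\<close> that are kept.\<close>

definition opt_spectrum :: "real list \<Rightarrow> real \<Rightarrow> nat \<Rightarrow> nat \<Rightarrow> real list" where
  "opt_spectrum lam c rho R = take rho lam @ replicate (length lam - R) c @ drop rho (take R lam)"

lemma length_opt_spectrum:
  "rho \<le> R \<Longrightarrow> R \<le> length lam \<Longrightarrow> length (opt_spectrum lam c rho R) = length lam"
  by (simp add: opt_spectrum_def)

text \<open>The right side lists the same spectrum along an eigenbasis of \<open>S0\<close>, where
  it is \<open>lam\<close> plus the weights of \<open>B\<close>.\<close>

lemma mset_opt_spectrum:
  assumes "rho \<le> R" "R \<le> length lam"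
  shows "mset (opt_spectrum lam c rho R) = mset (map (\<lambda>i. if i < R then lam ! i else c) [0..<length lam])"
proof -
  have "map (\<lambda>i. if i < R then lam ! i else c) [0..<length lam] = take R lam @ replicate (length lam - R) c"
    using assms by (intro nth_equalityI) (auto simp: nth_append)
  moreover have "take R lam = take rho lam @ drop rho (take R lam)"
    using assms by (metis append_take_drop_id min.absorb1 take_take)
  ultimately show ?thesis
    unfolding opt_spectrum_def by (metis add.assoc add.commute mset_append)
qed

lemma nth_opt_spectrum:
  assumes "rho \<le> R" "R \<le> length lam" "i < length lam"
  shows "opt_spectrum lam c rho R ! i = (if i < rho then lam ! i
    else if i < rho + (length lam - R) then c else lam ! (i - (length lam - R)))"
  using assms by (auto simp: opt_spectrum_def nth_append)

lemma sorted_opt_spectrum: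
  assumes "rho \<le> R" "R \<le> length lam" "sorted_wrt (\<ge>) lam"
    and "\<And>i. i < rho \<Longrightarrow> c < lam ! i" "\<And>i. rho \<le> i \<Longrightarrow> i < length lam \<Longrightarrow> lam ! i \<le> c"
  shows "sorted_wrt (\<ge>) (opt_spectrum lam c rho R)"
proof -
  have "c \<le> x" if "x \<in> set (take rho lam)" for x
    using that assms(1,2,4) by (auto simp: in_set_conv_nth intro: less_imp_le)
  moreover have "x \<le> c" if "x \<in> set (drop rho (take R lam))" for x
    using that assms(2,5) by (auto simp: in_set_conv_nth)
  moreover have "sorted_wrt (\<ge>) (replicate n c)" for n by (induction n) auto
  moreover have "y \<le> x" if "x \<in> set (take rho lam)" "y \<in> set (drop rho (take R lam))" for x y
    using calculation(1)[OF that(1)] calculation(2)[OF that(2)] by simp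
  ultimately show ?thesis
    unfolding opt_spectrum_def using assms(3)
    by (auto simp: sorted_wrt_append sorted_wrt_take sorted_wrt_drop)
qed

text \<open>The partial sums of the difference are concave on the block where \<open>opt_spectrum\<close> is
  constant, and they are nonnegative outside of that block by interlacing.\<close>

lemma opt_spectrum_majorized:
  fixes beta :: "real list"
  assumes d: "length lam = d" "length beta = d"
    and rho: "rho \<le> R" "R \<le> d"
      "\<And>i. i < rho \<Longrightarrow> c < lam ! i" "\<And>i. rho \<le> i \<Longrightarrow> i < d \<Longrightarrow> lam ! i \<le> c"
    and sorted: "sorted_wrt (\<ge>) lam" "sorted_wrt (\<ge>) beta"
    and lower: "\<And>i. i < d \<Longrightarrow> lam ! i \<le> beta ! i"
    and upper: "\<And>i. rho \<le> i \<Longrightarrow> i < R \<Longrightarrow> beta ! (d - R + i) \<le> lam ! i"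
    and total: "(\<Sum>i<d. beta ! i) = (\<Sum>i<d. lam ! i) + (\<Sum>i\<in>{R..<d}. c - lam ! i)"
  shows "opt_spectrum lam c rho R \<prec>\<^sub>m beta"
proof -
  define nu where "nu = opt_spectrum lam c rho R"
  \<comment> \<open>The entries equal to \<open>c\<close> that were raised occupy the positions from
    \<open>rho\<close> up to, but excluding, \<open>q\<close>.\<close>
  define q where "q = rho + (d - R)"
  define D where "D = (\<lambda>j. \<Sum>i<j. beta ! i - nu ! i)"
  have q: "rho \<le> q" "q \<le> d" using rho by (auto simp: q_def)
  have nu: "nu ! i = (if i < rho then lam ! i else if i < q then c else lam ! (i - (d - R)))" if "i < d" for i
    using nth_opt_spectrum[of rho R lam i c] that rho d by (simp add: nu_def q_def)
  have nlen: "length nu = d" using length_opt_spectrum rho d by (simp add: nu_def)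
  have split: "D j = D i + (\<Sum>l\<in>{i..<j}. beta ! l - nu ! l)" if "i \<le> j" for i j
    unfolding D_def using that by (subst sum.union_disjoint[symmetric]) (auto intro!: sum.cong)
  have "(\<Sum>i<d. nu ! i) = (\<Sum>i<d. if i < R then lam ! i else c)"
  proof -
    have "(\<Sum>i<d. nu ! i) = sum_list nu" using nlen by (simp add: sum_list_sum_nth atLeast0LessThan)
    also have "\<dots> = sum_list (map (\<lambda>i. if i < R then lam ! i else c) [0..<d])"
      using mset_opt_spectrum[of rho R lam c] rho d by (metis nu_def sum_mset_sum_list)
    finally show ?thesis by (simp add: interv_sum_list_conv_sum_set_nat atLeast0LessThan)
  qed
  also have "\<dots> = (\<Sum>i<d. lam ! i + (if i \<in> {R..<d} then c - lam ! i else 0))"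
    by (intro sum.cong) auto
  also have "\<dots> = (\<Sum>i<d. beta ! i)"
  proof -
    have "(\<Sum>i<d. if i \<in> {R..<d} then c - lam ! i else 0) = (\<Sum>i\<in>{R..<d}. c - lam ! i)"
      by (intro sum.mono_neutral_cong_right) auto
    then show ?thesis unfolding sum.distrib total by simp
  qed
  finally have tot: "(\<Sum>i<d. nu ! i) = (\<Sum>i<d. beta ! i)" .
  then have Dd: "D d = 0" by (simp add: D_def sum_subtractf)
  have low: "D j \<ge> 0" if "j \<le> rho" for j
    unfolding D_def using that nu lower q by (intro sum_nonneg) auto
  \<comment> \<open>Here the increments are summed from the right end, where \<open>D d = 0\<close>.
    Entry \<open>l\<close> of \<open>nu\<close> is the entry of \<open>lam\<close> shifted by
    \<open>d - R\<close>, and \<open>upper\<close> says that it dominates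
    \<open>beta ! l\<close>.\<close>
  have high: "D j \<ge> 0" if "q \<le> j" "j \<le> d" for j
  proof -
    have "(\<Sum>l\<in>{j..<d}. beta ! l - nu ! l) \<le> 0"
    proof (rule sum_nonpos)
      fix l assume l: "l \<in> {j..<d}"
      then have "beta ! (d - R + (l - (d - R))) \<le> lam ! (l - (d - R))"
        using that rho by (intro upper) (auto simp: q_def)
      then show "beta ! l - nu ! l \<le> 0" using l that q nu[of l] rho by (auto simp: q_def)
    qed
    then show ?thesis using split[OF that(2)] Dd by simp
  qed
  \<comment> \<open>On the block, \<open>beta ! l - c\<close> changes its sign at most once. Its
    sign at \<open>j - 1\<close> decides whether \<open>D j\<close> is compared with the left or
    with the right end of the block.\<close>
  have mid: "D j \<ge> 0" if "rho < j" "j < q" for j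
  proof (cases "c \<le> beta ! (j - 1)")
    case True
    have "beta ! l - nu ! l \<ge> 0" if l: "l \<in> {rho..<j}" for l
    proof -
      have "beta ! (j - 1) \<le> beta ! l"
        using sorted_wrt_nth_less[OF sorted(2), of l "j - 1"] l \<open>j < q\<close> q d by (cases "l = j - 1") auto
      then show ?thesis using True nu[of l] l \<open>j < q\<close> q by auto
    qed
    then have "(\<Sum>l\<in>{rho..<j}. beta ! l - nu ! l) \<ge> 0" by (rule sum_nonneg)
    then show ?thesis using split[of rho j] low[of rho] that by simp
  next
    case False
    have "beta ! l - nu ! l \<le> 0" if l: "l \<in> {j..<q}" for l
    proof -
      have "beta ! l \<le> beta ! (j - 1)"
        using sorted_wrt_nth_less[OF sorted(2), of "j - 1" l] l \<open>rho < j\<close> q d by auto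
      then show ?thesis using False nu[of l] l \<open>rho < j\<close> q by auto
    qed
    then have "(\<Sum>l\<in>{j..<q}. beta ! l - nu ! l) \<le> 0" by (rule sum_nonpos)
    then show ?thesis using split[of j q] high[of q] that q by simp
  qed
  have "D j \<ge> 0" if "j \<le> d" for j
    using low[of j] mid[of j] high[of j] that by linarith
  then have "(\<Sum>i<j. nu ! i) \<le> (\<Sum>i<j. beta ! i)" if "j \<le> d" for j
    using that by (simp add: D_def sum_subtractf)
  moreover have "sorted_wrt (\<ge>) nu" unfolding nu_def
    using rho sorted(1) d by (intro sorted_opt_spectrum) auto
  ultimately show ?thesis
    using majorized_iff_sorted[OF nlen d(2) _ sorted(2)] tot by (simp add: nu_def)
qed

section \<open>The threshold data \<open>c\<close>, \<open>rho\<close> and \<open>r\<close>\<close>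

lemma sorted_nth_mono:
  "sorted_wrt (\<ge>) (xs :: real list) \<Longrightarrow> i \<le> j \<Longrightarrow> j < length xs \<Longrightarrow> xs ! j \<le> xs ! i"
  using sorted_wrt_nth_less[of "(\<ge>)" xs i j] by (cases "i = j") auto

lemma Min_threshold:
  fixes lam :: "real list"
  assumes "sorted_wrt (\<ge>) lam" "q < length lam" "lam ! q \<le> c"
  defines "rho \<equiv> Min {q. q < length lam \<and> c \<ge> lam ! q}"
  shows "rho \<le> q" "\<And>i. i < rho \<Longrightarrow> c < lam ! i" "\<And>i. rho \<le> i \<Longrightarrow> i < length lam \<Longrightarrow> lam ! i \<le> c"
proof -
  let ?A = "{q. q < length lam \<and> c \<ge> lam ! q}"
  have fin: "finite ?A" by simp
  have q: "q \<in> ?A" using assms by simp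
  then have rho: "rho \<in> ?A" unfolding rho_def using Min_in[OF fin] by blast
  show "rho \<le> q" unfolding rho_def using Min_le[OF fin q] .
  show "c < lam ! i" if "i < rho" for i
  proof (rule ccontr)
    assume "\<not> c < lam ! i"
    then have "i \<in> ?A" using that rho by auto
    then have "rho \<le> i" unfolding rho_def using Min_le[OF fin] by blast
    then show False using that by simp
  qed
  show "lam ! i \<le> c" if "rho \<le> i" "i < length lam" for i
    using sorted_nth_mono[OF assms(1) that] rho by auto
qed

lemma sum_split_nat:
  fixes f :: "nat \<Rightarrow> real"
  shows "q \<le> d \<Longrightarrow> (\<Sum>i<d. f i) = (\<Sum>i<q. f i) + (\<Sum>i\<in>{q..<d}. f i)"
  by (subst sum.union_disjoint[symmetric]) (auto intro!: sum.cong)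

text \<open>\<open>c_lam\<close> is a water level: raising the entries from index
  \<open>r_lam\<close> on to it uses up the surplus \<open>t - sum_list lam\<close>. By minimality
  the test fails at \<open>r_lam - 1\<close>, and after clearing denominators this failure says that
  the level lies strictly below the previous entry.\<close>

lemma c_lam_properties:
  assumes sorted: "sorted_wrt (\<ge>) lam" and d: "lam \<noteq> []" and t: "sum_list lam \<le> t"
  shows "r_lam lam t < length lam" "\<And>i. i < r_lam lam t \<Longrightarrow> c_lam lam t < lam ! i"
    "\<And>i. r_lam lam t \<le> i \<Longrightarrow> i < length lam \<Longrightarrow> lam ! i \<le> c_lam lam t"
    "(\<Sum>i\<in>{r_lam lam t..<length lam}. c_lam lam t - lam ! i) = t - sum_list lam"
    "\<And>q. q < length lam \<Longrightarrow> lam ! q \<le> p_lam lam q t \<Longrightarrow> r_lam lam t \<le> q"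
proof -
  define d where "d = length lam"
  define r where "r = r_lam lam t"
  define c where "c = c_lam lam t"
  let ?A = "{q. q < length lam \<and> p_lam lam q t \<ge> lam ! q}"
  have fin: "finite ?A" by simp
  have dpos: "0 < d" using d by (simp add: d_def)
  have sl: "sum_list lam = (\<Sum>i<d. lam ! i)" by (simp add: sum_list_sum_nth atLeast0LessThan d_def)
  \<comment> \<open>The last index always passes the test, so the minimum is taken over a nonempty
    set.\<close>
  have "d - 1 \<in> ?A"
  proof -
    have "(\<Sum>i<d. lam ! i) = (\<Sum>i<d - 1. lam ! i) + lam ! (d - 1)"
      using dpos sum.lessThan_Suc[of "\<lambda>i. lam ! i" "d - 1"] by simp
    moreover have "real (length lam) - real (d - 1) = 1" using dpos unfolding d_def[symmetric] by (cases d) auto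
    ultimately show ?thesis using t sl dpos by (auto simp: p_lam_def d_def)
  qed
  then have rA: "r \<in> ?A" unfolding r_def r_lam_def using Min_in[OF fin] by blast
  then have rd: "r < d" by (simp add: d_def)
  show "r_lam lam t < length lam" using rA by (simp add: r_def)
  show le: "r_lam lam t \<le> q" if "q < length lam" "lam ! q \<le> p_lam lam q t" for q
    unfolding r_lam_def using Min_le[OF fin] that by blast
  have c: "c * (real d - real r) = t - (\<Sum>i<r. lam ! i)"
    using rd by (simp add: c_def c_lam_def p_lam_def r_def d_def)
  have below: "c < lam ! (r - 1)" if "0 < r"
  proof -
    have "\<not> lam ! (r - 1) \<le> p_lam lam (r - 1) t" using le[of "r - 1", folded r_def d_def] that rd by linarith
    moreover have "real d - real (r - 1) > 0" using rd by simp
    ultimately have "t - (\<Sum>i<r - 1. lam ! i) < lam ! (r - 1) * (real d - real (r - 1))"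
      by (simp add: p_lam_def d_def[symmetric] divide_simps split: if_splits)
    moreover have "(\<Sum>i<r. lam ! i) = (\<Sum>i<r - 1. lam ! i) + lam ! (r - 1)"
      using that sum.lessThan_Suc[of "\<lambda>i. lam ! i" "r - 1"] by simp
    moreover have "real (r - 1) = real r - 1" using that by (simp add: of_nat_diff)
    ultimately have "c * (real d - real r) < lam ! (r - 1) * (real d - real r)"
      unfolding c by (simp add: algebra_simps)
    then show ?thesis using rd by simp
  qed
  show "c_lam lam t < lam ! i" if "i < r_lam lam t" for i
  proof -
    have "i \<le> r - 1" "r - 1 < length lam" "0 < r" using that rd by (auto simp: r_def d_def)
    then show ?thesis using below sorted_nth_mono[OF sorted, of i "r - 1"] by (simp add: c_def)
  qed
  show "lam ! i \<le> c_lam lam t" if "r_lam lam t \<le> i" "i < length lam" for i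
    using sorted_nth_mono[OF sorted that] rA by (auto simp: c_lam_def r_def)
  have "(\<Sum>i\<in>{r..<d}. c - lam ! i) = c * (real d - real r) - (\<Sum>i\<in>{r..<d}. lam ! i)"
    using rd by (simp add: sum_subtractf of_nat_diff mult.commute)
  also have "\<dots> = t - sum_list lam" unfolding c sl using sum_split_nat[of r d "\<lambda>i. lam ! i"] rd by simp
  finally show "(\<Sum>i\<in>{r_lam lam t..<length lam}. c_lam lam t - lam ! i) = t - sum_list lam"
    by (simp add: r_def c_def d_def)
qed

text \<open>When \<open>m \<ge> 1\<close> and \<open>t \<le> s\<^sup>*\<close>, the eigenvalues between \<open>\<rho>\<close> and \<open>r\<close> all equal \<open>c\<close>, so that
  \<open>R = \<rho>\<close> describes the same data; otherwise \<open>R = r\<close>.\<close>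

lemma opt_data:
  fixes lam :: "real list" and m :: int and k :: nat and t :: real
  assumes len: "length lam = d" and sorted: "sorted_wrt (\<ge>) lam" and d: "d > 0" and k: "k > 0"
    and m: "m = int d - int k" and t: "sum_list lam \<le> t"
  obtains rho R where "rho \<le> R" "R < d" "\<And>i. i < rho \<Longrightarrow> c_lam_m lam m t < lam ! i"
    "\<And>i. rho \<le> i \<Longrightarrow> i < d \<Longrightarrow> lam ! i \<le> c_lam_m lam m t"
    "(\<Sum>i\<in>{R..<d}. c_lam_m lam m t - lam ! i) = t - sum_list lam"
    "R = rho \<or> R + k = d"
    "nu_opt lam m t = opt_spectrum lam (c_lam_m lam m t) rho R"
    "R \<le> r_opt lam m t" "r_opt lam m t < d" "d - r_opt lam m t \<le> k"
    "\<And>i. R \<le> i \<Longrightarrow> i < r_opt lam m t \<Longrightarrow> lam ! i = c_lam_m lam m t"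
    "m \<le> 0 \<or> t \<le> s_star lam m \<Longrightarrow> R = rho"
proof -
  define c where "c = c_lam_m lam m t"
  have ne: "lam \<noteq> []" using d len by auto
  note cl = c_lam_properties[OF sorted ne t, unfolded len]
  consider (low) "m \<le> 0" | (mid) "m \<ge> 1" "t \<le> s_star lam m" | (high) "m \<ge> 1" "t > s_star lam m" by linarith
  then show thesis
  proof cases
    case low
    then have cc: "c = c_lam lam t" "r_lam_m lam m t = r_lam lam t" "r_opt lam m t = r_lam lam t"
      by (simp_all add: c_def c_lam_m_def r_lam_m_def r_opt_def)
    show thesis
    proof (rule that[of "r_lam lam t" "r_lam lam t"], fold c_def)
      show "nu_opt lam m t = opt_spectrum lam c (r_lam lam t) (r_lam lam t)"
        using low cc len cl(1) by (simp add: nu_opt_def opt_spectrum_def Let_def flip: c_def)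
      show "d - r_opt lam m t \<le> k" using low m by simp
    qed (use cl cc in auto)
  next
    case mid
    define M where "M = nat m"
    have M: "1 \<le> M" "M < d" "M + k = d" using mid m k by (auto simp: M_def)
    have mM: "m = int M" using mid by (simp add: M_def)
    have cc: "c = c_lam lam t" using mid by (simp add: c_def c_lam_m_def)
    \<comment> \<open>\<open>r_lam_m\<close> compares \<open>lam\<close> with the fixed level
      \<open>c\<close>, and \<open>r_lam\<close> with the varying \<open>p_lam\<close>; both find
      the first entry not above \<open>c\<close>.\<close>
    have rr: "r_lam_m lam m t = r_lam lam t"
    proof -
      let ?rho = "Min {q. q < length lam \<and> c \<ge> lam ! q}"
      have l: "lam ! r_lam lam t \<le> c" using cl(1,3) cc by simp
      note mt = Min_threshold[OF sorted _ l, unfolded len, OF cl(1)]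
      have "?rho = r_lam lam t"
      proof (rule antisym)
        show "?rho \<le> r_lam lam t" using mt(1) len by simp
        show "r_lam lam t \<le> ?rho"
        proof (rule ccontr)
          assume "\<not> r_lam lam t \<le> ?rho"
          then have "?rho < r_lam lam t" by simp
          then have "c < lam ! ?rho" "?rho < d" using cl(1) cl(2)[of ?rho] cc by auto
          then show False using mt(3)[of ?rho] len by fastforce
        qed
      qed
      then show ?thesis using mid by (simp add: r_lam_m_def c_def)
    qed
    have rM: "r_opt lam m t = max (r_lam lam t) M" by (simp add: r_opt_def rr M_def)
    \<comment> \<open>The bound \<open>t \<le> s_star lam m\<close> says that
      \<open>p_lam lam M t\<close> is at most \<open>lam ! (M - 1)\<close>. On the other hand
      \<open>c\<close> is at most \<open>p_lam lam M t\<close>, because the surplus spent at the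
      indices from \<open>M\<close> on is only part of the total.\<close>
    have eqc: "lam ! i = c" if "r_lam lam t \<le> i" "i < M" for i
    proof (rule antisym)
      show "lam ! i \<le> c" using cl(3)[of i] that M cc by simp
      have "p_lam lam M t \<le> lam ! (M - 1)"
        using mid(2) M len by (simp add: p_lam_def s_star_def mM divide_simps algebra_simps)
      moreover have "c \<le> p_lam lam M t"
      proof -
        have "(\<Sum>i\<in>{r_lam lam t..<d}. c - lam ! i) \<ge> (\<Sum>i\<in>{M..<d}. c - lam ! i)"
          using cl(3) cc that M by (intro sum_mono2) auto
        then have "(\<Sum>i\<in>{M..<d}. c - lam ! i) \<le> t - sum_list lam" using cl(4) cc by simp
        moreover have "(\<Sum>i\<in>{M..<d}. c - lam ! i) = (real d - real M) * c - (\<Sum>i\<in>{M..<d}. lam ! i)"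
          using M by (simp add: sum_subtractf of_nat_diff)
        moreover have "sum_list lam = (\<Sum>i<M. lam ! i) + (\<Sum>i\<in>{M..<d}. lam ! i)"
          using sum_split_nat[of M d "\<lambda>i. lam ! i"] M len by (simp add: sum_list_sum_nth atLeast0LessThan)
        ultimately have "(real d - real M) * c \<le> t - (\<Sum>i<M. lam ! i)" by simp
        then show ?thesis using M len by (simp add: p_lam_def divide_simps mult.commute)
      qed
      moreover have "lam ! (M - 1) \<le> lam ! i" using sorted_nth_mono[OF sorted, of i "M - 1"] that M len by simp
      ultimately show "c \<le> lam ! i" by linarith
    qed
    show thesis
    proof (rule that[of "r_lam lam t" "r_lam lam t"], fold c_def)
      show "nu_opt lam m t = opt_spectrum lam c (r_lam lam t) (r_lam lam t)"
        using mid cl(1) len by (simp add: nu_opt_def opt_spectrum_def Let_def rr c_def)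
      show "lam ! i = c" if "r_lam lam t \<le> i" "i < r_opt lam m t" for i
        using eqc[of i] that rM by simp
    qed (use cl cc rM M in auto)
  next
    case high
    define M where "M = nat m"
    have M: "1 \<le> M" "M < d" "M + k = d" using high m k by (auto simp: M_def)
    have mM: "m = int M" using high by (simp add: M_def)
    have cc: "c = lam ! (M - 1) + (t - s_star lam m) / (real d - real M)"
      using high len by (simp add: c_def c_lam_m_def mM)
    have pos: "real d - real M > 0" using M by simp
    \<comment> \<open>Beyond \<open>s_star\<close> the level is strictly above
      \<open>lam ! (M - 1)\<close>; hence \<open>rho < m\<close> and \<open>r = m\<close>.\<close>
    have cgt: "lam ! (M - 1) < c" using high(2) pos by (simp add: cc)
    have rho: "r_lam_m lam m t = Min {q. q < length lam \<and> c \<ge> lam ! q}"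
      using high by (simp add: r_lam_m_def c_def)
    have M1: "M - 1 < length lam" using M len by simp
    note mt = Min_threshold[OF sorted M1 less_imp_le[OF cgt], folded rho, unfolded len]
    have rM: "r_lam_m lam m t \<le> M" "r_opt lam m t = M" using mt(1) by (auto simp: r_opt_def M_def[symmetric])
    have sstar: "s_star lam m = (\<Sum>i<M. lam ! i) + (real d - real M) * lam ! (M - 1)"
      using len by (simp add: s_star_def mM)
    show thesis
    proof (rule that[of "r_lam_m lam m t" M], fold c_def)
      have "c * (real d - real M) = t - (\<Sum>i<M. lam ! i)"
        using pos by (simp add: cc sstar field_simps)
      moreover have "(\<Sum>i\<in>{M..<d}. c - lam ! i) = c * (real d - real M) - (\<Sum>i\<in>{M..<d}. lam ! i)"
        using M by (simp add: sum_subtractf of_nat_diff mult.commute)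
      moreover have "sum_list lam = (\<Sum>i<M. lam ! i) + (\<Sum>i\<in>{M..<d}. lam ! i)"
        using sum_split_nat[of M d "\<lambda>i. lam ! i"] M len by (simp add: sum_list_sum_nth atLeast0LessThan)
      ultimately show "(\<Sum>i\<in>{M..<d}. c - lam ! i) = t - sum_list lam" by simp
      show "nu_opt lam m t = opt_spectrum lam c (r_lam_m lam m t) M"
      proof (cases "t < s_star_star lam m")
        case True
        then show ?thesis using high len by (simp add: nu_opt_def opt_spectrum_def Let_def c_def mM)
      next
        case False
        \<comment> \<open>\<open>s_star_star\<close> is the value of \<open>t\<close> at which the
          level reaches the largest eigenvalue. From there on \<open>rho = 0\<close>, and the
          constant block comes first.\<close>
        have "lam ! 0 \<le> c"
        proof -
          have "(real d - real M) * (lam ! 0 - lam ! (M - 1)) \<le> t - s_star lam m"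
            using False len sstar by (simp add: s_star_star_def mM algebra_simps)
          then have "lam ! 0 - lam ! (M - 1) \<le> (t - s_star lam m) / (real d - real M)"
            using pos by (simp add: pos_le_divide_eq mult.commute)
          then show ?thesis by (simp add: cc)
        qed
        then have "r_lam_m lam m t = 0" using mt(2)[of 0] by (cases "r_lam_m lam m t") auto
        then show ?thesis using False high len by (simp add: nu_opt_def opt_spectrum_def Let_def c_def mM)
      qed
    qed (use mt rM M high in auto)
  qed
qed

section \<open>The optimal completions\<close>

text \<open>Vectors of the two bases that belong to different eigenvalues are orthogonal, so
  applying \<open>g\<close> to the eigenvalues is consistent. This is the functional calculus by
  which \<open>B\<close> will be written as a function of \<open>S0\<close>.\<close>

lemma weighted_op_fun_unique:
  assumes u: "onb d u" and v: "onb d v" and eq: "real_weighted_op d e u = real_weighted_op d e' v"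
  shows "real_weighted_op d (\<lambda>i. g (e i)) u = real_weighted_op d (\<lambda>i. g (e' i)) v"
proof (rule eq_weighted_op[OF v])
  fix j assume j: "j < d"
  have vj: "v ! j \<in> carrier_vec d" using onb_nth_carrier[OF v j] .
  show "real_weighted_op d (\<lambda>i. g (e i)) u *\<^sub>v v ! j = complex_of_real (g (e' j)) \<cdot>\<^sub>v v ! j"
  proof (rule eq_of_cscalar_prod_onb[OF u])
    show "real_weighted_op d (\<lambda>i. g (e i)) u *\<^sub>v v ! j \<in> carrier_vec d"
      by (rule mult_mat_vec_carrier[OF _ vj]) simp
    show "complex_of_real (g (e' j)) \<cdot>\<^sub>v v ! j \<in> carrier_vec d" using vj by simp
    fix i assume i: "i < d"
    have ui: "u ! i \<in> carrier_vec d" using onb_nth_carrier[OF u i] .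
    have "real_weighted_op d e u *\<^sub>v v ! j = complex_of_real (e' j) \<cdot>\<^sub>v v ! j"
      unfolding eq using weighted_op_mult_basis[of d v j] v j by (simp add: onb_def)
    then have "complex_of_real (e i) * (v ! j \<bullet>c u ! i) = complex_of_real (e' j) * (v ! j \<bullet>c u ! i)"
      using weighted_op_cscalar_prod_onb[OF u vj i, of "\<lambda>i. complex_of_real (e i)"]
        cscalar_prod_smult_left[OF vj ui] by metis
    then have "v ! j \<bullet>c u ! i = 0 \<or> e i = e' j" by auto
    then show "(real_weighted_op d (\<lambda>i. g (e i)) u *\<^sub>v v ! j) \<bullet>c u ! i = (complex_of_real (g (e' j)) \<cdot>\<^sub>v v ! j) \<bullet>c u ! i"
      unfolding weighted_op_cscalar_prod_onb[OF u vj i] cscalar_prod_smult_left[OF vj ui] by auto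
  qed
qed simp

text \<open>Subadditivity of the rank, applied to one rank-one term at a time.\<close>

lemma rank_weighted_op_le:
  assumes "\<And>i. p \<le> i \<Longrightarrow> i < length hs \<Longrightarrow> w i = 0"
  shows "vec_space.rank d (weighted_op d w hs) \<le> p"
proof -
  interpret vec_space "TYPE(complex)" d .
  define W where "W = (\<lambda>p. weighted_op d (\<lambda>i. if i < p then w i else 0) hs)"
  have "rank (W p) \<le> p" for p
  proof (induction p)
    case 0
    have "W 0 = 0\<^sub>m d d" by (intro eq_matI) (auto simp: W_def weighted_op_index)
    then show ?case using rank_0I by simp
  next
    case (Suc p)
    define E where "E = weighted_op d (\<lambda>i. if i = p then w i else 0) hs"
    have "W (Suc p) = W p + E"
      unfolding W_def E_def weighted_op_add by (rule weighted_op_cong) auto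
    moreover have "rank E \<le> 1"
    proof (rule rank_le_1_product_entries)
      show "E \<in> carrier_mat d d" by (simp add: E_def)
      fix a b assume "a < dim_row E" "b < dim_col E"
      then have ab: "a < d" "b < d" by (auto simp: E_def)
      have "E $$ (a, b) = (\<Sum>i<length hs. if i = p then w p * hs ! p $ a * cnj (hs ! p $ b) else 0)"
        unfolding E_def weighted_op_index[OF ab] by (intro sum.cong) auto
      also have "\<dots> = (if p < length hs then w p * hs ! p $ a else 0) * cnj (hs ! p $ b)"
        by (simp add: sum.delta)
      finally show "E $$ (a, b) = (if p < length hs then w p * hs ! p $ a else 0) * cnj (hs ! p $ b)" .
    qed
    ultimately show ?case
      using rank_subadditive[of "W p" d E] Suc.IH by (simp add: W_def E_def)
  qed
  moreover have "W p = weighted_op d w hs" unfolding W_def by (rule weighted_op_cong) (use assms in auto)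
  ultimately show ?thesis by metis
qed

lemma eigs_frame_op_nonneg:
  assumes "set fs \<subseteq> carrier_vec d" "i < d"
  shows "eigs (frame_op d fs) ! i \<ge> 0"
proof -
  obtain u where u: "onb d u" "frame_op d fs = real_weighted_op d (\<lambda>i. eigs (frame_op d fs) ! i) u"
    using hermitian_spectral[OF hermitian_frame_op[OF assms(1)]] by blast
  have "eigs (frame_op d fs) ! i = qform (frame_op d fs) (u ! i)"
    using qform_basis[OF u(1) assms(2)] u(2) by metis
  then show ?thesis
    unfolding qform_frame_op[OF assms(1) onb_nth_carrier[OF u(1) assms(2)]] by (simp add: sum_nonneg)
qed

lemma majorized_sum_eq: "x \<prec>\<^sub>m y \<Longrightarrow> sum_list x = sum_list y"
proof -
  have "sum_list (decr z) = sum_list z" for z :: "real list"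
    by (metis mset_decr sum_mset_sum_list)
  then show "x \<prec>\<^sub>m y \<Longrightarrow> sum_list x = sum_list y"
    by (simp add: majorized_def Let_def pad_def sum_list_replicate)
qed

lemma majorized_pad: "length y \<le> length x \<Longrightarrow> x \<prec>\<^sub>m y \<Longrightarrow> x \<prec>\<^sub>m pad (length x) y"
  by (simp add: majorized_def Let_def pad_def max_def)

lemma mult_norm_sq:
  assumes "x \<in> carrier_vec d"
  shows "norm_sq (c \<cdot>\<^sub>v x) = (cmod c)\<^sup>2 * norm_sq x"
  using assms by (simp add: norm_sq_sum[of _ d] norm_mult power_mult_distrib sum_distrib_left)

text \<open>The vectors are basis vectors scaled by square roots of the weights, followed by zero
  vectors up to length \<open>k\<close>. The zero vectors mirror the padding in the majorization of
  lists of different lengths.\<close>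

lemma weighted_op_as_frame_op:
  assumes hs: "onb d hs" and s: "s \<le> d" and w: "\<And>i. i < s \<Longrightarrow> w i = 0" "\<And>i. i < d \<Longrightarrow> 0 \<le> w i"
    and k: "d - s \<le> k"
  obtains G where "set G \<subseteq> carrier_vec d" "length G = k" "map norm_sq G = pad k (map w [s..<d])"
    "frame_op d G = real_weighted_op d w hs"
proof -
  define G where "G = map (\<lambda>i. complex_of_real (sqrt (w i)) \<cdot>\<^sub>v hs ! i) [s..<d] @ replicate (k - (d - s)) (0\<^sub>v d)"
  have c: "set G \<subseteq> carrier_vec d" using onb_nth_carrier[OF hs] by (auto simp: G_def)
  have "norm_sq (hs ! i) = 1" if "i < d" for i
    using onb_cscalar_prod[OF hs that that] cscalar_prod_self[OF onb_nth_carrier[OF hs that]] by simp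
  then have n: "norm_sq (complex_of_real (sqrt (w i)) \<cdot>\<^sub>v hs ! i) = w i" if "i < d" for i
    using mult_norm_sq[OF onb_nth_carrier[OF hs that]] w(2)[OF that] that by simp
  have n0: "norm_sq (0\<^sub>v d) = 0" using norm_sq_eq_0_iff[of "0\<^sub>v d" d] by simp
  have norms: "map norm_sq G = pad k (map w [s..<d])"
    using n n0 by (simp add: G_def pad_def)
  have "frame_op d G = real_weighted_op d w hs"
  proof (rule eq_matI)
    fix a b assume "a < dim_row (real_weighted_op d w hs)" "b < dim_col (real_weighted_op d w hs)"
    then have ab: "a < d" "b < d" by auto
    have "frame_op d G $$ (a, b) = (\<Sum>i\<leftarrow>[s..<d]. complex_of_real (w i) * hs ! i $ a * cnj (hs ! i $ b))"
    proof -
      have "(\<Sum>g\<leftarrow>G. g $ a * cnj (g $ b)) = (\<Sum>g\<leftarrow>map (\<lambda>i. complex_of_real (sqrt (w i)) \<cdot>\<^sub>v hs ! i) [s..<d]. g $ a * cnj (g $ b))"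
        using ab by (simp add: G_def sum_list_replicate)
      also have "\<dots> = (\<Sum>i\<leftarrow>[s..<d]. complex_of_real (w i) * hs ! i $ a * cnj (hs ! i $ b))"
        unfolding map_map comp_def
      proof (rule arg_cong[of _ _ sum_list], rule map_cong[OF refl])
        fix i assume "i \<in> set [s..<d]"
        then have i: "i < d" by simp
        have "complex_of_real (sqrt (w i)) * complex_of_real (sqrt (w i)) = complex_of_real (w i)"
          using w(2)[OF i] by (simp flip: of_real_mult)
        then show "(complex_of_real (sqrt (w i)) \<cdot>\<^sub>v hs ! i) $ a * cnj ((complex_of_real (sqrt (w i)) \<cdot>\<^sub>v hs ! i) $ b)
            = complex_of_real (w i) * hs ! i $ a * cnj (hs ! i $ b)"
          using onb_nth_carrier[OF hs i] ab by (simp add: mult_ac)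
      qed
      finally show ?thesis unfolding frame_op_index[OF c ab] .
    qed
    also have "\<dots> = (\<Sum>i\<in>{s..<d}. complex_of_real (w i) * hs ! i $ a * cnj (hs ! i $ b))"
      by (simp add: interv_sum_list_conv_sum_set_nat)
    also have "\<dots> = (\<Sum>i<d. complex_of_real (w i) * hs ! i $ a * cnj (hs ! i $ b))"
      using w(1) s by (intro sum.mono_neutral_left) auto
    finally show "frame_op d G $$ (a, b) = real_weighted_op d w hs $$ (a, b)"
      using ab onb_length[OF hs] by (simp add: weighted_op_index)
  qed (use frame_op_carrier[OF c] in auto)
  then show thesis using that[OF c _ norms] k by (simp add: G_def)
qed

lemma opt_op_weighted:
  assumes hs: "onb d hs" and lam: "length lam = d" and r: "r = r_opt lam m t" "r < d"
  shows "opt_op d r (mu_opt lam m t) hs = real_weighted_op d (\<lambda>i. if i < r then 0 else c_lam_m lam m t - lam ! i) hs"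
proof -
  let ?c = "c_lam_m lam m t"
  let ?As = "map (\<lambda>i. complex_of_real (mu_opt lam m t ! i) \<cdot>\<^sub>m tensor (hs ! (r + i)) (hs ! (r + i))) [0..<d - r]"
  have mu: "mu_opt lam m t ! i = ?c - lam ! (r + i)" if "i < d - r" for i
    using that lam r by (simp add: mu_opt_def)
  have h: "hs ! i \<in> carrier_vec d" if "i < d" for i using onb_nth_carrier[OF hs that] .
  have c: "A \<in> carrier_mat d d" if "A \<in> set ?As" for A
  proof -
    obtain i where "i < d - r" "A = complex_of_real (mu_opt lam m t ! i) \<cdot>\<^sub>m tensor (hs ! (r + i)) (hs ! (r + i))"
      using \<open>A \<in> set ?As\<close> by auto
    then show ?thesis using tensor_carrier[OF h h, of "r + i" "r + i"] by simp
  qed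
  show ?thesis
  proof (rule eq_matI)
    let ?W = "real_weighted_op d (\<lambda>i. if i < r then 0 else ?c - lam ! i) hs"
    fix a b assume "a < dim_row ?W" "b < dim_col ?W"
    then have ab: "a < d" "b < d" by auto
    have "opt_op d r (mu_opt lam m t) hs $$ (a, b) = (\<Sum>A\<leftarrow>?As. A $$ (a, b))"
      unfolding opt_op_def by (rule mat_sum_index[OF c ab])
    also have "\<dots> = (\<Sum>i\<leftarrow>[0..<d - r]. complex_of_real (?c - lam ! (r + i)) * hs ! (r + i) $ a * cnj (hs ! (r + i) $ b))"
      unfolding map_map comp_def
    proof (rule arg_cong[of _ _ sum_list], rule map_cong[OF refl])
      fix i assume "i \<in> set [0..<d - r]"
      then have i: "i < d - r" "r + i < d" by auto
      show "(complex_of_real (mu_opt lam m t ! i) \<cdot>\<^sub>m tensor (hs ! (r + i)) (hs ! (r + i))) $$ (a, b)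
          = complex_of_real (?c - lam ! (r + i)) * hs ! (r + i) $ a * cnj (hs ! (r + i) $ b)"
        using tensor_carrier[OF h[OF i(2)] h[OF i(2)]] tensor_index[OF h[OF i(2)] h[OF i(2)] ab] ab mu[OF i(1)] by simp
    qed
    also have "\<dots> = (\<Sum>i\<in>{0..<d - r}. complex_of_real (?c - lam ! (r + i)) * hs ! (r + i) $ a * cnj (hs ! (r + i) $ b))"
      by (simp add: interv_sum_list_conv_sum_set_nat)
    also have "\<dots> = (\<Sum>i\<in>{r..<d}. complex_of_real (?c - lam ! i) * hs ! i $ a * cnj (hs ! i $ b))"
      by (rule sum.reindex_bij_witness[of _ "\<lambda>i. i - r" "\<lambda>i. r + i"]) (use r in auto)
    also have "\<dots> = (\<Sum>i<d. complex_of_real (if i < r then 0 else ?c - lam ! i) * hs ! i $ a * cnj (hs ! i $ b))"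
      by (intro sum.mono_neutral_cong_left) auto
    finally show "opt_op d r (mu_opt lam m t) hs $$ (a, b) = ?W $$ (a, b)"
      using ab onb_length[OF hs] by (simp add: weighted_op_index)
  qed (use mat_sum_carrier[of ?As d, OF c] in \<open>auto simp: opt_op_def\<close>)
qed

theorem theorem4p3:
  fixes d n n0 k r :: nat and m :: int and t :: real
    and F0 :: "complex vec list" and S0 :: "complex mat"
    and a b lam mu nu :: "real list"
  assumes F0: "length F0 = n0" "set F0 \<subseteq> carrier_vec d"
    and n: "n0 < n" and k: "k = n - n0"
    and S0: "S0 = frame_op d F0"
    and m: "m = int d - int k"
    and rank: "int (vec_space.rank d S0) \<ge> m"
    and a: "length a = n" "\<forall>i<n. a ! i > 0" "\<forall>i<n0. norm_sq (F0 ! i) = a ! i"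
    and b: "b = drop n0 a"
    and t: "t = (\<Sum>i<n. a ! i)"
    and lam: "lam = eigs S0"
    and nu: "nu = nu_opt lam m t"
    and r: "r = r_opt lam m t"
    and mu: "mu = mu_opt lam m t"
    and maj: "b \<prec>\<^sub>m mu"
  shows
    "nu \<in> completion_spectra d F0 a
     \<and> (\<forall>beta \<in> completion_spectra d F0 a. beta \<noteq> nu \<longrightarrow> nu \<prec>\<^sub>m beta)
     \<and> (\<forall>F1. F0 @ F1 \<in> completions d F0 a \<longrightarrow>
          (eigs (frame_op d (F0 @ F1)) = nu \<longleftrightarrow>
             (\<forall>S \<in> completion_ops d F0 a. mat_majorized (frame_op d (F0 @ F1)) S))
          \<and> (eigs (frame_op d (F0 @ F1)) = nu \<longleftrightarrow>
             (\<exists>hs. eigenbasis d S0 lam hs \<and> frame_op d F1 = opt_op d r mu hs)))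
     \<and> (\<exists>F1 hs. F0 @ F1 \<in> completions d F0 a \<and> eigenbasis d S0 lam hs
          \<and> frame_op d F1 = opt_op d r mu hs)
     \<and> (m \<le> 0 \<or> (m \<ge> 1 \<and> lam ! (nat m - 1) > lam ! nat m)
          \<or> (m \<ge> 1 \<and> lam ! (nat m - 1) = lam ! nat m \<and> t \<le> s_star lam m) \<longrightarrow>
          (\<forall>hs hs'. eigenbasis d S0 lam hs \<longrightarrow> eigenbasis d S0 lam hs' \<longrightarrow>
             opt_op d r mu hs = opt_op d r mu hs')
          \<and> (\<forall>hs F1. eigenbasis d S0 lam hs \<longrightarrow> F0 @ F1 \<in> completions d F0 a \<longrightarrow>
             (eigs (frame_op d (F0 @ F1)) = nu \<longleftrightarrow> frame_op d F1 = opt_op d r mu hs)))"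
proof -

  \<comment> \<open>Traces and positivity of the data\<close>
  define c where "c = c_lam_m lam m t"
  have S0h: "hermitian d S0" using hermitian_frame_op[OF F0(2)] S0 by simp
  have S0c: "S0 \<in> carrier_mat d d" using frame_op_carrier[OF F0(2)] S0 by simp
  obtain h where h: "onb d h" "S0 = real_weighted_op d (\<lambda>i. lam ! i) h" and len: "length lam = d"
    using hermitian_spectral[OF S0h] lam by blast
  have sorted: "sorted_wrt (\<ge>) lam" using sorted_eigs lam by simp
  have nonneg: "lam ! i \<ge> 0" if "i < d" for i using eigs_frame_op_nonneg[OF F0(2) that] lam S0 by simp
  have lam_mono: "lam ! j \<le> lam ! i" if "i \<le> j" "j < d" for i j
    using sorted_nth_mono[OF sorted that(1)] that(2) len by simp
  have lenb: "length b = k" using a b k by simp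
  have bnth: "b ! i = a ! (n0 + i)" if "i < k" for i using that a b k n by simp
  have suml: "sum_list lam = (\<Sum>i<d. lam ! i)" using len by (simp add: sum_list_sum_nth atLeast0LessThan)
  have sumb: "sum_list b = (\<Sum>i<k. b ! i)" using lenb by (simp add: sum_list_sum_nth atLeast0LessThan)
  have t_eq: "t = sum_list lam + sum_list b"
  proof -
    have "(\<Sum>i<n0. a ! i) = (\<Sum>i<length F0. norm_sq (F0 ! i))" using a F0 by simp
    also have "\<dots> = sum_list lam"
      using sum_eigenvalues_frame_op[OF F0(2) h(1)] h(2) S0 suml by simp
    finally have "(\<Sum>i<n0. a ! i) = sum_list lam" .
    moreover have "(\<Sum>i\<in>{n0..<n}. a ! i) = (\<Sum>i<k. b ! i)"
      by (rule sum.reindex_bij_witness[of _ "\<lambda>i. n0 + i" "\<lambda>i. i - n0"]) (use bnth k n in auto)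
    ultimately show ?thesis using sum_split_nat[of n0 n "\<lambda>i. a ! i"] n t sumb by simp
  qed
  have bpos: "sum_list b > 0"
  proof -
    have "{..<k} \<noteq> {}" using k n by (simp add: lessThan_empty_iff)
    then show ?thesis unfolding sumb using a bnth k n by (intro sum_pos) auto
  qed
  have dpos: "d > 0"
  proof (rule ccontr)
    assume "\<not> 0 < d"
    then have "sum_list mu = 0" using len mu by (simp add: mu_opt_def)
    then show False using majorized_sum_eq[OF maj] bpos by simp
  qed
  have kpos: "k > 0" using k n by simp
  have t_ge: "sum_list lam \<le> t" using t_eq bpos by simp

  \<comment> \<open>The block form of the optimal data\<close>
  obtain rho R where rho: "rho \<le> R" "R < d" "\<And>i. i < rho \<Longrightarrow> c < lam ! i"
    "\<And>i. rho \<le> i \<Longrightarrow> i < d \<Longrightarrow> lam ! i \<le> c"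
    and tot: "(\<Sum>i\<in>{R..<d}. c - lam ! i) = t - sum_list lam"
    and Rk: "R = rho \<or> R + k = d"
    and nu_eq: "nu = opt_spectrum lam c rho R"
    and r_props: "R \<le> r" "r < d" "d - r \<le> k" "\<And>i. R \<le> i \<Longrightarrow> i < r \<Longrightarrow> lam ! i = c"
    and unique: "m \<le> 0 \<or> t \<le> s_star lam m \<Longrightarrow> R = rho"
    using opt_data[OF len sorted dpos kpos m t_ge, folded c_def nu r] by blast
  define nu' where "nu' = (\<lambda>i. if i < R then lam ! i else c)"
  \<comment> \<open>This is \<open>opt_op\<close> with \<open>R\<close> in place of
    \<open>r\<close>; the two agree because the weight \<open>c - lam ! i\<close> vanishes for
    \<open>R \<le> i < r\<close>.\<close>
  define B where "B = (\<lambda>hs. real_weighted_op d (\<lambda>i. if i < R then 0 else c - lam ! i) hs)"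
  have opt: "opt_op d r mu hs = B hs" if "onb d hs" for hs
    unfolding mu opt_op_weighted[OF that len r r_props(2)] B_def c_def[symmetric]
    by (rule weighted_op_cong) (use r_props onb_length[OF that] in auto)
  have numset: "mset nu = mset (map nu' [0..<d])"
    unfolding nu_eq nu'_def using mset_opt_spectrum[of rho R lam c] rho len by simp
  have nulen: "length nu = d" using length_opt_spectrum rho len nu_eq by simp
  have nusorted: "sorted_wrt (\<ge>) nu"
    unfolding nu_eq using rho len sorted by (intro sorted_opt_spectrum) auto
  have cpos: "c > 0"
  proof (rule ccontr)
    assume "\<not> c > 0"
    then have "(\<Sum>i\<in>{R..<d}. c - lam ! i) \<le> 0"
    proof (intro sum_nonpos)
      fix i assume "i \<in> {R..<d}"
      then show "c - lam ! i \<le> 0" using nonneg[of i] \<open>\<not> c > 0\<close> by simp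
    qed
    then show False using tot t_eq bpos by simp
  qed
  have nupos: "nu' i > 0" if i: "i < d" for i
  proof (cases "i < R \<and> rho \<le> i")
    case False
    then show ?thesis using rho(3)[of i] cpos by (auto simp: nu'_def)
  next
    case True
    \<comment> \<open>What remains are kept eigenvalues that are not above \<open>c\<close>, so that
      \<open>R = m\<close>. If one of them were zero, all later ones would be zero as well and the
      rank of \<open>S0\<close> would be less than \<open>m\<close>.\<close>
    then have Rm: "R + k = d" using Rk by auto
    show ?thesis
    proof (rule ccontr)
      assume "\<not> nu' i > 0"
      then have "lam ! i \<le> 0" using True by (simp add: nu'_def)
      then have z: "lam ! j = 0" if "i \<le> j" "j < d" for j
        using lam_mono[OF that] nonneg[OF that(2)] by simp
      then have "vec_space.rank d S0 \<le> i"
        unfolding h(2) using onb_length[OF h(1)] by (intro rank_weighted_op_le) auto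
      then show False using rank m Rm True by linarith
    qed
  qed
  have sum_ops: "frame_op d (F0 @ F1) = S0 + frame_op d F1" if "set F1 \<subseteq> carrier_vec d" for F1
    using frame_op_append[OF F0(2) that] S0 by simp
  have opt_eigs: "frame_op d (F0 @ F1) = real_weighted_op d nu' hs" "eigs (frame_op d (F0 @ F1)) = nu"
    if "set F1 \<subseteq> carrier_vec d" "onb d hs" "S0 = real_weighted_op d (\<lambda>i. lam ! i) hs" "frame_op d F1 = B hs" for F1 hs
  proof -
    show S: "frame_op d (F0 @ F1) = real_weighted_op d nu' hs"
      unfolding sum_ops[OF that(1)] that(4) B_def
      by (subst that(3), unfold weighted_op_add, rule weighted_op_cong) (simp add: nu'_def)
    have "decr (map nu' [0..<d]) = decr nu" unfolding decr_eq_iff using numset by simp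
    then show "eigs (frame_op d (F0 @ F1)) = nu"
      unfolding S eigs_weighted_op[OF that(2)] using decr_id[OF nusorted] by simp
  qed
  have completionD: "set F1 \<subseteq> carrier_vec d" "length F1 = k" "set (F0 @ F1) \<subseteq> carrier_vec d" "length (F0 @ F1) = n"
    "\<And>i. i < n \<Longrightarrow> norm_sq ((F0 @ F1) ! i) = a ! i"
    if "F0 @ F1 \<in> completions d F0 a" for F1
  proof -
    show *: "set (F0 @ F1) \<subseteq> carrier_vec d" "length (F0 @ F1) = n"
      using that a by (auto simp: completions_def frames_def)
    then show "set F1 \<subseteq> carrier_vec d" "length F1 = k" using F0 k by auto
    show "norm_sq ((F0 @ F1) ! i) = a ! i" if "i < n" for i
    proof (cases "i < n0")
      case True
      then show ?thesis using a F0 by (simp add: nth_append)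
    next
      case False
      then show ?thesis using \<open>F0 @ F1 \<in> completions d F0 a\<close> that a F0 by (auto simp: completions_def)
    qed
  qed
  have completionE: "\<exists>F1. fs = F0 @ F1" if "fs \<in> completions d F0 a" for fs
    using that by (auto simp: completions_def intro: exI[of _ "drop (length F0) fs"]) (metis append_take_drop_id)

  \<comment> \<open>Existence of an optimal completion\<close>
  have ex: "\<exists>F1. F0 @ F1 \<in> completions d F0 a \<and> frame_op d F1 = B h"
  proof -
    let ?w = "\<lambda>i. if i < r then 0 else c - lam ! i"
    obtain G where G: "set G \<subseteq> carrier_vec d" "length G = k" "map norm_sq G = pad k (map ?w [r..<d])"
      "frame_op d G = real_weighted_op d ?w h"
    proof (rule weighted_op_as_frame_op[OF h(1) less_imp_le[OF r_props(2)]])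
      show "0 \<le> ?w i" if "i < d" for i using rho(1) rho(4)[of i] r_props(1) that by simp
    qed (use r_props(3) in auto)
    have "map ?w [r..<d] = mu" using mu r len by (simp add: mu_opt_def c_def)
    moreover have "length mu = d - r" using mu r len by (simp add: mu_opt_def)
    ultimately have "b \<prec>\<^sub>m map norm_sq G" using majorized_pad[of mu b] maj lenb G(3) r_props by simp
    from schur_horn_frame[OF G(1) _ this] obtain F1 where F1: "set F1 \<subseteq> carrier_vec d" "map norm_sq F1 = b"
      "frame_op d F1 = frame_op d G" using G lenb by auto
    have FB: "frame_op d F1 = B h"
      unfolding F1(3) G(4) B_def by (rule weighted_op_cong) (use r_props onb_length[OF h(1)] in auto)
    have "length F1 = k" using F1(2) lenb by (metis length_map)
    \<comment> \<open>The weights \<open>nu'\<close> are positive, so the frame operator is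
      invertible and the vectors span.\<close>
    have "spans d (F0 @ F1)"
      using F0 F1 opt_eigs(1)[OF F1(1) h FB] nupos
      by (intro spans_of_frame_op[OF _ h(1)]) (auto simp: less_imp_neq[symmetric])
    moreover have "norm_sq ((F0 @ F1) ! i) = a ! i" if "n0 \<le> i" "i < n" for i
    proof -
      have "norm_sq (F1 ! (i - n0)) = b ! (i - n0)"
        using arg_cong[OF F1(2), of "\<lambda>l. l ! (i - n0)"] \<open>length F1 = k\<close> that k by simp
      then show ?thesis using bnth[of "i - n0"] that k F0 by (simp add: nth_append)
    qed
    ultimately have "F0 @ F1 \<in> completions d F0 a"
      using F0 F1 a k n \<open>length F1 = k\<close> by (auto simp: completions_def frames_def)
    then show ?thesis using FB by blast
  qed

  \<comment> \<open>Minimality of \<open>nu\<close> under majorization\<close>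
  have minimal: "nu \<prec>\<^sub>m eigs (frame_op d (F0 @ F1))" and eigs_len: "length (eigs (frame_op d (F0 @ F1))) = d"
    if F1: "F0 @ F1 \<in> completions d F0 a" for F1
  proof -
    note D = completionD[OF F1]
    define beta where "beta = eigs (frame_op d (F0 @ F1))"
    obtain u where u: "onb d u" "frame_op d (F0 @ F1) = real_weighted_op d (\<lambda>i. beta ! i) u"
      and bl: "length beta = d"
      using hermitian_spectral[OF hermitian_frame_op[OF D(3)]] beta_def by blast
    have bs: "sorted_wrt (\<ge>) beta" by (simp add: beta_def sorted_eigs)
    have beta_mono: "beta ! j \<le> beta ! i" if "i \<le> j" "j < d" for i j
      using sorted_nth_mono[OF bs that(1)] that(2) bl by simp
    have q: "qform (real_weighted_op d (\<lambda>i. beta ! i) u) x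
      = qform (real_weighted_op d (\<lambda>i. lam ! i) h) x + (\<Sum>i<k. (cmod (x \<bullet>c F1 ! i))\<^sup>2)"
      if x: "x \<in> carrier_vec d" for x
      unfolding u(2)[symmetric] h(2)[symmetric] sum_ops[OF D(1)]
        qform_add[OF S0c frame_op_carrier[OF D(1)] x] qform_frame_op[OF D(1) x] D(2) ..
    have "nu \<prec>\<^sub>m beta"
      unfolding nu_eq
    proof (rule opt_spectrum_majorized[OF len bl rho(1) less_imp_le[OF rho(2)] rho(3,4) sorted bs])
      \<comment> \<open>Lower interlacing: Weyl's inequality with the two operators exchanged and an
        empty list \<open>gs\<close>.\<close>
      fix i assume i: "i < d"
      show "lam ! i \<le> beta ! i"
        using weyl_inequality[OF u(1) h(1), of "\<lambda>i. beta ! i" "\<lambda>i. lam ! i" "[]" i]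
          beta_mono lam_mono i q by (simp add: sum_nonneg)
    next
      \<comment> \<open>Upper interlacing, which concerns only the case \<open>R + k = d\<close>. On
        the complement of \<open>F1\<close> the two quadratic forms agree, and the shift by
        \<open>length F1 = k\<close> is the shift by \<open>d - R\<close>.\<close>
      fix i assume i: "rho \<le> i" "i < R"
      then have Rm: "R + k = d" using Rk by auto
      have "beta ! (length F1 + i) \<le> lam ! i"
      proof (rule weyl_inequality[OF h(1) u(1) lam_mono beta_mono D(1)])
        fix x assume x: "x \<in> carrier_vec d" "\<And>g. g \<in> set F1 \<Longrightarrow> x \<bullet>c g = 0"
        show "qform (real_weighted_op d (\<lambda>i. beta ! i) u) x \<le> qform (real_weighted_op d (\<lambda>i. lam ! i) h) x"
          unfolding q[OF x(1)] using x(2) D(2) by simp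
      qed (use D(2) Rm i in auto)
      then show "beta ! (d - R + i) \<le> lam ! i" using D(2) Rm by (simp flip: Rm)
    next
      have "(\<Sum>i<d. beta ! i) = (\<Sum>i<n. norm_sq ((F0 @ F1) ! i))"
        using sum_eigenvalues_frame_op[OF D(3) u] D(4) by simp
      also have "\<dots> = t" using D(5) t by simp
      finally show "(\<Sum>i<d. beta ! i) = (\<Sum>i<d. lam ! i) + (\<Sum>i\<in>{R..<d}. c - lam ! i)"
        using tot suml by simp
    qed
    then show "nu \<prec>\<^sub>m eigs (frame_op d (F0 @ F1))" "length (eigs (frame_op d (F0 @ F1))) = d"
      using bl by (simp_all add: beta_def)
  qed

  \<comment> \<open>The operators of optimal completions\<close>
  have optimal: "\<exists>hs. eigenbasis d S0 lam hs \<and> frame_op d F1 = opt_op d r mu hs"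
    if F1: "F0 @ F1 \<in> completions d F0 a" and eigs: "eigs (frame_op d (F0 @ F1)) = nu" for F1
  proof -
    note D = completionD[OF F1]
    obtain u0 where u0: "onb d u0" "frame_op d (F0 @ F1) = real_weighted_op d (\<lambda>i. nu ! i) u0"
      using hermitian_spectral[OF hermitian_frame_op[OF D(3)]] eigs by metis
    \<comment> \<open>The eigenvectors of the sum are rearranged from the sorted order
      \<open>nu\<close> to the order \<open>nu'\<close> that
      \<open>optimal_operator_structure\<close> expects.\<close>
    have "map (\<lambda>i. nu ! i) [0..<d] = nu" using nulen by (metis map_nth)
    then have "mset (map (\<lambda>i. nu ! i) [0..<d]) = mset (map nu' [0..<d])" using numset by simp
    from weighted_op_reorder[OF u0(1) this] obtain u where u: "onb d u"
      "\<And>w. weighted_op d (\<lambda>i. w (nu ! i)) u0 = weighted_op d (\<lambda>i. w (nu' i)) u" by blast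
    have S: "real_weighted_op d (\<lambda>i. lam ! i) h + frame_op d F1 = real_weighted_op d (\<lambda>i. if i < R then lam ! i else c) u"
      using u0(2) u(2)[of complex_of_real] sum_ops[OF D(1)] h(2) by (simp add: nu'_def)
    have Rk': "R = rho \<or> length F1 + R \<le> d" using Rk D(2) by auto
    obtain hs where hs: "onb d hs" "real_weighted_op d (\<lambda>i. lam ! i) h = real_weighted_op d (\<lambda>i. lam ! i) hs"
      "frame_op d F1 = real_weighted_op d (\<lambda>i. if i < R then 0 else c - lam ! i) hs"
      using optimal_operator_structure[OF h(1) u(1) D(1) S lam_mono rho(1) less_imp_le[OF rho(2)] rho(3,4) Rk']
      by blast
    then show ?thesis using eigenbasis_iff[OF S0c] h(2) opt[OF hs(1)] by (auto simp: B_def)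
  qed
  have converse: "eigs (frame_op d (F0 @ F1)) = nu"
    if F1: "F0 @ F1 \<in> completions d F0 a" and hs: "eigenbasis d S0 lam hs" "frame_op d F1 = opt_op d r mu hs" for F1 hs
    using opt_eigs(2)[OF completionD(1)[OF F1]] hs eigenbasis_iff[OF S0c] opt by metis
  obtain G1 where G1: "F0 @ G1 \<in> completions d F0 a" "frame_op d G1 = B h" using ex by blast
  have hb: "eigenbasis d S0 lam h" using eigenbasis_iff[OF S0c] h by blast
  have G1nu: "eigs (frame_op d (F0 @ G1)) = nu" using converse[OF G1(1) hb] G1(2) opt[OF h(1)] by simp
  have part1: "nu \<in> completion_spectra d F0 a"
    unfolding completion_spectra_def completion_ops_def using G1(1) G1nu by (metis imageI)
  have part2: "nu \<prec>\<^sub>m beta" if "beta \<in> completion_spectra d F0 a" for beta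
    using that minimal completionE unfolding completion_spectra_def completion_ops_def by blast
  have part3: "eigs (frame_op d (F0 @ F1)) = nu \<longleftrightarrow> (\<forall>S \<in> completion_ops d F0 a. mat_majorized (frame_op d (F0 @ F1)) S)"
    if F1: "F0 @ F1 \<in> completions d F0 a" for F1
  proof
    assume "eigs (frame_op d (F0 @ F1)) = nu"
    then show "\<forall>S \<in> completion_ops d F0 a. mat_majorized (frame_op d (F0 @ F1)) S"
      using part2 by (auto simp: mat_majorized_def completion_spectra_def)
  next
    \<comment> \<open>The comparison with the completion by \<open>G1\<close>, whose spectrum is
      \<open>nu\<close>, gives the reverse majorization; on sorted lists majorization is
      antisymmetric.\<close>
    assume "\<forall>S \<in> completion_ops d F0 a. mat_majorized (frame_op d (F0 @ F1)) S"
    then have "eigs (frame_op d (F0 @ F1)) \<prec>\<^sub>m nu"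
      using G1 G1nu by (auto simp: mat_majorized_def completion_ops_def)
    then show "eigs (frame_op d (F0 @ F1)) = nu"
      using majorized_antisym_sorted[OF eigs_len[OF F1] nulen sorted_eigs nusorted] minimal[OF F1] by blast
  qed

  \<comment> \<open>Independence of the eigenbasis\<close>
  have part4: "opt_op d r mu hs = opt_op d r mu hs'"
    if cond: "m \<le> 0 \<or> (m \<ge> 1 \<and> lam ! (nat m - 1) > lam ! nat m) \<or> (m \<ge> 1 \<and> lam ! (nat m - 1) = lam ! nat m \<and> t \<le> s_star lam m)"
      and hs: "eigenbasis d S0 lam hs" "eigenbasis d S0 lam hs'" for hs hs'
  proof -
    have o: "onb d hs" "onb d hs'" "real_weighted_op d (\<lambda>i. lam ! i) hs = real_weighted_op d (\<lambda>i. lam ! i) hs'"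
      using hs eigenbasis_iff[OF S0c] by auto
    \<comment> \<open>The function \<open>g\<close> must tell kept from raised eigenvalues by their
      value alone. If \<open>R = rho\<close>, the threshold is \<open>c\<close>. Otherwise it is
      \<open>lam ! R\<close>, and only the strict gap in \<open>cond\<close> is left, since the
      other alternatives force \<open>R = rho\<close>.\<close>
    obtain g :: "real \<Rightarrow> real" where g: "\<And>i. i < d \<Longrightarrow> g (lam ! i) = (if i < R then 0 else c - lam ! i)"
    proof (cases "R = rho")
      case True
      show thesis
        by (rule that[of "\<lambda>x. if x > c then 0 else c - x"]) (use True rho(3,4) in \<open>force simp: not_less\<close>)
    next
      case False
      then have R: "R + k = d" "R = nat m" "m \<ge> 1" using Rk m rho by auto
      then have gap: "lam ! R < lam ! (R - 1)" using cond unique False by auto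
      have "lam ! R < lam ! i" if "i < R" for i
      proof -
        have "i \<le> R - 1" "R - 1 < d" using that rho(2) by auto
        then show ?thesis using gap lam_mono[of i "R - 1"] by linarith
      qed
      moreover have "lam ! i \<le> lam ! R" if "R \<le> i" "i < d" for i using lam_mono that .
      ultimately show thesis
        by (intro that[of "\<lambda>x. if x > lam ! R then 0 else c - x"]) (force simp: not_less)
    qed
    have "B v = real_weighted_op d (\<lambda>i. g (lam ! i)) v" if "onb d v" for v
      unfolding B_def by (rule weighted_op_cong) (use g onb_length[OF that] in simp)
    then show ?thesis using weighted_op_fun_unique[OF o, of g] opt o by simp
  qed
  show ?thesis
  proof (intro conjI allI ballI impI)
    show "nu \<in> completion_spectra d F0 a" by (rule part1)
    show "nu \<prec>\<^sub>m beta" if "beta \<in> completion_spectra d F0 a" for beta using part2[OF that] .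
    fix F1 assume F1: "F0 @ F1 \<in> completions d F0 a"
    show "eigs (frame_op d (F0 @ F1)) = nu \<longleftrightarrow> (\<forall>S \<in> completion_ops d F0 a. mat_majorized (frame_op d (F0 @ F1)) S)"
      by (rule part3[OF F1])
    show "eigs (frame_op d (F0 @ F1)) = nu \<longleftrightarrow> (\<exists>hs. eigenbasis d S0 lam hs \<and> frame_op d F1 = opt_op d r mu hs)"
      using optimal[OF F1] converse[OF F1] by blast
  next
    show "\<exists>F1 hs. F0 @ F1 \<in> completions d F0 a \<and> eigenbasis d S0 lam hs \<and> frame_op d F1 = opt_op d r mu hs"
      using G1 hb opt[OF h(1)] by metis
  next
    fix hs hs'
    assume "m \<le> 0 \<or> (m \<ge> 1 \<and> lam ! (nat m - 1) > lam ! nat m) \<or> (m \<ge> 1 \<and> lam ! (nat m - 1) = lam ! nat m \<and> t \<le> s_star lam m)"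
      and "eigenbasis d S0 lam hs" "eigenbasis d S0 lam hs'"
    then show "opt_op d r mu hs = opt_op d r mu hs'" by (rule part4)
  next
    fix hs F1
    assume *: "m \<le> 0 \<or> (m \<ge> 1 \<and> lam ! (nat m - 1) > lam ! nat m) \<or> (m \<ge> 1 \<and> lam ! (nat m - 1) = lam ! nat m \<and> t \<le> s_star lam m)"
      "eigenbasis d S0 lam hs" and F1: "F0 @ F1 \<in> completions d F0 a"
    show "eigs (frame_op d (F0 @ F1)) = nu \<longleftrightarrow> frame_op d F1 = opt_op d r mu hs"
      using optimal[OF F1] converse[OF F1] part4[OF *] *(2) by metis
  qed
qed

end
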